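(* Let $K\neq 0$ be real, let $(p,q)=(4,0)$ if $K>0$ and $(p,q)=(3,1)$ if $K<0$, and let $M=\{v\in\mathbb{R}^{p,q}\mid (v,v)=1/K\}$ be the (pseudo-)sphere of curvature $K$ in $\mathbb{R}^{p,q}$, with its induced Riemannian metric. Let $\Sigma$ be an oriented surface and let $x_0\colon\Sigma\to M$ be an immersion with constant mean curvature $H$ and unit normal $N\colon\Sigma\to\mathbb{R}^{p,q}$. Then the moment class of $x_0$ is represented by the $\Lambda^2\mathbb{R}^{p,q}$-valued $1$-form $(Kx_0-HN)\wedge *dx_0$ on $\Sigma$ (the moment form): $$\mu_{x_0}=\bigl[(Kx_0-HN)\wedge *dx_0\bigr]\in H^1(\Sigma,\mathbb{R})\otimes\Lambda^2\mathbb{R}^{p,q},$$ where $*$ is the Hodge star operator of $\Sigma$.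
   Context: $\mathbb{R}^{p,q}$ is $\mathbb{R}^{p+q}$ with a symmetric bilinear form $(\,,\,)$ with $p$ positive and $q$ negative directions. For $K<0$, $M$ has two components, each of which is a space form. The Hodge star on $1$-forms on $\Sigma$ is that of the metric induced by $x_0$ and the orientation of $\Sigma$, with the convention $*\omega=\omega\circ J$, where $J$ is rotation by $+\pi/2$ on $T\Sigma$. $M$ is oriented with volume form $\mathrm{vol}_M$. $\mathrm{vol}_{x_0}$ is the area form of the induced metric on $\Sigma$; $N$ is the unit normal to $x_0$ in $M$ with $x_0^*(i_N\mathrm{vol}_M)=\mathrm{vol}_{x_0}$; the mean curvature $H$ is half the trace of the second fundamental form with respect to $N$. The Lie algebra $\mathfrak{g}_M$ of Killing fields of $M$ is identified with $\Lambda^2\mathbb{R}^{p,q}$: $a\wedge b$ corresponds to the Killing field $v\mapsto (b,v)a-(a,v)b$. The dual $\mathfrak{g}_M^*$ is identified with $\Lambda^2\mathbb{R}^{p,q}$ using the metric on $\Lambda^2\mathbb{R}^{p,q}$ induced from that of $\mathbb{R}^{p,q}$, $(a\wedge b,c\wedge d)=(a,c)(b,d)-(a,d)(b,c)$. Moment class: for $Y\in\mathfrak{g}_M$ there is a $1$-form $\alpha_Y$ on $M$, unique up to exact forms, with $d\alpha_Y=i_Y\mathrm{vol}_M$. With $Y^\top$ the vector field on $\Sigma$ such that $Y\circ x_0-dx_0(Y^\top)$ is normal to $x_0$, the $1$-form $i_{Y^\top}\mathrm{vol}_{x_0}-2Hx_0^*\alpha_Y$ is closed, and $\mu_{x_0}\in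 H^1(\Sigma,\mathbb{R})\otimes\mathfrak{g}_M^*$ is defined by $\mu_{x_0}(Y)=[i_{Y^\top}\mathrm{vol}_{x_0}-2Hx_0^*\alpha_Y]$.
   Formalization: The formal conclusion is K·μ = [(Kx₀−HN)∧*dx₀], i.e. the moment form represents μ under 1/K times the induced metric on Λ²; with the stated unscaled metric the identity fails for K≠1 (e.g. minimal Clifford torus). *)

theory Defs
  imports "HOL-Analysis.Analysis"
begin

subsection \<open>Smooth maps\<close>

primrec Ck_on :: "nat \<Rightarrow> 'a::euclidean_space set \<Rightarrow> ('a \<Rightarrow> 'b::real_normed_vector) \<Rightarrow> bool"
  where
    "Ck_on 0 S f \<longleftrightarrow> continuous_on S f"
  | "Ck_on (Suc k) S f \<longleftrightarrow> (\<forall>x\<in>S. f differentiable (at x)) \<and>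
       (\<forall>v. Ck_on k S (\<lambda>x. frechet_derivative f (at x) v))"

text \<open>Meant for open \<open>S\<close>.\<close>

definition smooth_on :: "'a::euclidean_space set \<Rightarrow> ('a \<Rightarrow> 'b::real_normed_vector) \<Rightarrow> bool"
  where "smooth_on S f \<longleftrightarrow> (\<forall>k. Ck_on k S f)"

text \<open>Smoothness on an arbitrary subset: locally the restriction of a smooth map on an open set.\<close>

definition smooth_on_subset :: "'a::euclidean_space set \<Rightarrow> ('a \<Rightarrow> 'b::real_normed_vector) \<Rightarrow> bool"
  where "smooth_on_subset S f \<longleftrightarrow>
    (\<forall>x\<in>S. \<exists>U F. open U \<and> x \<in> U \<and> smooth_on U F \<and> (\<forall>y\<in>S \<inter> U. f y = F y))"


subsection \<open>The space with form of signature (p,q), p + q = 4\<close>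

text \<open>The elements of the index type \<^typ>\<open>4\<close> are \<open>of_nat 0, \<dots>, of_nat 3\<close>
  (so \<open>4 = 0\<close>); the first \<open>p\<close> of them are the positive directions.\<close>

definition pq_form :: "nat \<Rightarrow> nat \<Rightarrow> real^4 \<Rightarrow> real^4 \<Rightarrow> real"
  where "pq_form p q v w =
    (\<Sum>i<p. v $ of_nat i * w $ of_nat i) - (\<Sum>i=p..<p+q. v $ of_nat i * w $ of_nat i)"

lemma pq_form_4_0: "pq_form 4 0 v w = v \<bullet> w"
proof -
  have "(4::4) = 0" by simp
  then have "v $ 4 * w $ 4 = v $ 0 * w $ 0" by (simp only:)
  then show ?thesis
    by (simp add: pq_form_def inner_vec_def sum_4 eval_nat_numeral)
qed

lemma pq_form_3_1:
  "pq_form 3 1 v w = v $ 0 * w $ 0 + v $ 1 * w $ 1 + v $ 2 * w $ 2 - v $ 3 * w $ 3"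
  by (simp add: pq_form_def eval_nat_numeral)

lemma bilinear_pq_form: "bilinear (pq_form p q)"
  unfolding bilinear_def
  by (auto intro!: linearI simp: pq_form_def sum.distrib sum_distrib_left algebra_simps)

lemma vec_expand: "u = (\<Sum>i\<in>UNIV. u $ i *\<^sub>R axis i 1)" for u :: "real^4"
  by (simp add: vec_eq_iff axis_def if_distrib cong: if_cong)

lemma pq_form_expand_left:
  "pq_form p q v w = (\<Sum>i\<in>UNIV. v $ i * pq_form p q (axis i 1) w)"
proof -
  interpret linear "\<lambda>u. pq_form p q u w"
    using bilinear_pq_form unfolding bilinear_def by blast
  show ?thesis
    by (subst vec_expand[of v]) (simp add: sum scale)
qed

lemma pq_form_expand:
  "pq_form p q v w = (\<Sum>i\<in>UNIV. \<Sum>k\<in>UNIV. v $ i * w $ k * pq_form p q (axis i 1) (axis k 1))"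
proof -
  have "pq_form p q u w = (\<Sum>k\<in>UNIV. w $ k * pq_form p q u (axis k 1))" for u
  proof -
    interpret linear "pq_form p q u"
      using bilinear_pq_form unfolding bilinear_def by blast
    show ?thesis
      by (subst vec_expand[of w]) (simp add: sum scale)
  qed
  then show ?thesis
    by (subst pq_form_expand_left) (simp add: sum_distrib_left mult.assoc)
qed

text \<open>\<open>\<Lambda>\<^sup>2 \<real>\<^sup>4\<close> as the space of antisymmetric matrices, \<open>a \<and> b = a b\<^sup>T - b a\<^sup>T\<close>.\<close>

definition bivectors :: "(real^4^4) set"
  where "bivectors = {Y. transpose Y = - Y}"

definition wedge :: "real^4 \<Rightarrow> real^4 \<Rightarrow> real^4^4"
  where "wedge a b = (\<chi> i j. a $ i * b $ j - b $ i * a $ j)"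

definition bivector_inner :: "nat \<Rightarrow> nat \<Rightarrow> real^4^4 \<Rightarrow> real^4^4 \<Rightarrow> real"
  where "bivector_inner p q Y Z =
    (\<Sum>i\<in>UNIV. \<Sum>j\<in>UNIV. \<Sum>k\<in>UNIV. \<Sum>l\<in>UNIV. Y $ i $ j * Z $ k $ l *
       pq_form p q (axis i 1) (axis k 1) * pq_form p q (axis j 1) (axis l 1)) / 2"

definition killing_field :: "nat \<Rightarrow> nat \<Rightarrow> real^4^4 \<Rightarrow> real^4 \<Rightarrow> real^4"
  where "killing_field p q Y v =
    (\<Sum>i\<in>UNIV. \<Sum>j\<in>UNIV. (Y $ i $ j * pq_form p q (axis j 1) v) *\<^sub>R axis i 1)"

text \<open>The two definitions above are the (bi)linear extensions of the usual formulas on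
  decomposable bivectors:\<close>

lemma bivector_inner_wedge:
  "bivector_inner p q (wedge a b) (wedge c d) =
     pq_form p q a c * pq_form p q b d - pq_form p q a d * pq_form p q b c"
  unfolding bivector_inner_def pq_form_expand[of p q a] pq_form_expand[of p q b] wedge_def sum_4
  by simp algebra

lemma killing_field_wedge:
  "killing_field p q (wedge a b) v = pq_form p q b v *\<^sub>R a - pq_form p q a v *\<^sub>R b"
  unfolding pq_form_expand_left[of p q b] pq_form_expand_left[of p q a]
  by (simp add: vec_eq_iff killing_field_def wedge_def forall_4 sum_4 axis_def algebra_simps)


subsection \<open>The space form M\<close>

definition space_form :: "nat \<Rightarrow> nat \<Rightarrow> real \<Rightarrow> (real^4) set"
  where "space_form p q K = {v. pq_form p q v v = 1 / K}"

definition tangent :: "nat \<Rightarrow> nat \<Rightarrow> real^4 \<Rightarrow> (real^4) set"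
  where "tangent p q v = {w. pq_form p q v w = 0}"

definition tangent_proj :: "nat \<Rightarrow> nat \<Rightarrow> real \<Rightarrow> real^4 \<Rightarrow> real^4 \<Rightarrow> real^4"
  where "tangent_proj p q K v w = w - (K * pq_form p q v w) *\<^sub>R v"

text \<open>A differential form on \<open>M\<close> takes the base point as its first argument; only its values on
  tangent vectors are meaningful. A volume form of \<open>M\<close> (equivalently, an orientation of \<open>M\<close>) is a
  smooth 3-form with values \<open>\<plusminus>1\<close> on orthonormal bases of tangent spaces.\<close>

definition volume_form :: "nat \<Rightarrow> nat \<Rightarrow> real \<Rightarrow>
    (real^4 \<Rightarrow> real^4 \<Rightarrow> real^4 \<Rightarrow> real^4 \<Rightarrow> real) \<Rightarrow> bool"
  where "volume_form p q K vol \<longleftrightarrow>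
    (\<forall>v \<in> space_form p q K.
       (\<forall>u\<in>tangent p q v. \<forall>u'\<in>tangent p q v. \<forall>w\<in>tangent p q v. \<forall>z\<in>tangent p q v. \<forall>r s.
          vol v (r *\<^sub>R u + s *\<^sub>R u') w z = r * vol v u w z + s * vol v u' w z \<and>
          vol v u w z = - vol v w u z \<and> vol v u w z = - vol v u z w) \<and>
       (\<forall>u\<in>tangent p q v. \<forall>w\<in>tangent p q v. \<forall>z\<in>tangent p q v.
          pq_form p q u u = 1 \<and> pq_form p q w w = 1 \<and> pq_form p q z z = 1 \<and>
          pq_form p q u w = 0 \<and> pq_form p q u z = 0 \<and> pq_form p q w z = 0 \<longrightarrow>
          \<bar>vol v u w z\<bar> = 1)) \<and>
    (\<forall>a b c. smooth_on_subset (space_form p q K)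
       (\<lambda>v. vol v (tangent_proj p q K v a) (tangent_proj p q K v b) (tangent_proj p q K v c)))"

text \<open>\<open>\<alpha>\<close> is a smooth 1-form on \<open>M\<close> with \<open>d\<alpha> = \<beta>\<close>: near every point \<open>\<alpha>\<close> is the restriction to \<open>M\<close> of
  a smooth 1-form \<open>w \<mapsto> A y \<bullet> w\<close> on an open set, and \<open>\<beta>\<close> is the restriction of the exterior
  derivative of the latter.\<close>

definition primitive_on :: "nat \<Rightarrow> nat \<Rightarrow> real \<Rightarrow> (real^4 \<Rightarrow> real^4 \<Rightarrow> real) \<Rightarrow>
    (real^4 \<Rightarrow> real^4 \<Rightarrow> real^4 \<Rightarrow> real) \<Rightarrow> bool"
  where "primitive_on p q K \<alpha> \<beta> \<longleftrightarrow>
    (\<forall>v \<in> space_form p q K. \<exists>U (A :: real^4 \<Rightarrow> real^4). open U \<and> v \<in> U \<and> smooth_on U A \<and>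
       (\<forall>y \<in> space_form p q K \<inter> U.
          (\<forall>w \<in> tangent p q y. \<alpha> y w = A y \<bullet> w) \<and>
          (\<forall>u \<in> tangent p q y. \<forall>w \<in> tangent p q y.
             \<beta> y u w = frechet_derivative A (at y) u \<bullet> w - frechet_derivative A (at y) w \<bullet> u)))"


subsection \<open>Oriented surfaces and their 1-forms\<close>

text \<open>A chart is its domain together with the coordinate map.\<close>

type_synonym 'a chart = "'a set \<times> ('a \<Rightarrow> real^2)"

definition chart_inv :: "'a chart \<Rightarrow> real^2 \<Rightarrow> 'a"
  where "chart_inv c = inv_into (fst c) (snd c)"

definition chart_diff :: "('a \<Rightarrow> 'v::real_normed_vector) \<Rightarrow> 'a chart \<Rightarrow> 'a \<Rightarrow> real^2 \<Rightarrow> 'v"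
  where "chart_diff f c x = frechet_derivative (f \<circ> chart_inv c) (at (snd c x))"

definition area2 :: "real^2 \<Rightarrow> real^2 \<Rightarrow> real"
  where "area2 \<xi> \<eta> = \<xi> $ 1 * \<eta> $ 2 - \<xi> $ 2 * \<eta> $ 1"

definition oriented_surface :: "'a topology \<Rightarrow> 'a chart set \<Rightarrow> bool"
  where "oriented_surface X \<A> \<longleftrightarrow>
    Hausdorff_space X \<and> second_countable X \<and> (\<Union>c\<in>\<A>. fst c) = topspace X \<and>
    (\<forall>c\<in>\<A>. openin X (fst c) \<and> open (snd c ` fst c) \<and>
       homeomorphic_map (subtopology X (fst c)) (top_of_set (snd c ` fst c)) (snd c)) \<and>
    (\<forall>c\<in>\<A>. \<forall>c'\<in>\<A>. smooth_on (snd c ` (fst c \<inter> fst c')) (snd c' \<circ> chart_inv c) \<and>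
       (\<forall>x \<in> fst c \<inter> fst c'.
          area2 (chart_diff (snd c') c x (axis 1 1)) (chart_diff (snd c') c x (axis 2 1)) > 0))"

definition smooth_fun :: "'a chart set \<Rightarrow> ('a \<Rightarrow> 'v::real_normed_vector) \<Rightarrow> bool"
  where "smooth_fun \<A> f \<longleftrightarrow> (\<forall>c\<in>\<A>. smooth_on (snd c ` fst c) (f \<circ> chart_inv c))"

text \<open>A tangent vector at \<open>x\<close> is given by its coordinates \<open>\<xi>\<close> in a chart \<open>c\<close> around \<open>x\<close>, and
  \<open>\<omega> c x \<xi>\<close> is the value of the 1-form \<open>\<omega>\<close> on it; \<open>chart_diff f\<close> is the 1-form \<open>df\<close>. Values with
  \<open>c \<notin> \<A>\<close> or \<open>x \<notin> fst c\<close> are meaningless.\<close>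

type_synonym ('a, 'v) form1 = "'a chart \<Rightarrow> 'a \<Rightarrow> real^2 \<Rightarrow> 'v"

definition one_form :: "'a chart set \<Rightarrow> ('a, 'v::real_normed_vector) form1 \<Rightarrow> bool"
  where "one_form \<A> \<omega> \<longleftrightarrow>
    (\<forall>c\<in>\<A>. \<forall>x\<in>fst c. linear (\<omega> c x)) \<and>
    (\<forall>c\<in>\<A>. \<forall>c'\<in>\<A>. \<forall>x \<in> fst c \<inter> fst c'. \<forall>\<xi>. \<omega> c x \<xi> = \<omega> c' x (chart_diff (snd c') c x \<xi>)) \<and>
    (\<forall>c\<in>\<A>. \<forall>\<xi>. smooth_on (snd c ` fst c) (\<lambda>u. \<omega> c (chart_inv c u) \<xi>))"

definition ext_deriv :: "('a, 'v::real_normed_vector) form1 \<Rightarrow> 'a chart \<Rightarrow> 'a \<Rightarrow>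
    real^2 \<Rightarrow> real^2 \<Rightarrow> 'v"
  where "ext_deriv \<omega> c x \<xi> \<eta> =
    chart_diff (\<lambda>y. \<omega> c y \<eta>) c x \<xi> - chart_diff (\<lambda>y. \<omega> c y \<xi>) c x \<eta>"

definition closed_form :: "'a chart set \<Rightarrow> ('a, 'v::real_normed_vector) form1 \<Rightarrow> bool"
  where "closed_form \<A> \<omega> \<longleftrightarrow> one_form \<A> \<omega> \<and>
    (\<forall>c\<in>\<A>. \<forall>x\<in>fst c. \<forall>\<xi> \<eta>. ext_deriv \<omega> c x \<xi> \<eta> = 0)"

definition exact_form :: "'a chart set \<Rightarrow> ('a, 'v::real_normed_vector) form1 \<Rightarrow> bool"
  where "exact_form \<A> \<omega> \<longleftrightarrow>
    (\<exists>f. smooth_fun \<A> f \<and> (\<forall>c\<in>\<A>. \<forall>x\<in>fst c. \<forall>\<xi>. \<omega> c x \<xi> = chart_diff f c x \<xi>))"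

text \<open>The de Rham class of \<open>\<omega>\<close>; this is the empty set if \<open>\<omega>\<close> is not a closed 1-form.\<close>

definition H1_class :: "'a chart set \<Rightarrow> ('a, real) form1 \<Rightarrow> ('a, real) form1 set"
  where "H1_class \<A> \<omega> =
    {\<eta>. closed_form \<A> \<eta> \<and> exact_form \<A> (\<lambda>c x \<xi>. \<eta> c x \<xi> - \<omega> c x \<xi>)}"


subsection \<open>Immersions into M\<close>

definition immersion_into :: "nat \<Rightarrow> nat \<Rightarrow> real \<Rightarrow> 'a topology \<Rightarrow> 'a chart set \<Rightarrow>
    ('a \<Rightarrow> real^4) \<Rightarrow> bool"
  where "immersion_into p q K X \<A> x0 \<longleftrightarrow>
    smooth_fun \<A> x0 \<and> x0 ` topspace X \<subseteq> space_form p q K \<and>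
    (\<forall>c\<in>\<A>. \<forall>x\<in>fst c. inj (chart_diff x0 c x))"

definition induced_metric :: "nat \<Rightarrow> nat \<Rightarrow> ('a \<Rightarrow> real^4) \<Rightarrow> 'a chart \<Rightarrow> 'a \<Rightarrow>
    real^2 \<Rightarrow> real^2 \<Rightarrow> real"
  where "induced_metric p q x0 c x \<xi> \<eta> =
    pq_form p q (chart_diff x0 c x \<xi>) (chart_diff x0 c x \<eta>)"

definition bilin_matrix :: "(real^2 \<Rightarrow> real^2 \<Rightarrow> real) \<Rightarrow> real^2^2"
  where "bilin_matrix b = (\<chi> i j. b (axis i 1) (axis j 1))"

text \<open>Charts being oriented, this is \<open>\<surd>(det g) dx \<and> dy\<close>.\<close>

definition area_form :: "nat \<Rightarrow> nat \<Rightarrow> ('a \<Rightarrow> real^4) \<Rightarrow> 'a chart \<Rightarrow> 'a \<Rightarrow>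
    real^2 \<Rightarrow> real^2 \<Rightarrow> real"
  where "area_form p q x0 c x \<xi> \<eta> =
    sqrt (det (bilin_matrix (induced_metric p q x0 c x))) * area2 \<xi> \<eta>"

text \<open>Rotation by \<open>+\<pi>/2\<close> on the tangent spaces of the surface.\<close>

definition rot :: "nat \<Rightarrow> nat \<Rightarrow> ('a \<Rightarrow> real^4) \<Rightarrow> 'a chart \<Rightarrow> 'a \<Rightarrow> real^2 \<Rightarrow> real^2"
  where "rot p q x0 c x = (THE J. linear J \<and>
    (\<forall>\<xi>. induced_metric p q x0 c x (J \<xi>) (J \<xi>) = induced_metric p q x0 c x \<xi> \<xi> \<and>
         induced_metric p q x0 c x \<xi> (J \<xi>) = 0 \<and> (\<xi> \<noteq> 0 \<longrightarrow> area2 \<xi> (J \<xi>) > 0)))"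

definition hodge_star :: "nat \<Rightarrow> nat \<Rightarrow> ('a \<Rightarrow> real^4) \<Rightarrow> ('a, 'v) form1 \<Rightarrow> ('a, 'v) form1"
  where "hodge_star p q x0 \<omega> c x \<xi> = \<omega> c x (rot p q x0 c x \<xi>)"

definition unit_normal :: "nat \<Rightarrow> nat \<Rightarrow> 'a chart set \<Rightarrow>
    (real^4 \<Rightarrow> real^4 \<Rightarrow> real^4 \<Rightarrow> real^4 \<Rightarrow> real) \<Rightarrow> ('a \<Rightarrow> real^4) \<Rightarrow> ('a \<Rightarrow> real^4) \<Rightarrow> bool"
  where "unit_normal p q \<A> vol x0 N \<longleftrightarrow> smooth_fun \<A> N \<and>
    (\<forall>c\<in>\<A>. \<forall>x\<in>fst c. N x \<in> tangent p q (x0 x) \<and> pq_form p q (N x) (N x) = 1 \<and>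
       (\<forall>\<xi>. pq_form p q (N x) (chart_diff x0 c x \<xi>) = 0) \<and>
       (\<forall>\<xi> \<eta>. vol (x0 x) (N x) (chart_diff x0 c x \<xi>) (chart_diff x0 c x \<eta>) =
          area_form p q x0 c x \<xi> \<eta>))"

text \<open>\<open>II(\<xi>,\<eta>) = (\<nabla>\<^sub>\<xi> dx0(\<eta>), N)\<close>. As \<open>N\<close> is tangent to \<open>M\<close>, the Levi-Civita connection of \<open>M\<close> may be
  replaced by the flat ambient one, and as \<open>N\<close> is normal to the surface, \<open>\<eta>\<close> may be extended by
  constant coordinates.\<close>

definition second_fund_form :: "nat \<Rightarrow> nat \<Rightarrow> ('a \<Rightarrow> real^4) \<Rightarrow> ('a \<Rightarrow> real^4) \<Rightarrow> 'a chart \<Rightarrow> 'a \<Rightarrow>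
    real^2 \<Rightarrow> real^2 \<Rightarrow> real"
  where "second_fund_form p q x0 N c x \<xi> \<eta> =
    pq_form p q (chart_diff (\<lambda>y. chart_diff x0 c y \<eta>) c x \<xi>) (N x)"

definition mean_curvature :: "nat \<Rightarrow> nat \<Rightarrow> ('a \<Rightarrow> real^4) \<Rightarrow> ('a \<Rightarrow> real^4) \<Rightarrow> 'a chart \<Rightarrow> 'a \<Rightarrow> real"
  where "mean_curvature p q x0 N c x =
    trace (matrix_inv (bilin_matrix (induced_metric p q x0 c x)) **
           bilin_matrix (second_fund_form p q x0 N c x)) / 2"


subsection \<open>Moment class and moment form\<close>

definition tangent_part :: "nat \<Rightarrow> nat \<Rightarrow> ('a \<Rightarrow> real^4) \<Rightarrow> real^4^4 \<Rightarrow> 'a chart \<Rightarrow> 'a \<Rightarrow> real^2"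
  where "tangent_part p q x0 Y c x = (THE \<tau>. \<forall>\<xi>.
    pq_form p q (killing_field p q Y (x0 x) - chart_diff x0 c x \<tau>) (chart_diff x0 c x \<xi>) = 0)"

text \<open>The choice of \<open>\<alpha>\<close> is immaterial: it is unique up to exact forms.\<close>

definition moment_class :: "nat \<Rightarrow> nat \<Rightarrow> real \<Rightarrow> (real^4 \<Rightarrow> real^4 \<Rightarrow> real^4 \<Rightarrow> real^4 \<Rightarrow> real) \<Rightarrow>
    'a chart set \<Rightarrow> ('a \<Rightarrow> real^4) \<Rightarrow> real \<Rightarrow> real^4^4 \<Rightarrow> ('a, real) form1 set"
  where "moment_class p q K vol \<A> x0 H Y =
    (let \<alpha> = (SOME \<alpha>. primitive_on p q K \<alpha> (\<lambda>v. vol v (killing_field p q Y v)))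
     in H1_class \<A> (\<lambda>c x \<xi>. area_form p q x0 c x (tangent_part p q x0 Y c x) \<xi>
                             - 2 * H * \<alpha> (x0 x) (chart_diff x0 c x \<xi>)))"

text \<open>A \<open>\<Lambda>\<^sup>2\<close>-valued 1-form acts on Killing fields via \<^const>\<open>bivector_inner\<close>. With this normalisation
  the moment form paired with \<open>Y\<close> is \<open>K\<close> times a representative of \<open>\<mu>(Y)\<close>. For instance, for the
  minimal Clifford torus \<open>x0 = r/\<surd>2 (e\<^sup>i\<^sup>s, e\<^sup>i\<^sup>t)\<close>, \<open>K = 1/r\<^sup>2\<close>, orientation \<open>ds \<and> dt\<close>, and
  \<open>Y = e\<^sub>1 \<and> e\<^sub>2\<close>, the form representing
  \<open>\<mu>(Y)\<close> is \<open>- r\<^sup>2/2 dt\<close>, whereas the moment form pairs with \<open>Y\<close> to \<open>- 1/2 dt\<close>. The \<open>\<Lambda>\<^sup>2\<close>-valued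
  form therefore represents the moment class under the pairing \<open>bivector_inner / K\<close>.\<close>

definition moment_form :: "nat \<Rightarrow> nat \<Rightarrow> real \<Rightarrow> ('a \<Rightarrow> real^4) \<Rightarrow> real \<Rightarrow> ('a \<Rightarrow> real^4) \<Rightarrow>
    ('a, real^4^4) form1"
  where "moment_form p q K x0 H N c x \<xi> =
    wedge (K *\<^sub>R x0 x - H *\<^sub>R N x) (hodge_star p q x0 (chart_diff x0) c x \<xi>)"

end

theory Submission
  imports Defs
begin

text \<open>On the tangent spaces of \<open>M\<close> the volume form is \<open>\<kappa> det(v, -, -, -)\<close> with \<open>\<kappa>\<close> locally constant and
  \<open>\<kappa>\<^sup>2 = \<bar>K\<bar>\<close>, so that \<open>\<alpha>(w) = - \<kappa>/(2K) det(Y, v, w)\<close> (with \<open>Y = a \<and> b\<close> filling two rows) is a primitive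
  of the contraction of \<open>vol\<close> with the Killing field of \<open>Y\<close>. For this primitive, evaluating everything
  in the orthogonal frame \<open>x\<^sub>0, N, dx\<^sub>0(\<xi>), *dx\<^sub>0(\<xi>)\<close> shows that the form defining the moment class equals
  the moment form paired with \<open>Y\<close>. Any other primitive differs by a closed 1-form on \<open>M\<close>, which is
  exact because the cone over \<open>M\<close> is the union of two starlike open sets with connected intersection.
  The moment form is closed because \<open>d * dx\<^sub>0\<close> is a multiple of \<open>K x\<^sub>0 - H N\<close> (constant mean
  curvature) and the shape operator is symmetric.\<close>

section \<open>Smooth maps\<close>

text \<open>The moment class is built from a primitive picked by choice, so one computable primitive
  is not enough: H^1(M) = 0 is needed as well, and passing to the cone reduces this to calculus on
  open subsets of R^4. The computable primitive rests on the vanishing of the determinant of four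
  vectors tangent at \<open>v\<close>. For Y = \<open>wedge a b\<close> this turns det(v, Y v, u, w)
  into - det(a, b, u, w) / K, a 2-form with constant coefficients, and half of its contraction with
  the position vector is a primitive; hence the constant - \<kappa>/(2K). For K < 0 the two sheets
  of M can be oriented independently, so \<kappa> is constant only locally.\<close>

lemma Ck_on_cong:
  assumes "open S" "\<And>x. x \<in> S \<Longrightarrow> f x = g x" "Ck_on k S f"
  shows "Ck_on k S g"
  using assms(2,3)
proof (induction k arbitrary: f g)
  case 0
  then show ?case by (metis Ck_on.simps(1) continuous_on_cong)
next
  case (Suc k)
  have d: "(g has_derivative frechet_derivative f (at x)) (at x)" if "x \<in> S" for x
    using Suc.prems that assms(1)
    by (metis Ck_on.simps(2) frechet_derivative_works has_derivative_transform_within_open)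
  have "Ck_on k S (\<lambda>x. frechet_derivative g (at x) v)" for v
  proof (rule Suc.IH)
    show "Ck_on k S (\<lambda>x. frechet_derivative f (at x) v)" using Suc.prems by simp
    show "frechet_derivative f (at x) v = frechet_derivative g (at x) v" if "x \<in> S" for x
      using d[OF that] by (metis frechet_derivative_at)
  qed
  with d show ?case by (auto simp: differentiable_def)
qed

lemma Ck_on_subset: "Ck_on k S f \<Longrightarrow> T \<subseteq> S \<Longrightarrow> Ck_on k T f"
  by (induction k arbitrary: f) (auto intro: continuous_on_subset)

text \<open>Lets the derivative be given by a formula: \<open>frechet_derivative\<close> agrees with
  it on the open set only, which is what \<open>Ck_on_cong\<close> bridges.\<close>

lemma Ck_on_SucI:
  assumes "open S" "\<And>x. x \<in> S \<Longrightarrow> (f has_derivative f' x) (at x)"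
    "\<And>v. Ck_on k S (\<lambda>x. f' x v)"
  shows "Ck_on (Suc k) S f"
proof -
  have "Ck_on k S (\<lambda>x. frechet_derivative f (at x) v)" for v
    by (rule Ck_on_cong[OF assms(1) _ assms(3)[of v]])
      (use assms(2) frechet_derivative_at in metis)
  with assms(2) show ?thesis by (auto simp: differentiable_def)
qed

lemma Ck_on_SucD: "Ck_on (Suc k) S f \<Longrightarrow> Ck_on k S f"
proof (induction k arbitrary: f)
  case 0
  then show ?case
    by (auto intro!: continuous_at_imp_continuous_on differentiable_imp_continuous_within)
next
  case (Suc k)
  then show ?case by (metis Ck_on.simps(2))
qed

lemma Ck_on_Suc_has_derivative:
  "Ck_on (Suc k) S f \<Longrightarrow> x \<in> S \<Longrightarrow> (f has_derivative frechet_derivative f (at x)) (at x)"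
  by (simp add: frechet_derivative_works[symmetric])

lemma Ck_on_const: "open S \<Longrightarrow> Ck_on k S (\<lambda>x. c)"
proof (induction k arbitrary: c)
  case (Suc k)
  then show ?case by (intro Ck_on_SucI[where f'="\<lambda>_ _. 0"]) auto
qed simp

lemma Ck_on_add:
  assumes "open S" "Ck_on k S f" "Ck_on k S g"
  shows "Ck_on k S (\<lambda>x. f x + g x)"
  using assms(2,3)
proof (induction k arbitrary: f g)
  case 0
  then show ?case by (simp add: continuous_on_add)
next
  case (Suc k)
  show ?case
    by (rule Ck_on_SucI[OF assms(1) has_derivative_add])
      (use Suc in \<open>auto intro!: Ck_on_Suc_has_derivative[of k] Suc.IH\<close>)
qed

lemma Ck_on_sum:
  assumes "open S" "finite I" "\<And>i. i \<in> I \<Longrightarrow> Ck_on k S (f i)"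
  shows "Ck_on k S (\<lambda>x. \<Sum>i\<in>I. f i x)"
  using assms(2,3) by induction (auto intro!: Ck_on_add Ck_on_const assms(1))

text \<open>Covers products, inner products, scalar multiples and \<open>wedge\<close> at once. Each
  summand of the product rule keeps one factor undifferentiated; \<open>Ck_on_SucD\<close> lowers
  its order so that the induction hypothesis applies.\<close>

lemma Ck_on_bilinear:
  assumes "open S" "bounded_bilinear h" "Ck_on k S f" "Ck_on k S g"
  shows "Ck_on k S (\<lambda>x. h (f x) (g x))"
  using assms(3,4)
proof (induction k arbitrary: f g)
  case 0
  then show ?case by (simp add: bounded_bilinear.continuous_on[OF assms(2)])
next
  case (Suc k)
  show ?case
    by (rule Ck_on_SucI[OF assms(1) bounded_bilinear.FDERIV[OF assms(2)]])
      (use Suc.prems Ck_on_SucD[of k S f] Ck_on_SucD[of k S g] in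
        \<open>auto intro!: Ck_on_Suc_has_derivative[of k] Suc.IH Ck_on_add assms(1) simp del: Ck_on.simps,
         auto\<close>)
qed

lemma Ck_on_bounded_linear:
  assumes "open S" "bounded_linear h" "Ck_on k S f"
  shows "Ck_on k S (\<lambda>x. h (f x))"
  using assms(3)
proof (induction k arbitrary: f)
  case 0
  then show ?case by (simp add: bounded_linear.continuous_on[OF assms(2)])
next
  case (Suc k)
  show ?case
    by (rule Ck_on_SucI[OF assms(1) bounded_linear.has_derivative[OF assms(2)]])
      (use Suc in \<open>auto intro!: Ck_on_Suc_has_derivative[of k] Suc.IH\<close>)
qed

lemma linear_expand_basis:
  fixes L :: "'b::euclidean_space \<Rightarrow> 'c::real_vector"
  assumes "linear L"
  shows "L w = (\<Sum>b\<in>Basis. (w \<bullet> b) *\<^sub>R L b)"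
  by (subst euclidean_representation[of w, symmetric])
    (simp only: linear_sum[OF assms] linear_scale[OF assms])

text \<open>In the chain rule the direction in which \<open>f\<close> is differentiated varies with
  \<open>x\<close>. Expanding it in \<open>Basis\<close> gives products of scalar functions with
  derivatives of \<open>f\<close> in fixed directions, composed with \<open>g\<close>, and these are
  covered by the induction hypothesis.\<close>

lemma Ck_on_compose:
  fixes g :: "'a::euclidean_space \<Rightarrow> 'b::euclidean_space" and f :: "'b \<Rightarrow> 'c::real_normed_vector"
  assumes "open S" "open T" "g ` S \<subseteq> T" "Ck_on k T f" "Ck_on k S g"
  shows "Ck_on k S (\<lambda>x. f (g x))"
  using assms(4,5)
proof (induction k arbitrary: f)
  case 0
  then show ?case using assms(3) by (auto intro: continuous_on_compose2)
next
  case (Suc k)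
  let ?f' = "\<lambda>x v. \<Sum>b\<in>Basis. (frechet_derivative g (at x) v \<bullet> b) *\<^sub>R frechet_derivative f (at (g x)) b"
  show ?case
  proof (rule Ck_on_SucI[OF assms(1), where f'="?f'"])
    fix x assume x: "x \<in> S"
    then have g: "(g has_derivative frechet_derivative g (at x)) (at x)"
      using Suc.prems Ck_on_Suc_has_derivative by blast
    have "g x \<in> T" using x assms(3) by blast
    then have f: "(f has_derivative frechet_derivative f (at (g x))) (at (g x))"
      using Suc.prems Ck_on_Suc_has_derivative by blast
    have "frechet_derivative f (at (g x)) (frechet_derivative g (at x) v) = ?f' x v" for v
      by (rule linear_expand_basis) (use f has_derivative_linear in blast)
    with has_derivative_compose[OF g f] show "((\<lambda>x. f (g x)) has_derivative ?f' x) (at x)"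
      by (simp add: o_def)
  next
    fix v
    have "Ck_on k S (\<lambda>x. frechet_derivative f (at (g x)) b)" for b
      using Suc.prems Ck_on_SucD[of k S g] by (intro Suc.IH) auto
    then show "Ck_on k S (\<lambda>x. ?f' x v)"
      using Suc.prems
      by (auto intro!: Ck_on_sum assms(1) Ck_on_bilinear[OF assms(1) bounded_bilinear_scaleR]
          Ck_on_bounded_linear[OF assms(1) bounded_linear_inner_left])
  qed
qed

lemma smooth_on_cong:
  "open S \<Longrightarrow> (\<And>x. x \<in> S \<Longrightarrow> f x = g x) \<Longrightarrow> smooth_on S f \<Longrightarrow> smooth_on S g"
  using Ck_on_cong[of S f g] by (auto simp: smooth_on_def)

lemma smooth_on_subset: "smooth_on S f \<Longrightarrow> T \<subseteq> S \<Longrightarrow> smooth_on T f"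
  by (auto simp: smooth_on_def intro: Ck_on_subset)

lemma smooth_on_has_derivative:
  "smooth_on S f \<Longrightarrow> x \<in> S \<Longrightarrow> (f has_derivative frechet_derivative f (at x)) (at x)"
  unfolding smooth_on_def using Ck_on_Suc_has_derivative by blast

lemma smooth_on_frechet_derivative:
  "smooth_on S f \<Longrightarrow> smooth_on S (\<lambda>x. frechet_derivative f (at x) v)"
  unfolding smooth_on_def by (metis Ck_on.simps(2))

lemma smooth_on_continuous_on: "smooth_on S f \<Longrightarrow> continuous_on S f"
  unfolding smooth_on_def by (metis Ck_on.simps(1))

lemma smooth_onI:
  assumes "open S" "\<And>x. x \<in> S \<Longrightarrow> (f has_derivative f' x) (at x)"
    "\<And>v. smooth_on S (\<lambda>x. f' x v)"
  shows "smooth_on S f"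
  unfolding smooth_on_def
proof
  fix k show "Ck_on k S f"
    using Ck_on_SucI[OF assms(1,2)] assms(3) Ck_on_SucD unfolding smooth_on_def by blast
qed

lemma smooth_on_const: "open S \<Longrightarrow> smooth_on S (\<lambda>x. c)"
  by (simp add: smooth_on_def Ck_on_const)

lemma smooth_on_add:
  "open S \<Longrightarrow> smooth_on S f \<Longrightarrow> smooth_on S g \<Longrightarrow> smooth_on S (\<lambda>x. f x + g x)"
  by (simp add: smooth_on_def Ck_on_add)

lemma smooth_on_sum:
  "open S \<Longrightarrow> finite I \<Longrightarrow> (\<And>i. i \<in> I \<Longrightarrow> smooth_on S (f i)) \<Longrightarrow> smooth_on S (\<lambda>x. \<Sum>i\<in>I. f i x)"
  by (simp add: smooth_on_def Ck_on_sum)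

lemma smooth_on_bilinear:
  "bounded_bilinear h \<Longrightarrow> open S \<Longrightarrow> smooth_on S f \<Longrightarrow> smooth_on S g \<Longrightarrow> smooth_on S (\<lambda>x. h (f x) (g x))"
  by (simp add: smooth_on_def Ck_on_bilinear)

lemmas smooth_on_scaleR = smooth_on_bilinear[OF bounded_bilinear_scaleR]
lemmas smooth_on_mult = smooth_on_bilinear[OF bounded_bilinear_mult]
lemmas smooth_on_inner = smooth_on_bilinear[OF bounded_bilinear_inner]

lemma smooth_on_bounded_linear:
  "bounded_linear h \<Longrightarrow> open S \<Longrightarrow> smooth_on S f \<Longrightarrow> smooth_on S (\<lambda>x. h (f x))"
  by (simp add: smooth_on_def Ck_on_bounded_linear)

lemma smooth_on_minus:
  "open S \<Longrightarrow> smooth_on S f \<Longrightarrow> smooth_on S g \<Longrightarrow> smooth_on S (\<lambda>x. f x - g x)"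
  using smooth_on_add[of S f "\<lambda>x. - g x"]
    smooth_on_bounded_linear[OF bounded_linear_minus[OF bounded_linear_ident], of S g]
  by simp

lemma smooth_on_linear:
  assumes "linear f" "open S"
  shows "smooth_on S f"
  by (rule smooth_onI[OF assms(2) linear_imp_has_derivative])
    (use assms in \<open>auto intro: smooth_on_const\<close>)

lemma smooth_on_compose:
  fixes g :: "'a::euclidean_space \<Rightarrow> 'b::euclidean_space"
  shows "smooth_on T f \<Longrightarrow> open S \<Longrightarrow> open T \<Longrightarrow> g ` S \<subseteq> T \<Longrightarrow> smooth_on S g \<Longrightarrow>
    smooth_on S (\<lambda>x. f (g x))"
  unfolding smooth_on_def using Ck_on_compose by blast

text \<open>The family in \<open>c\<close> and \<open>s\<close> is closed under differentiation. It
  supplies the square roots of the Gram determinant and of the radial retraction.\<close>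

lemma smooth_on_powr: "smooth_on {0<..} (\<lambda>x::real. c * x powr s)"
  unfolding smooth_on_def
proof
  fix k show "Ck_on k {0<..} (\<lambda>x::real. c * x powr s)"
  proof (induction k arbitrary: c s)
    case 0
    then show ?case by (auto intro!: continuous_intros)
  next
    case (Suc k)
    show ?case
    proof (rule Ck_on_SucI[where f'="\<lambda>x v. (c * s * v) * x powr (s - 1)"])
      fix x :: real assume "x \<in> {0<..}"
      then show "((\<lambda>x. c * x powr s) has_derivative (\<lambda>v. (c * s * v) * x powr (s - 1))) (at x)"
        by (auto intro!: derivative_eq_intros simp: powr_diff field_simps)
    qed (use Suc in auto)
  qed
qed

text \<open>Both mixed partial derivatives at \<open>x\<close> are approximated by the second difference
  \<open>f (x + hu + hw) - f (x + hu) - f (x + hw) + f x\<close>, by applying the mean value theorem twice.\<close>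

lemma second_difference_mvt:
  fixes f :: "'a::euclidean_space \<Rightarrow> real"
  assumes "h > 0"
    and f: "\<And>s t. 0 \<le> s \<Longrightarrow> s \<le> h \<Longrightarrow> 0 \<le> t \<Longrightarrow> t \<le> h \<Longrightarrow>
      (f has_derivative f' (x + s *\<^sub>R u + t *\<^sub>R w)) (at (x + s *\<^sub>R u + t *\<^sub>R w))"
    and f': "\<And>s t. 0 \<le> s \<Longrightarrow> s \<le> h \<Longrightarrow> 0 \<le> t \<Longrightarrow> t \<le> h \<Longrightarrow>
      ((\<lambda>y. f' y u) has_derivative f'' (x + s *\<^sub>R u + t *\<^sub>R w)) (at (x + s *\<^sub>R u + t *\<^sub>R w))"
  shows "\<exists>s t. 0 < s \<and> s < h \<and> 0 < t \<and> t < h \<and>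
    f (x + h *\<^sub>R u + h *\<^sub>R w) - f (x + h *\<^sub>R u) - f (x + h *\<^sub>R w) + f x =
    h\<^sup>2 * f'' (x + s *\<^sub>R u + t *\<^sub>R w) w"
proof -
  let ?g = "\<lambda>s. f (x + s *\<^sub>R u + h *\<^sub>R w) - f (x + s *\<^sub>R u + 0 *\<^sub>R w)"
  have f_line: "((\<lambda>s. f (x + s *\<^sub>R u + t *\<^sub>R w)) has_real_derivative f' (x + s *\<^sub>R u + t *\<^sub>R w) u) (at s)"
    if "0 \<le> s" "s \<le> h" "0 \<le> t" "t \<le> h" for s t
  proof -
    have "((\<lambda>s. x + s *\<^sub>R u + t *\<^sub>R w) has_derivative (\<lambda>r. r *\<^sub>R u)) (at s)"
      by (auto intro!: derivative_eq_intros)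
    from has_derivative_compose[OF this f[OF that]]
    show ?thesis
      using has_derivative_linear[OF f[OF that]]
      unfolding has_field_derivative_def
      by (auto elim!: has_derivative_eq_rhs simp: linear_scale)
  qed
  have f'_line: "((\<lambda>t. f' (x + s *\<^sub>R u + t *\<^sub>R w) u) has_real_derivative f'' (x + s *\<^sub>R u + t *\<^sub>R w) w) (at t)"
    if "0 \<le> s" "s \<le> h" "0 \<le> t" "t \<le> h" for s t
  proof -
    have "((\<lambda>t. x + s *\<^sub>R u + t *\<^sub>R w) has_derivative (\<lambda>r. r *\<^sub>R w)) (at t)"
      by (auto intro!: derivative_eq_intros)
    from has_derivative_compose[OF this f'[OF that]]
    show ?thesis
      using has_derivative_linear[OF f'[OF that]]
      unfolding has_field_derivative_def
      by (auto elim!: has_derivative_eq_rhs simp: linear_scale)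
  qed
  have "\<exists>s. 0 < s \<and> s < h \<and>
      ?g h - ?g 0 = (h - 0) * (f' (x + s *\<^sub>R u + h *\<^sub>R w) u - f' (x + s *\<^sub>R u + 0 *\<^sub>R w) u)"
    by (rule MVT2[OF \<open>h > 0\<close>], rule DERIV_diff; rule f_line) (use \<open>h > 0\<close> in auto)
  then obtain s where s: "0 < s" "s < h"
      "?g h - ?g 0 = h * (f' (x + s *\<^sub>R u + h *\<^sub>R w) u - f' (x + s *\<^sub>R u + 0 *\<^sub>R w) u)"
    by auto
  have "\<exists>t. 0 < t \<and> t < h \<and> f' (x + s *\<^sub>R u + h *\<^sub>R w) u - f' (x + s *\<^sub>R u + 0 *\<^sub>R w) u =
      (h - 0) * f'' (x + s *\<^sub>R u + t *\<^sub>R w) w"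
    by (rule MVT2[OF \<open>h > 0\<close>], rule f'_line) (use s in auto)
  then obtain t where "0 < t" "t < h" "f' (x + s *\<^sub>R u + h *\<^sub>R w) u - f' (x + s *\<^sub>R u + 0 *\<^sub>R w) u =
      h * f'' (x + s *\<^sub>R u + t *\<^sub>R w) w"
    by auto
  with s show ?thesis by (intro exI[of _ s] exI[of _ t]) (simp add: power2_eq_square)
qed

lemma symmetric_second_derivative_real:
  fixes f :: "'a::euclidean_space \<Rightarrow> real"
  assumes "open S" "x \<in> S" "Ck_on 2 S f"
  shows "frechet_derivative (\<lambda>y. frechet_derivative f (at y) u) (at x) w =
         frechet_derivative (\<lambda>y. frechet_derivative f (at y) w) (at x) u"
proof (rule ccontr)
  define f' where "f' = (\<lambda>y. frechet_derivative f (at y))"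
  define g where "g u y = frechet_derivative (\<lambda>y. f' y u) (at y)" for u y
  \<comment> \<open>Half the gap between the two mixed derivatives: both approximated within
    \<open>e\<close> by a common value is a contradiction.\<close>
  define e where "e = \<bar>g u x w - g w x u\<bar> / 2"
  assume "\<not> ?thesis"
  then have "e > 0" by (simp add: e_def g_def f'_def)
  have C: "Ck_on (Suc (Suc 0)) S f" using assms(3) by (simp add: numeral_2_eq_2)
  have f: "(f has_derivative f' y) (at y)" if "y \<in> S" for y
    using Ck_on_Suc_has_derivative[OF C that] by (simp add: f'_def)
  have f': "((\<lambda>y. f' y a) has_derivative g a y) (at y)" if "y \<in> S" for y a
    using C that unfolding f'_def g_def by (auto simp: frechet_derivative_works)
  have "continuous_on S (\<lambda>y. g a y b)" for a b
    using C unfolding f'_def g_def by auto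
  then have cont: "isCont (\<lambda>y. g a y b) x" for a b
    using assms(1,2) continuous_on_eq_continuous_at by blast
  obtain d1 where d1: "d1 > 0" "\<And>y. dist y x < d1 \<Longrightarrow> dist (g u y w) (g u x w) < e"
    using cont[of u w] \<open>e > 0\<close> unfolding continuous_at_eps_delta by blast
  obtain d2 where d2: "d2 > 0" "\<And>y. dist y x < d2 \<Longrightarrow> dist (g w y u) (g w x u) < e"
    using cont[of w u] \<open>e > 0\<close> unfolding continuous_at_eps_delta by blast
  obtain d3 where d3: "d3 > 0" "ball x d3 \<subseteq> S"
    using assms(1,2) open_contains_ball by blast
  define d where "d = min d1 (min d2 d3)"
  have "d > 0" using d1 d2 d3 by (simp add: d_def)
  define h where "h = d / 2 / (norm u + norm w + 1)"
  have n: "norm u + norm w + 1 > 0" by (simp add: add_nonneg_pos)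
  then have "h > 0" using \<open>d > 0\<close> by (simp add: h_def)
  have near: "dist (x + s *\<^sub>R u + t *\<^sub>R w) x < d" if "0 \<le> s" "s \<le> h" "0 \<le> t" "t \<le> h" for s t
  proof -
    have "dist (x + s *\<^sub>R u + t *\<^sub>R w) x \<le> s * norm u + t * norm w"
      using norm_triangle_ineq[of "s *\<^sub>R u" "t *\<^sub>R w"] that by (simp add: dist_norm)
    also have "\<dots> \<le> h * (norm u + norm w + 1)"
      using mult_right_mono[OF that(2), of "norm u"] mult_right_mono[OF that(4), of "norm w"] \<open>h > 0\<close>
      by (simp add: algebra_simps)
    also have "\<dots> = d / 2" using n by (simp add: h_def del: distrib_left_numeral)
    finally show ?thesis using \<open>d > 0\<close> by simp
  qed
  then have inS: "x + s *\<^sub>R u + t *\<^sub>R w \<in> S" if "0 \<le> s" "s \<le> h" "0 \<le> t" "t \<le> h" for s t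
    using that d3 by (fastforce simp: d_def dist_commute)
  then have inS': "x + s *\<^sub>R w + t *\<^sub>R u \<in> S" if "0 \<le> s" "s \<le> h" "0 \<le> t" "t \<le> h" for s t
    using inS[OF that(3,4,1,2)] by (simp only: ac_simps)
  let ?D = "f (x + h *\<^sub>R u + h *\<^sub>R w) - f (x + h *\<^sub>R u) - f (x + h *\<^sub>R w) + f x"
  have "\<exists>s t. 0 < s \<and> s < h \<and> 0 < t \<and> t < h \<and> ?D = h\<^sup>2 * g u (x + s *\<^sub>R u + t *\<^sub>R w) w"
    by (rule second_difference_mvt[OF \<open>h > 0\<close>, where f'=f']) (rule f f', rule inS; assumption)+
  then obtain s t where st: "0 < s" "s < h" "0 < t" "t < h"
      "?D = h\<^sup>2 * g u (x + s *\<^sub>R u + t *\<^sub>R w) w"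
    by blast
  have "\<exists>s t. 0 < s \<and> s < h \<and> 0 < t \<and> t < h \<and>
      f (x + h *\<^sub>R w + h *\<^sub>R u) - f (x + h *\<^sub>R w) - f (x + h *\<^sub>R u) + f x =
      h\<^sup>2 * g w (x + s *\<^sub>R w + t *\<^sub>R u) u"
    by (rule second_difference_mvt[OF \<open>h > 0\<close>, where f'=f']) (rule f f', rule inS'; assumption)+
  then obtain s' t' where st': "0 < s'" "s' < h" "0 < t'" "t' < h"
      "f (x + h *\<^sub>R w + h *\<^sub>R u) - f (x + h *\<^sub>R w) - f (x + h *\<^sub>R u) + f x =
       h\<^sup>2 * g w (x + s' *\<^sub>R w + t' *\<^sub>R u) u"
    by blast
  have "x + h *\<^sub>R w + h *\<^sub>R u = x + h *\<^sub>R u + h *\<^sub>R w" by simp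
  with st'(5) have "?D = h\<^sup>2 * g w (x + s' *\<^sub>R w + t' *\<^sub>R u) u" by (simp only:)
  with st(5) \<open>h > 0\<close> have eq: "g u (x + s *\<^sub>R u + t *\<^sub>R w) w = g w (x + s' *\<^sub>R w + t' *\<^sub>R u) u" by simp
  have "dist (x + s *\<^sub>R u + t *\<^sub>R w) x < d1" using near[of s t] st by (simp add: d_def)
  note 1 = d1(2)[OF this]
  have "dist (x + t' *\<^sub>R u + s' *\<^sub>R w) x < d2" using near[of t' s'] st' by (simp add: d_def)
  then have "dist (x + s' *\<^sub>R w + t' *\<^sub>R u) x < d2" by (simp add: add.commute add.left_commute)
  note 2 = d2(2)[OF this]
  have "2 * e \<le> dist (g u (x + s *\<^sub>R u + t *\<^sub>R w) w) (g u x w) +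
      dist (g w (x + s' *\<^sub>R w + t' *\<^sub>R u) u) (g w x u)"
    using dist_triangle3[of "g u x w" "g w x u" "g w (x + s' *\<^sub>R w + t' *\<^sub>R u) u"]
    unfolding eq e_def by (simp add: dist_real_def)
  with 1 2 show False by linarith
qed

lemma symmetric_second_derivative:
  fixes f :: "'a::euclidean_space \<Rightarrow> 'b::euclidean_space"
  assumes "open S" "x \<in> S" "smooth_on S f"
  shows "frechet_derivative (\<lambda>y. frechet_derivative f (at y) u) (at x) w =
         frechet_derivative (\<lambda>y. frechet_derivative f (at y) w) (at x) u"
proof (rule euclidean_eqI)
  fix b :: 'b assume "b \<in> Basis"
  have inner: "frechet_derivative (\<lambda>y. h y \<bullet> b) (at y) a = frechet_derivative h (at y) a \<bullet> b"
    if "smooth_on S h" "y \<in> S" for h :: "'a \<Rightarrow> 'b" and y a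
    using has_derivative_inner_left[OF smooth_on_has_derivative[OF that], of b]
      frechet_derivative_at by metis
  have "frechet_derivative (\<lambda>y. frechet_derivative (\<lambda>y. f y \<bullet> b) (at y) a) (at x) c =
      frechet_derivative (\<lambda>y. frechet_derivative f (at y) a) (at x) c \<bullet> b" for a c
  proof -
    have "((\<lambda>y. frechet_derivative f (at y) a \<bullet> b) has_derivative
        frechet_derivative (\<lambda>y. frechet_derivative f (at y) a \<bullet> b) (at x)) (at x)"
      using smooth_on_bounded_linear[OF bounded_linear_inner_left assms(1)
          smooth_on_frechet_derivative[OF assms(3)], of a b]
      by (rule smooth_on_has_derivative) (rule assms(2))
    then have "((\<lambda>y. frechet_derivative (\<lambda>y. f y \<bullet> b) (at y) a) has_derivative
        frechet_derivative (\<lambda>y. frechet_derivative f (at y) a \<bullet> b) (at x)) (at x)"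
      by (rule has_derivative_transform_within_open[OF _ assms(1,2)]) (simp add: inner[OF assms(3)])
    from frechet_derivative_at[OF this] show ?thesis
      using inner[OF smooth_on_frechet_derivative[OF assms(3)] assms(2)] by metis
  qed
  moreover have "Ck_on 2 S (\<lambda>y. f y \<bullet> b)"
    using smooth_on_bounded_linear[OF bounded_linear_inner_left assms(1,3), of b]
    by (simp add: smooth_on_def)
  ultimately show "frechet_derivative (\<lambda>y. frechet_derivative f (at y) u) (at x) w \<bullet> b =
      frechet_derivative (\<lambda>y. frechet_derivative f (at y) w) (at x) u \<bullet> b"
    using symmetric_second_derivative_real[OF assms(1,2), of "\<lambda>y. f y \<bullet> b"] by metis
qed

section \<open>The Poincare lemma\<close>

text \<open>The potential is the integral of \<open>G\<close> along the segment from the centre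
  \<open>a\<close> to \<open>x\<close>, differentiated under the integral sign.\<close>

lemma poincare_lemma_starlike:
  fixes G :: "'a::euclidean_space \<Rightarrow> 'a"
  assumes "open S" "starlike S" "Ck_on 1 S G"
    and sym: "\<And>x u w. x \<in> S \<Longrightarrow>
      frechet_derivative G (at x) u \<bullet> w = frechet_derivative G (at x) w \<bullet> u"
  shows "\<exists>f. \<forall>x\<in>S. (f has_derivative (\<lambda>h. G x \<bullet> h)) (at x)"
proof -
  obtain a where a: "a \<in> S" "\<And>x. x \<in> S \<Longrightarrow> closed_segment a x \<subseteq> S"
    using assms(2) unfolding starlike_def by blast
  define z where "z x t = a + t *\<^sub>R (x - a)" for x and t :: real
  define G' where "G' x = frechet_derivative G (at x)" for x
  have zS: "z x t \<in> S" if "x \<in> S" "0 \<le> t" "t \<le> 1" for x t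
  proof -
    have "z x t = (1 - t) *\<^sub>R a + t *\<^sub>R x" by (simp add: z_def algebra_simps)
    then show ?thesis using a(2)[OF that(1)] that in_segment(1) by blast
  qed
  have G: "(G has_derivative G' x) (at x)" if "x \<in> S" for x
    using assms(3) that Ck_on_Suc_has_derivative[of 0 S G x] by (simp add: G'_def)
  then have contG: "continuous_on S G"
    by (auto intro!: continuous_at_imp_continuous_on has_derivative_continuous)
  have contG': "continuous_on S (\<lambda>x. G' x v)" for v
    using assms(3) by (simp add: G'_def)
  define F where "F x t = G (z x t) \<bullet> (x - a)" for x t
  \<comment> \<open>The derivative of the integrand in \<open>x\<close>, packed as a bounded linear
    function because \<open>leibniz_rule\<close> integrates derivatives of that type.\<close>
  define F' where "F' x t = Blinfun (\<lambda>h. t * (G' (z x t) h \<bullet> (x - a)) + G (z x t) \<bullet> h)" for x t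
  have F': "blinfun_apply (F' x t) = (\<lambda>h. t * (G' (z x t) h \<bullet> (x - a)) + G (z x t) \<bullet> h)"
    if "x \<in> S" "0 \<le> t" "t \<le> 1" for x t
    unfolding F'_def
    by (rule bounded_linear_Blinfun_apply)
      (use has_derivative_bounded_linear[OF G[OF zS[OF that]]] in
        \<open>auto intro!: bounded_linear_add bounded_linear_const_mult bounded_linear_inner_right
          bounded_linear_inner_left_comp\<close>)
  have contz: "continuous_on T (\<lambda>(x, t). z x t)" for T
    unfolding z_def split_beta by (intro continuous_intros)
  define f where "f x = integral (cbox 0 1) (F x)" for x
  have "(f has_derivative (\<lambda>h. G x \<bullet> h)) (at x)" if x: "x \<in> S" for x
  proof -
    obtain r where r: "r > 0" "ball x r \<subseteq> S" using assms(1) x open_contains_ball by blast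
    have dF: "((\<lambda>y. F y t) has_derivative blinfun_apply (F' y t)) (at y within ball x r)"
      if "y \<in> ball x r" "t \<in> cbox 0 1" for y t
    proof -
      have y: "y \<in> S" "0 \<le> t" "t \<le> 1" using that r by auto
      have "((\<lambda>y. z y t) has_derivative (\<lambda>h. t *\<^sub>R h)) (at y)"
        unfolding z_def by (auto intro!: derivative_eq_intros)
      from has_derivative_compose[OF this G[OF zS[OF y]]]
      have "((\<lambda>y. G (z y t)) has_derivative (\<lambda>h. t *\<^sub>R G' (z y t) h)) (at y)"
        using has_derivative_linear[OF G[OF zS[OF y]]] by (simp add: linear_scale)
      then have "((\<lambda>y. F y t) has_derivative blinfun_apply (F' y t)) (at y)"
        unfolding F_def F'[OF y] by (auto intro!: derivative_eq_intros)
      then show ?thesis by (rule has_derivative_at_withinI)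
    qed
    have contF: "continuous_on {0..1} (F y)" if "y \<in> S" for y
      unfolding F_def
      by (intro continuous_intros continuous_on_compose2[OF contG])
        (use zS[OF that] in \<open>auto simp: z_def intro!: continuous_intros\<close>)
    have "continuous_on (ball x r \<times> cbox 0 1) (\<lambda>(y, t). F' y t)"
      unfolding split_beta
    proof (rule continuous_on_blinfun_componentwise)
      fix i :: 'a assume "i \<in> Basis"
      have "continuous_on (ball x r \<times> cbox 0 1)
          (\<lambda>p. snd p * (G' (z (fst p) (snd p)) i \<bullet> (fst p - a)) + G (z (fst p) (snd p)) \<bullet> i)"
        by (intro continuous_intros continuous_on_compose2[OF contG] continuous_on_compose2[OF contG'])
          (use zS r contz in \<open>auto simp: split_beta\<close>)
      moreover have "blinfun_apply (F' (fst p) (snd p)) i =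
          snd p * (G' (z (fst p) (snd p)) i \<bullet> (fst p - a)) + G (z (fst p) (snd p)) \<bullet> i"
        if "p \<in> ball x r \<times> cbox 0 1" for p
        using F'[of "fst p" "snd p"] that r by auto
      ultimately show "continuous_on (ball x r \<times> cbox 0 1) (\<lambda>p. blinfun_apply (F' (fst p) (snd p)) i)"
        by (simp cong: continuous_on_cong)
    qed
    note contF' = this
    have "F y integrable_on cbox 0 1" if "y \<in> ball x r" for y
      using contF[of y] r that integrable_continuous_interval by fastforce
    from leibniz_rule[OF dF this contF']
    have "(f has_derivative blinfun_apply (integral (cbox 0 1) (F' x))) (at x within ball x r)"
      using r by (simp add: f_def[abs_def])
    then have "(f has_derivative blinfun_apply (integral (cbox 0 1) (F' x))) (at x)"
      using r by (simp add: at_within_open[of x "ball x r"])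
    moreover have "blinfun_apply (integral (cbox 0 1) (F' x)) = (\<lambda>h. G x \<bullet> h)"
    proof
      fix h
      have "continuous_on (cbox 0 1) (Pair x :: real \<Rightarrow> _)" by (intro continuous_intros)
      moreover have "Pair x ` cbox 0 1 \<subseteq> ball x r \<times> cbox (0 :: real) 1" using r by auto
      ultimately have "continuous_on (cbox 0 1) (F' x)"
        using continuous_on_compose2[OF contF', of "cbox 0 1" "Pair x"] by simp
      then have "blinfun_apply (integral (cbox 0 1) (F' x)) h =
          integral (cbox 0 1) (\<lambda>t. blinfun_apply (F' x t) h)"
        by (intro blinfun_apply_integral integrable_continuous)
      also have "\<dots> = integral (cbox 0 1) (\<lambda>t. t * (G' (z x t) h \<bullet> (x - a)) + G (z x t) \<bullet> h)"
        using F'[OF x] by (intro integral_cong) auto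
      also have "\<dots> = 1 * (G (z x 1) \<bullet> h) - 0 * (G (z x 0) \<bullet> h)"
      proof -
        \<comment> \<open>Symmetry of the derivative of \<open>G\<close> exchanges \<open>h\<close>
          and \<open>x - a\<close>; the integrand is then the total derivative of this product,
          whose boundary values are 0 and \<open>G x\<close> paired with \<open>h\<close>.\<close>
        have "((\<lambda>t. t * (G (z x t) \<bullet> h)) has_vector_derivative
            t * (G' (z x t) h \<bullet> (x - a)) + G (z x t) \<bullet> h) (at t within {0..1})"
          if "t \<in> {0..1}" for t
        proof -
          have t: "x \<in> S" "0 \<le> t" "t \<le> 1" using that x by auto
          have "((\<lambda>t. z x t) has_derivative (\<lambda>s. s *\<^sub>R (x - a))) (at t)"
            unfolding z_def by (auto intro!: derivative_eq_intros)
          from has_derivative_compose[OF this G[OF zS[OF t]]]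
          have "((\<lambda>t. G (z x t)) has_derivative (\<lambda>s. s *\<^sub>R G' (z x t) (x - a))) (at t)"
            using has_derivative_linear[OF G[OF zS[OF t]]] by (simp add: linear_scale)
          then have "((\<lambda>t. t * (G (z x t) \<bullet> h)) has_derivative
              (\<lambda>s. s *\<^sub>R (t * (G' (z x t) (x - a) \<bullet> h) + G (z x t) \<bullet> h))) (at t)"
            by (auto intro!: derivative_eq_intros simp: algebra_simps)
          then show ?thesis
            using sym[OF zS[OF t], of h "x - a"]
            by (simp add: has_vector_derivative_def has_derivative_at_withinI G'_def)
        qed
        from fundamental_theorem_of_calculus[OF _ this] show ?thesis
          by (simp add: integral_unique)
      qed
      also have "\<dots> = G x \<bullet> h" by (simp add: z_def)
      finally show "blinfun_apply (integral (cbox 0 1) (F' x)) h = G x \<bullet> h" .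
    qed
    ultimately show ?thesis by simp
  qed
  then show ?thesis by blast
qed

text \<open>Two local potentials differ by a constant on the connected overlap, so one of them can
  be shifted to fit. The overlap may be empty, which is the case of two separate sheets.\<close>

lemma poincare_lemma_union:
  fixes G :: "'a::euclidean_space \<Rightarrow> 'a"
  assumes "open S" "starlike S" "open T" "starlike T" "connected (S \<inter> T)" "Ck_on 1 (S \<union> T) G"
    and sym: "\<And>x u w. x \<in> S \<union> T \<Longrightarrow>
      frechet_derivative G (at x) u \<bullet> w = frechet_derivative G (at x) w \<bullet> u"
  shows "\<exists>f. \<forall>x\<in>S \<union> T. (f has_derivative (\<lambda>h. G x \<bullet> h)) (at x)"
proof -
  obtain f where f: "\<And>x. x \<in> S \<Longrightarrow> (f has_derivative (\<lambda>h. G x \<bullet> h)) (at x)"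
    using poincare_lemma_starlike[OF assms(1,2) Ck_on_subset[OF assms(6)]] sym by blast
  obtain g where g: "\<And>x. x \<in> T \<Longrightarrow> (g has_derivative (\<lambda>h. G x \<bullet> h)) (at x)"
    using poincare_lemma_starlike[OF assms(3,4) Ck_on_subset[OF assms(6)]] sym by blast
  have d: "((\<lambda>x. f x - g x) has_derivative (\<lambda>h. 0)) (at x)" if "x \<in> S \<inter> T" for x
    using has_derivative_diff[OF f[of x] g[of x]] that by simp
  have "(\<lambda>x. f x - g x) constant_on S \<inter> T"
  proof (rule has_derivative_zero_connected_constant_on[OF assms(5) _ finite.emptyI])
    show "open (S \<inter> T)" using assms(1,3) by blast
    show "continuous_on (S \<inter> T) (\<lambda>x. f x - g x)"
      using d has_derivative_continuous continuous_at_imp_continuous_on by blast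
    show "\<forall>x\<in>S \<inter> T - {}. ((\<lambda>x. f x - g x) has_derivative (\<lambda>h. 0)) (at x within S \<inter> T)"
      using d has_derivative_at_withinI by blast
  qed
  then obtain c where c: "\<And>x. x \<in> S \<inter> T \<Longrightarrow> f x - g x = c"
    unfolding constant_on_def by blast
  define F where "F x = (if x \<in> S then f x else g x + c)" for x
  have "(F has_derivative (\<lambda>h. G x \<bullet> h)) (at x)" if "x \<in> S \<union> T" for x
  proof (cases "x \<in> S")
    case True
    show ?thesis
      by (rule has_derivative_transform_within_open[OF f[OF True] assms(1) True]) (simp add: F_def)
  next
    case False
    with that have x: "x \<in> T" by simp
    have "((\<lambda>x. g x + c) has_derivative (\<lambda>h. G x \<bullet> h)) (at x)"
      using has_derivative_add[OF g[OF x] has_derivative_const[of c]] by simp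
    then show ?thesis
      by (rule has_derivative_transform_within_open[OF _ assms(3) x])
        (use c in \<open>fastforce simp: F_def\<close>)
  qed
  then show ?thesis by blast
qed

section \<open>Linear algebra of the form\<close>

lemma pq_form_commute: "pq_form p q v w = pq_form p q w v"
  by (simp add: pq_form_def mult.commute)

lemmas pq_form_simps =
  bilinear_ladd[OF bilinear_pq_form] bilinear_radd[OF bilinear_pq_form]
  bilinear_lsub[OF bilinear_pq_form] bilinear_rsub[OF bilinear_pq_form]
  bilinear_lmul[OF bilinear_pq_form] bilinear_rmul[OF bilinear_pq_form]
  bilinear_lneg[OF bilinear_pq_form] bilinear_rneg[OF bilinear_pq_form]
  bilinear_lzero[OF bilinear_pq_form] bilinear_rzero[OF bilinear_pq_form]

lemma bounded_bilinear_pq_form: "bounded_bilinear (pq_form p q)"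
  using bilinear_pq_form bilinear_conv_bounded_bilinear by blast

lemma bounded_bilinear_wedge: "bounded_bilinear wedge"
  unfolding bilinear_conv_bounded_bilinear[symmetric] bilinear_def
  by (auto intro!: linearI simp: wedge_def vec_eq_iff algebra_simps)

lemma wedge_self: "wedge a a = 0"
  by (simp add: wedge_def vec_eq_iff)

lemma wedge_commute: "wedge a b = - wedge b a"
  by (simp add: wedge_def vec_eq_iff)

lemma axis_nth_if: "axis i a $ j = (if j = i then a else 0)"
  by (simp add: axis_def)

lemma bivectors_expand:
  assumes "Y \<in> bivectors"
  shows "Y = (1/2) *\<^sub>R (\<Sum>i\<in>UNIV. \<Sum>j\<in>UNIV. Y $ i $ j *\<^sub>R wedge (axis i 1) (axis j 1))"
proof -
  have anti: "Y $ i $ j = - Y $ j $ i" for i j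
  proof -
    have "transpose Y $ j $ i = (- Y) $ j $ i" using assms by (simp add: bivectors_def)
    then show ?thesis by (simp add: transpose_def)
  qed
  have Y: "Y $ 2 $ 1 = - Y $ 1 $ 2" "Y $ 3 $ 1 = - Y $ 1 $ 3" "Y $ 4 $ 1 = - Y $ 1 $ 4"
      "Y $ 3 $ 2 = - Y $ 2 $ 3" "Y $ 4 $ 2 = - Y $ 2 $ 4" "Y $ 4 $ 3 = - Y $ 3 $ 4"
    by (rule anti)+
  have "Y $ i $ i = 0" for i
    using anti[of i i] by linarith
  then show ?thesis
    by (simp add: vec_eq_iff forall_4 sum_4 wedge_def axis_nth_if Y)
qed

text \<open>Reduces an identity that is linear in \<open>Y\<close> to decomposable bivectors. The
  factor 1/2 corrects for each pair of indices being counted twice.\<close>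

lemma bivectors_linear_expand:
  assumes "linear L" "Y \<in> bivectors"
  shows "L Y = (1/2) *\<^sub>R (\<Sum>i\<in>UNIV. \<Sum>j\<in>UNIV. Y $ i $ j *\<^sub>R L (wedge (axis i 1) (axis j 1)))"
  by (subst bivectors_expand[OF assms(2)])
    (simp only: linear_scale[OF assms(1)] linear_sum[OF assms(1)])

lemma linear_killing_field: "linear (\<lambda>Y. killing_field p q Y v)"
  by (rule linearI) (simp_all add: killing_field_def sum.distrib scaleR_sum_right algebra_simps)

lemma linear_bivector_inner: "linear (bivector_inner p q Z)"
  by (rule linearI)
    (simp_all add: bivector_inner_def sum.distrib sum_distrib_left add_divide_distrib algebra_simps)

text \<open>An alternating 3-form on the span of three vectors is a multiple of the determinant of
  the coefficients, so two such forms can be compared through one value. The hypotheses are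
  restricted to \<open>V\<close> because a volume form is meaningful on tangent vectors only;
  linearity in the other slots follows by antisymmetry.\<close>

lemma alternating_trilinear_expand:
  fixes T :: "'v::real_vector \<Rightarrow> 'v \<Rightarrow> 'v \<Rightarrow> real"
  assumes V: "subspace V" "e1 \<in> V" "e2 \<in> V" "e3 \<in> V"
    and lin: "\<And>u u' w z r s. u \<in> V \<Longrightarrow> u' \<in> V \<Longrightarrow> w \<in> V \<Longrightarrow> z \<in> V \<Longrightarrow>
      T (r *\<^sub>R u + s *\<^sub>R u') w z = r * T u w z + s * T u' w z"
    and anti12: "\<And>u w z. u \<in> V \<Longrightarrow> w \<in> V \<Longrightarrow> z \<in> V \<Longrightarrow> T u w z = - T w u z"
    and anti23: "\<And>u w z. u \<in> V \<Longrightarrow> w \<in> V \<Longrightarrow> z \<in> V \<Longrightarrow> T u w z = - T u z w"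
  shows "T (a1 *\<^sub>R e1 + a2 *\<^sub>R e2 + a3 *\<^sub>R e3) (b1 *\<^sub>R e1 + b2 *\<^sub>R e2 + b3 *\<^sub>R e3)
      (c1 *\<^sub>R e1 + c2 *\<^sub>R e2 + c3 *\<^sub>R e3) =
    (a1 * (b2 * c3 - b3 * c2) - a2 * (b1 * c3 - b3 * c1) + a3 * (b1 * c2 - b2 * c1)) * T e1 e2 e3"
proof -
  have comb: "r1 *\<^sub>R e1 + r2 *\<^sub>R e2 + r3 *\<^sub>R e3 \<in> V" for r1 r2 r3
    using V by (auto intro!: subspace_add subspace_scale)
  have lin3: "T (r1 *\<^sub>R e1 + r2 *\<^sub>R e2 + r3 *\<^sub>R e3) w z = r1 * T e1 w z + r2 * T e2 w z + r3 * T e3 w z"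
    if "w \<in> V" "z \<in> V" for r1 r2 r3 w z
    using lin[of "r1 *\<^sub>R e1 + r2 *\<^sub>R e2" e3 w z 1 r3] lin[of e1 e2 w z r1 r2] V that
    by (simp add: subspace_add subspace_scale)
  have lin2: "T u (r1 *\<^sub>R e1 + r2 *\<^sub>R e2 + r3 *\<^sub>R e3) z = r1 * T u e1 z + r2 * T u e2 z + r3 * T u e3 z"
    if "u \<in> V" "z \<in> V" for r1 r2 r3 u z
    using lin3[OF that, of r1 r2 r3] anti12[of u _ z] that comb V by simp
  have lin1: "T u w (r1 *\<^sub>R e1 + r2 *\<^sub>R e2 + r3 *\<^sub>R e3) = r1 * T u w e1 + r2 * T u w e2 + r3 * T u w e3"
    if "u \<in> V" "w \<in> V" for r1 r2 r3 u w
    using lin2[OF that, of r1 r2 r3] anti23[of u w] that comb V by simp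
  have z12: "T u u w = 0" and z23: "T w u u = 0" if "u \<in> V" "w \<in> V" for u w
    using anti12[of u u w] anti23[of w u u] that by auto
  have z13: "T u w u = 0" if "u \<in> V" "w \<in> V" for u w
    using anti12[of u w u] z23 that by simp
  have p: "T e2 e1 e3 = - T e1 e2 e3" "T e1 e3 e2 = - T e1 e2 e3" "T e3 e2 e1 = - T e1 e2 e3"
    "T e2 e3 e1 = T e1 e2 e3" "T e3 e1 e2 = T e1 e2 e3"
    using anti12[of e2 e1 e3] anti23[of e1 e3 e2] anti12[of e3 e2 e1] anti23[of e2 e3 e1]
      anti12[of e3 e1 e2] V by auto
  show ?thesis
    by (simp only: lin1 lin2 lin3 comb V z12 z13 z23 p) (simp add: algebra_simps)
qed

section \<open>The determinant of four vectors\<close>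

definition det4 :: "real^4 \<Rightarrow> real^4 \<Rightarrow> real^4 \<Rightarrow> real^4 \<Rightarrow> real"
  where "det4 a b c d = det (\<chi> i. if i = 1 then a else if i = 2 then b else if i = 3 then c else d)"

lemma
  shows linear_det4_1: "linear (\<lambda>x. det4 x b c d)"
    and linear_det4_2: "linear (\<lambda>x. det4 a x c d)"
    and linear_det4_3: "linear (\<lambda>x. det4 a b x d)"
    and linear_det4_4: "linear (\<lambda>x. det4 a b c x)"
proof -
  \<comment> \<open>Row \<open>k\<close> is overwritten by \<open>x\<close>, so one linearity proof
    serves all four slots.\<close>
  define R :: "4 \<Rightarrow> real^4 \<Rightarrow> real^4^4" where
    "R k x = (\<chi> i. if i = k then x else if i = 1 then a else if i = 2 then b else if i = 3 then c else d)"
    for k x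
  have lin: "linear (\<lambda>x. det (R k x))" for k
  proof (rule linearI)
    let ?c = "\<lambda>i. if i = 1 then a else if i = 2 then b else if i = 3 then c else d"
    show "det (R k (x + y)) = det (R k x) + det (R k y)" for x y
      using det_row_add[of k "\<lambda>_. x" "\<lambda>_. y" ?c] by (simp add: R_def)
    show "det (R k (r *\<^sub>R x)) = r *\<^sub>R det (R k x)" for r x
      using det_row_mul[of k r "\<lambda>_. x" ?c, unfolded scalar_mult_eq_scaleR] by (simp add: R_def)
  qed
  have "det4 x b c d = det (R 1 x)" "det4 a x c d = det (R 2 x)" "det4 a b x d = det (R 3 x)"
    "det4 a b c x = det (R 4 x)" for x
    unfolding det4_def R_def by (auto intro!: arg_cong[of _ _ det] simp: vec_eq_iff forall_4)
  then show "linear (\<lambda>x. det4 x b c d)" "linear (\<lambda>x. det4 a x c d)" "linear (\<lambda>x. det4 a b x d)"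
    "linear (\<lambda>x. det4 a b c x)" using lin by simp_all
qed

lemmas det4_simps =
  linear_add[OF linear_det4_1] linear_add[OF linear_det4_2]
  linear_add[OF linear_det4_3] linear_add[OF linear_det4_4]
  linear_scale[OF linear_det4_1] linear_scale[OF linear_det4_2]
  linear_scale[OF linear_det4_3] linear_scale[OF linear_det4_4]
  linear_diff[OF linear_det4_1] linear_diff[OF linear_det4_2]
  linear_diff[OF linear_det4_3] linear_diff[OF linear_det4_4]

lemma det4_same: "det4 a a c d = 0" "det4 a b b d = 0" "det4 a b c c = 0"
proof -
  show "det4 a a c d = 0" unfolding det4_def
    by (rule det_identical_rows[of 1 2]) (simp_all add: row_def vec_eq_iff)
  show "det4 a b b d = 0" unfolding det4_def
    by (rule det_identical_rows[of 2 3]) (simp_all add: row_def vec_eq_iff)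
  show "det4 a b c c = 0" unfolding det4_def
    by (rule det_identical_rows[of 3 4]) (simp_all add: row_def vec_eq_iff)
qed

text \<open>Polarisation: the determinant vanishes with \<open>a + b\<close> in both slots.\<close>

lemma det4_swap12: "det4 a b c d = - det4 b a c d"
  using det4_same(1)[of "a + b" c d] unfolding det4_simps unfolding det4_same by linarith

lemma det4_swap23: "det4 a b c d = - det4 a c b d"
  using det4_same(2)[of a "b + c" d] unfolding det4_simps unfolding det4_same by linarith

lemma det4_swap34: "det4 a b c d = - det4 a b d c"
  using det4_same(3)[of a b "c + d"] unfolding det4_simps unfolding det4_same by linarith

lemma det4_same': "det4 a b a d = 0" "det4 a b c b = 0" "det4 a b c a = 0"
  using det4_swap12[of a b a d] det4_swap23[of a b c b] det4_swap12[of a b c a] det4_swap23[of b a c a]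
  by (simp_all add: det4_same)

section \<open>Orthogonality in the two signatures\<close>

locale space_form_signature =
  fixes K :: real and p q :: nat
  assumes K: "K \<noteq> 0" and pq: "(p, q) = (if K > 0 then (4, 0) else (3, 1))"
begin

abbreviation form ("\<langle>_,/ _\<rangle>") where "form \<equiv> pq_form p q"

lemma form_pos: "K > 0 \<Longrightarrow> \<langle>v, w\<rangle> = v \<bullet> w"
  using pq pq_form_4_0 by simp

lemma form_neg:
  "K < 0 \<Longrightarrow> \<langle>v, w\<rangle> = v $ 0 * w $ 0 + v $ 1 * w $ 1 + v $ 2 * w $ 2 - v $ 3 * w $ 3"
  using pq pq_form_3_1[of v w] by simp

text \<open>Directions are counted from 0, so the only negative one, present for K < 0, has index
  3.\<close>

lemma form_axis:
  "\<langle>axis i 1, axis j 1\<rangle> = (if i = j then if i = 3 \<and> K < 0 then - 1 else 1 else 0)"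
proof (cases "K > 0")
  case True
  then show ?thesis by (simp add: form_pos inner_axis_axis)
next
  case False
  with K have "K < 0" by simp
  have "\<forall>i j. \<langle>axis i 1, axis j 1\<rangle> = (if i = j then if i = 3 then - 1 else 1 else 0)"
    by (simp add: forall_4 form_neg[OF \<open>K < 0\<close>] axis_nth_if)
  with \<open>K < 0\<close> show ?thesis by simp
qed

text \<open>The Gram matrix of the four vectors is M G M^T, where G is the Gram matrix of the axes
  and has determinant \<open>sgn K\<close>; orthogonality makes the Gram matrix diagonal.\<close>

lemma det4_orthogonal:
  assumes "\<langle>a, b\<rangle> = 0" "\<langle>a, c\<rangle> = 0" "\<langle>a, d\<rangle> = 0" "\<langle>b, c\<rangle> = 0" "\<langle>b, d\<rangle> = 0" "\<langle>c, d\<rangle> = 0"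
  shows "(det4 a b c d)\<^sup>2 * sgn K = \<langle>a, a\<rangle> * \<langle>b, b\<rangle> * \<langle>c, c\<rangle> * \<langle>d, d\<rangle>"
proof -
  define M :: "real^4^4"
    where "M = (\<chi> i. if i = 1 then a else if i = 2 then b else if i = 3 then c else d)"
  define G :: "real^4^4" where "G = (\<chi> i j. \<langle>axis i 1, axis j 1\<rangle>)"
  have *: "(M ** G ** transpose M) $ i $ j = \<langle>M $ i, M $ j\<rangle>" for i j
    unfolding pq_form_expand[of p q "M $ i"]
    by (simp add: matrix_matrix_mult_def transpose_def G_def sum_distrib_right sum_4 algebra_simps)
  have entries: "(M ** G ** transpose M) $ i $ j =
      (if i = j then if i = 1 then \<langle>a, a\<rangle> else if i = 2 then \<langle>b, b\<rangle> else if i = 3 then \<langle>c, c\<rangle> else \<langle>d, d\<rangle> else 0)"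
    for i j
  proof -
    have "\<langle>b, a\<rangle> = 0" "\<langle>c, a\<rangle> = 0" "\<langle>d, a\<rangle> = 0" "\<langle>c, b\<rangle> = 0" "\<langle>d, b\<rangle> = 0" "\<langle>d, c\<rangle> = 0"
      by (subst pq_form_commute, rule assms)+
    with assms have "\<forall>i j. \<langle>M $ i, M $ j\<rangle> = (if i = j then if i = 1 then \<langle>a, a\<rangle>
        else if i = 2 then \<langle>b, b\<rangle> else if i = 3 then \<langle>c, c\<rangle> else \<langle>d, d\<rangle> else 0)"
      by (simp add: forall_4 M_def)
    with * show ?thesis by simp
  qed
  have "det (M ** G ** transpose M) = (\<Prod>i\<in>UNIV. (M ** G ** transpose M) $ i $ i)"
    by (rule det_diagonal) (simp add: entries)
  also have "\<dots> = \<langle>a, a\<rangle> * \<langle>b, b\<rangle> * \<langle>c, c\<rangle> * \<langle>d, d\<rangle>"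
    unfolding entries UNIV_4 by simp
  finally have "det M ^ 2 * det G = \<langle>a, a\<rangle> * \<langle>b, b\<rangle> * \<langle>c, c\<rangle> * \<langle>d, d\<rangle>"
    unfolding det_mul det_transpose power2_eq_square by (simp only: ac_simps)
  moreover have "det G = (\<Prod>i\<in>UNIV. G $ i $ i)"
    by (rule det_diagonal) (simp add: G_def form_axis)
  then have "det G = sgn K"
    using K unfolding UNIV_4 by (simp add: G_def form_axis sgn_if)
  ultimately show ?thesis by (simp add: det4_def M_def)
qed

text \<open>Orthogonal vectors of nonzero square form a basis also for an indefinite form: the
  coefficients can be read off by pairing, so the map \<open>L\<close> is injective and hence
  surjective.\<close>

lemma orthogonal_frame_expand:
  assumes "\<langle>a, b\<rangle> = 0" "\<langle>a, c\<rangle> = 0" "\<langle>a, d\<rangle> = 0" "\<langle>b, c\<rangle> = 0" "\<langle>b, d\<rangle> = 0" "\<langle>c, d\<rangle> = 0"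
    and "\<langle>a, a\<rangle> \<noteq> 0" "\<langle>b, b\<rangle> \<noteq> 0" "\<langle>c, c\<rangle> \<noteq> 0" "\<langle>d, d\<rangle> \<noteq> 0"
  shows "x = (\<langle>a, x\<rangle> / \<langle>a, a\<rangle>) *\<^sub>R a + (\<langle>b, x\<rangle> / \<langle>b, b\<rangle>) *\<^sub>R b +
    (\<langle>c, x\<rangle> / \<langle>c, c\<rangle>) *\<^sub>R c + (\<langle>d, x\<rangle> / \<langle>d, d\<rangle>) *\<^sub>R d"
proof -
  define L :: "real^4 \<Rightarrow> real^4" where "L r = r $ 1 *\<^sub>R a + r $ 2 *\<^sub>R b + r $ 3 *\<^sub>R c + r $ 4 *\<^sub>R d" for r
  have sym: "\<langle>b, a\<rangle> = 0" "\<langle>c, a\<rangle> = 0" "\<langle>d, a\<rangle> = 0" "\<langle>c, b\<rangle> = 0" "\<langle>d, b\<rangle> = 0" "\<langle>d, c\<rangle> = 0"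
    by (subst pq_form_commute, rule assms)+
  have coeffs: "\<langle>a, L r\<rangle> = r $ 1 * \<langle>a, a\<rangle>" "\<langle>b, L r\<rangle> = r $ 2 * \<langle>b, b\<rangle>" "\<langle>c, L r\<rangle> = r $ 3 * \<langle>c, c\<rangle>"
    "\<langle>d, L r\<rangle> = r $ 4 * \<langle>d, d\<rangle>" for r
    by (simp_all add: L_def pq_form_simps assms(1-6) sym)
  have "linear L" by (rule linearI) (simp_all add: L_def algebra_simps)
  moreover have "inj L"
  proof (rule injI)
    fix r s assume "L r = L s"
    then have "r $ 1 = s $ 1" "r $ 2 = s $ 2" "r $ 3 = s $ 3" "r $ 4 = s $ 4"
      using coeffs[of r] coeffs[of s] assms(7-10) by simp_all
    then show "r = s" by (simp add: vec_eq_iff forall_4)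
  qed
  ultimately obtain r where "x = L r"
    using linear_injective_imp_surjective by (metis surjD)
  then show ?thesis using coeffs[of r] assms(7-10) by (simp add: L_def)
qed

text \<open>Three linear conditions in four unknowns: padded with a zero component they give an
  endomorphism that is not surjective, hence not injective.\<close>

lemma exists_orthogonal_vector:
  shows "\<exists>w. w \<noteq> 0 \<and> \<langle>a, w\<rangle> = 0 \<and> \<langle>b, w\<rangle> = 0 \<and> \<langle>c, w\<rangle> = 0"
proof -
  define L :: "real^4 \<Rightarrow> real^4" where
    "L w = (\<chi> i. if i = 1 then \<langle>a, w\<rangle> else if i = 2 then \<langle>b, w\<rangle> else if i = 3 then \<langle>c, w\<rangle> else 0)" for w
  have "linear L" by (rule linearI) (auto simp: L_def pq_form_simps vec_eq_iff)
  moreover have "\<not> surj L"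
  proof
    assume "surj L"
    then obtain w where "L w = axis 4 1" by (metis surjD)
    then show False by (auto simp: L_def vec_eq_iff axis_def forall_4)
  qed
  ultimately have "\<not> inj L" using linear_injective_imp_surjective by blast
  then obtain w where "w \<noteq> 0" "L w = 0"
    using \<open>linear L\<close> linear_injective_0 by blast
  then show ?thesis by (intro exI[of _ w]) (auto simp: L_def vec_eq_iff forall_4)
qed

text \<open>The metric induced on M is Riemannian. For K < 0 the vector \<open>v\<close> is
  timelike, and a vector orthogonal to it must be spacelike, by the Cauchy-Schwarz inequality for
  the three spatial coordinates.\<close>

lemma form_tangent_pos:
  assumes "v \<in> space_form p q K" "w \<in> tangent p q v" "w \<noteq> 0"
  shows "\<langle>w, w\<rangle> > 0"
proof (cases "K > 0")
  case True
  with assms show ?thesis by (simp add: form_pos)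
next
  case False
  with K have "K < 0" by simp
  define A where "A = (v $ 0)\<^sup>2 + (v $ 1)\<^sup>2 + (v $ 2)\<^sup>2"
  define B where "B = (w $ 0)\<^sup>2 + (w $ 1)\<^sup>2 + (w $ 2)\<^sup>2"
  have v: "A - (v $ 3)\<^sup>2 = 1 / K"
    using assms(1) by (simp add: space_form_def form_neg[OF \<open>K < 0\<close>] A_def power2_eq_square)
  have vw: "v $ 0 * w $ 0 + v $ 1 * w $ 1 + v $ 2 * w $ 2 = v $ 3 * w $ 3"
    using assms(2) by (simp add: tangent_def form_neg[OF \<open>K < 0\<close>])
  have ww: "\<langle>w, w\<rangle> = B - (w $ 3)\<^sup>2" by (simp add: form_neg[OF \<open>K < 0\<close>] B_def power2_eq_square)
  have "1 / K < 0" using \<open>K < 0\<close> by simp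
  then have lt: "A < (v $ 3)\<^sup>2" using v by linarith
  \<comment> \<open>Lagrange's identity for the spatial parts of \<open>v\<close> and
    \<open>w\<close>, which gives the Cauchy-Schwarz inequality below.\<close>
  have "A * B - (v $ 3 * w $ 3)\<^sup>2 = (v $ 0 * w $ 1 - v $ 1 * w $ 0)\<^sup>2 +
      (v $ 0 * w $ 2 - v $ 2 * w $ 0)\<^sup>2 + (v $ 1 * w $ 2 - v $ 2 * w $ 1)\<^sup>2"
    unfolding vw[symmetric] A_def B_def by (simp add: power2_eq_square algebra_simps)
  then have cs: "(v $ 3)\<^sup>2 * (w $ 3)\<^sup>2 \<le> A * B"
    by (smt (verit) power_mult_distrib zero_le_power2)
  have "A \<ge> 0" "B \<ge> 0" by (simp_all add: A_def B_def)
  have "B \<noteq> 0"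
  proof
    assume "B = 0"
    then have w0: "w $ 0 = 0" "w $ 1 = 0" "w $ 2 = 0"
      unfolding B_def by (smt (verit) zero_le_power2 power_eq_0_iff)+
    then have "w $ 3 = 0" using vw lt \<open>A \<ge> 0\<close> by auto
    \<comment> \<open>\<open>forall_4\<close> enumerates the indices as 1 to 4, whereas the form
      uses 0 to 3.\<close>
    moreover have "(4::4) = 0" by simp
    then have "w $ 4 = w $ 0" by (simp only:)
    ultimately have "w = 0" using w0 by (simp add: vec_eq_iff forall_4)
    with assms(3) show False by simp
  qed
  with \<open>B \<ge> 0\<close> have "A * B < (v $ 3)\<^sup>2 * B" using lt by simp
  with cs have "(v $ 3)\<^sup>2 * (w $ 3)\<^sup>2 < (v $ 3)\<^sup>2 * B" by linarith
  then have "(w $ 3)\<^sup>2 < B" using mult_less_cancel_left_pos lt \<open>A \<ge> 0\<close> by (smt (verit) mult_left_mono)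
  then show ?thesis by (simp add: ww)
qed

end

section \<open>The volume form and its contraction with Killing fields\<close>

text \<open>The determinant with its first two rows filled by a bivector: on
  \<open>wedge a b\<close> it equals \<open>det4 a b u w\<close>.\<close>

definition bivector_det :: "real^4^4 \<Rightarrow> real^4 \<Rightarrow> real^4 \<Rightarrow> real"
  where "bivector_det Y u w = (\<Sum>i\<in>UNIV. \<Sum>j\<in>UNIV. Y $ i $ j * det4 (axis i 1) (axis j 1) u w) / 2"

lemma linear_bivector_det: "linear (\<lambda>u. bivector_det Y u w)" "linear (bivector_det Y u)"
  by (rule linearI; simp add: bivector_det_def det4_simps sum.distrib add_divide_distrib
      sum_distrib_left algebra_simps)+

lemma bivector_det_commute: "bivector_det Y u w = - bivector_det Y w u"
  unfolding bivector_det_def by (subst det4_swap34) (simp add: sum_negf)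

context space_form_signature
begin

lemma subspace_tangent: "subspace (tangent p q v)"
  by (auto simp: subspace_def tangent_def pq_form_simps)

lemma tangent_proj_tangent: "v \<in> space_form p q K \<Longrightarrow> tangent_proj p q K v w \<in> tangent p q v"
  using K by (simp add: tangent_proj_def tangent_def space_form_def pq_form_simps)

text \<open>A Gram-Schmidt step: \<open>a\<close> and \<open>b\<close> are the frame vectors already
  chosen.\<close>

lemma exists_unit_tangent:
  assumes "v \<in> space_form p q K"
  shows "\<exists>w. w \<in> tangent p q v \<and> \<langle>w, w\<rangle> = 1 \<and> \<langle>a, w\<rangle> = 0 \<and> \<langle>b, w\<rangle> = 0"
proof -
  obtain w where w: "w \<noteq> 0" "\<langle>v, w\<rangle> = 0" "\<langle>a, w\<rangle> = 0" "\<langle>b, w\<rangle> = 0"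
    using exists_orthogonal_vector by blast
  then have "\<langle>w, w\<rangle> > 0" using form_tangent_pos[OF assms, of w] by (simp add: tangent_def)
  with w show ?thesis
    by (intro exI[of _ "(1 / sqrt \<langle>w, w\<rangle>) *\<^sub>R w"]) (simp add: tangent_def pq_form_simps)
qed

text \<open>The position vector completes the frame to an orthogonal basis and has square 1/K, so
  \<open>det4_orthogonal\<close> gives the determinant the square 1/\<bar>K\<bar>. This is the
  origin of \<kappa>^2 = \<bar>K\<bar>.\<close>

lemma exists_orthonormal_frame:
  assumes "v \<in> space_form p q K"
  obtains e1 e2 e3 where "e1 \<in> tangent p q v" "e2 \<in> tangent p q v" "e3 \<in> tangent p q v"
    "\<langle>e1, e1\<rangle> = 1" "\<langle>e2, e2\<rangle> = 1" "\<langle>e3, e3\<rangle> = 1" "\<langle>e1, e2\<rangle> = 0" "\<langle>e1, e3\<rangle> = 0" "\<langle>e2, e3\<rangle> = 0"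
    "(det4 v e1 e2 e3)\<^sup>2 * \<bar>K\<bar> = 1"
    "\<And>u. u \<in> tangent p q v \<Longrightarrow> u = \<langle>e1, u\<rangle> *\<^sub>R e1 + \<langle>e2, u\<rangle> *\<^sub>R e2 + \<langle>e3, u\<rangle> *\<^sub>R e3"
proof -
  obtain e1 where e1: "e1 \<in> tangent p q v" "\<langle>e1, e1\<rangle> = 1"
    using exists_unit_tangent[OF assms] by blast
  obtain e2 where e2: "e2 \<in> tangent p q v" "\<langle>e2, e2\<rangle> = 1" "\<langle>e1, e2\<rangle> = 0"
    using exists_unit_tangent[OF assms] by blast
  obtain e3 where e3: "e3 \<in> tangent p q v" "\<langle>e3, e3\<rangle> = 1" "\<langle>e1, e3\<rangle> = 0" "\<langle>e2, e3\<rangle> = 0"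
    using exists_unit_tangent[OF assms] by blast
  have v: "\<langle>v, v\<rangle> = 1 / K" "\<langle>v, e1\<rangle> = 0" "\<langle>v, e2\<rangle> = 0" "\<langle>v, e3\<rangle> = 0"
    using assms e1 e2 e3 by (simp_all add: space_form_def tangent_def)
  have "(det4 v e1 e2 e3)\<^sup>2 * sgn K = 1 / K"
    using det4_orthogonal[of v e1 e2 e3] v e1 e2 e3 by simp
  then have "(det4 v e1 e2 e3)\<^sup>2 * (sgn K * K) = 1" using K by (simp add: field_simps)
  then have "(det4 v e1 e2 e3)\<^sup>2 * \<bar>K\<bar> = 1" by (simp add: abs_sgn mult.commute)
  moreover have "u = \<langle>e1, u\<rangle> *\<^sub>R e1 + \<langle>e2, u\<rangle> *\<^sub>R e2 + \<langle>e3, u\<rangle> *\<^sub>R e3" if "u \<in> tangent p q v" for u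
    using orthogonal_frame_expand[of v e1 e2 e3 u] v e1 e2 e3 K that by (simp add: tangent_def)
  ultimately show thesis using that e1 e2 e3 by blast
qed

lemma det4_tangent_expand:
  assumes "e1 \<in> tangent p q v" "e2 \<in> tangent p q v" "e3 \<in> tangent p q v"
  shows "det4 a (a1 *\<^sub>R e1 + a2 *\<^sub>R e2 + a3 *\<^sub>R e3) (b1 *\<^sub>R e1 + b2 *\<^sub>R e2 + b3 *\<^sub>R e3)
      (c1 *\<^sub>R e1 + c2 *\<^sub>R e2 + c3 *\<^sub>R e3) =
    (a1 * (b2 * c3 - b3 * c2) - a2 * (b1 * c3 - b3 * c1) + a3 * (b1 * c2 - b2 * c1)) * det4 a e1 e2 e3"
  by (rule alternating_trilinear_expand[OF subspace_tangent assms])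
    (simp_all add: det4_simps, (rule det4_swap23 det4_swap34)+)

text \<open>The tangent space has dimension 3.\<close>

lemma det4_tangent_zero:
  assumes "v \<in> space_form p q K"
    and T: "a \<in> tangent p q v" "b \<in> tangent p q v" "c \<in> tangent p q v" "d \<in> tangent p q v"
  shows "det4 a b c d = 0"
proof -
  obtain e1 e2 e3 where e: "e1 \<in> tangent p q v" "e2 \<in> tangent p q v" "e3 \<in> tangent p q v"
    and ex: "\<And>u. u \<in> tangent p q v \<Longrightarrow> u = \<langle>e1, u\<rangle> *\<^sub>R e1 + \<langle>e2, u\<rangle> *\<^sub>R e2 + \<langle>e3, u\<rangle> *\<^sub>R e3"
    using exists_orthonormal_frame[OF assms(1)] by metis
  have "det4 a e1 e2 e3 = 0"
    by (subst ex[OF T(1)]) (simp only: det4_simps det4_same det4_same' scaleR_zero_right add_0)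
  then show ?thesis
    by (subst ex[OF T(2)], subst ex[OF T(3)], subst ex[OF T(4)])
      (subst det4_tangent_expand[OF e], simp)
qed

text \<open>Both sides are alternating 3-forms on a 3-dimensional space, and \<open>k\<close> is the
  ratio of their values on an orthonormal frame. It is obtained at each point separately; its
  regularity is the next lemma.\<close>

lemma volume_form_eq_det4:
  assumes "volume_form p q K vol" "v \<in> space_form p q K"
  shows "\<exists>k. k\<^sup>2 = \<bar>K\<bar> \<and> (\<forall>u\<in>tangent p q v. \<forall>w\<in>tangent p q v. \<forall>z\<in>tangent p q v.
    vol v u w z = k * det4 v u w z)"
proof -
  obtain e1 e2 e3 where e: "e1 \<in> tangent p q v" "e2 \<in> tangent p q v" "e3 \<in> tangent p q v"
    and on: "\<langle>e1, e1\<rangle> = 1" "\<langle>e2, e2\<rangle> = 1" "\<langle>e3, e3\<rangle> = 1" "\<langle>e1, e2\<rangle> = 0" "\<langle>e1, e3\<rangle> = 0" "\<langle>e2, e3\<rangle> = 0"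
    and D: "(det4 v e1 e2 e3)\<^sup>2 * \<bar>K\<bar> = 1"
    and ex: "\<And>u. u \<in> tangent p q v \<Longrightarrow> u = \<langle>e1, u\<rangle> *\<^sub>R e1 + \<langle>e2, u\<rangle> *\<^sub>R e2 + \<langle>e3, u\<rangle> *\<^sub>R e3"
    using exists_orthonormal_frame[OF assms(2)] by metis
  have vol: "vol v (a1 *\<^sub>R e1 + a2 *\<^sub>R e2 + a3 *\<^sub>R e3) (b1 *\<^sub>R e1 + b2 *\<^sub>R e2 + b3 *\<^sub>R e3)
      (c1 *\<^sub>R e1 + c2 *\<^sub>R e2 + c3 *\<^sub>R e3) =
    (a1 * (b2 * c3 - b3 * c2) - a2 * (b1 * c3 - b3 * c1) + a3 * (b1 * c2 - b2 * c1)) * vol v e1 e2 e3"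
    for a1 a2 a3 b1 b2 b3 c1 c2 c3
    by (rule alternating_trilinear_expand[OF subspace_tangent e])
      (use assms in \<open>unfold volume_form_def, blast+\<close>)
  have "\<bar>vol v e1 e2 e3\<bar> = 1"
    using assms e on unfolding volume_form_def by blast
  then have vol1: "(vol v e1 e2 e3)\<^sup>2 = 1" by (metis power2_abs one_power2)
  define k where "k = vol v e1 e2 e3 / det4 v e1 e2 e3"
  have "det4 v e1 e2 e3 \<noteq> 0" using D by auto
  have "k\<^sup>2 = \<bar>K\<bar>"
    using D \<open>det4 v e1 e2 e3 \<noteq> 0\<close> by (simp add: k_def power_divide vol1 field_simps)
  moreover have "vol v u w z = k * det4 v u w z"
    if "u \<in> tangent p q v" "w \<in> tangent p q v" "z \<in> tangent p q v" for u w z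
    apply (subst (1 2) ex[OF that(1)], subst (1 2) ex[OF that(2)], subst (1 2) ex[OF that(3)])
    apply (subst vol, subst det4_tangent_expand[OF e])
    using \<open>det4 v e1 e2 e3 \<noteq> 0\<close> by (simp add: k_def)
  ultimately show ?thesis by blast
qed

text \<open>Near \<open>v0\<close> the factor is a quotient of continuous functions, and it takes
  only the two values plus and minus sqrt \<bar>K\<bar>.\<close>

lemma volume_form_factor_locally_constant:
  assumes "volume_form p q K vol" "v0 \<in> space_form p q K"
    and sq: "\<And>v. v \<in> space_form p q K \<Longrightarrow> (k v)\<^sup>2 = \<bar>K\<bar>"
    and k: "\<And>v u w z. v \<in> space_form p q K \<Longrightarrow> u \<in> tangent p q v \<Longrightarrow> w \<in> tangent p q v \<Longrightarrow>
      z \<in> tangent p q v \<Longrightarrow> vol v u w z = k v * det4 v u w z"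
  shows "\<exists>U. open U \<and> v0 \<in> U \<and> (\<forall>v \<in> space_form p q K \<inter> U. k v = k v0)"
proof -
  obtain a b c where D: "(det4 v0 a b c)\<^sup>2 * \<bar>K\<bar> = 1"
    using exists_orthonormal_frame[OF assms(2)] by metis
  let ?P = "tangent_proj p q K"
  obtain U F where U: "open U" "v0 \<in> U" "smooth_on U F"
    and F: "\<And>v. v \<in> space_form p q K \<inter> U \<Longrightarrow> vol v (?P v a) (?P v b) (?P v c) = F v"
    using assms(1,2) unfolding volume_form_def smooth_on_subset_def by meson
  \<comment> \<open>Smoothness of the volume form is expressed through tangential projections; these
    alter \<open>a\<close>, \<open>b\<close>, \<open>c\<close> by multiples of \<open>v\<close>,
    which \<open>det4 v\<close> does not see.\<close>
  have F_eq: "F v = k v * det4 v a b c" if "v \<in> space_form p q K \<inter> U" for v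
  proof -
    have "F v = k v * det4 v (?P v a) (?P v b) (?P v c)"
      using F[OF that] k[of v] that tangent_proj_tangent by simp
    then show ?thesis
      by (simp add: tangent_proj_def det4_simps det4_same det4_same')
  qed
  define h where "h v = F v / det4 v a b c" for v
  have "isCont F v0"
    using smooth_on_continuous_on[OF U(3)] U by (simp add: continuous_on_eq_continuous_at)
  moreover have contD: "isCont (\<lambda>v. det4 v a b c) v0"
    by (simp add: linear_det4_1 linear_continuous_at linear_conv_bounded_linear[symmetric])
  moreover have D0: "det4 v0 a b c \<noteq> 0" using D by auto
  ultimately have "isCont h v0" unfolding h_def by (intro continuous_intros)
  moreover have s: "sqrt \<bar>K\<bar> > 0" using K by simp
  \<comment> \<open>A change of sign would be a jump by twice this bound.\<close>
  ultimately obtain d where d: "d > 0" "\<And>v. dist v v0 < d \<Longrightarrow> dist (h v) (h v0) < sqrt \<bar>K\<bar>"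
    unfolding continuous_at_eps_delta by blast
  obtain d' where d': "d' > 0" "\<And>v. dist v v0 < d' \<Longrightarrow> dist (det4 v a b c) (det4 v0 a b c) < \<bar>det4 v0 a b c\<bar>"
    using contD D0 unfolding continuous_at_eps_delta by (meson zero_less_abs_iff)
  define W where "W = U \<inter> ball v0 d \<inter> ball v0 d'"
  have "k v = k v0" if v: "v \<in> space_form p q K \<inter> W" for v
  proof -
    have "det4 v a b c \<noteq> 0" using d'(2)[of v] v by (auto simp: W_def dist_commute dist_real_def)
    then have "h v = k v" using F_eq[of v] v by (simp add: h_def W_def)
    moreover have "h v0 = k v0" using F_eq[of v0] U assms(2) D0 by (simp add: h_def)
    ultimately have "\<bar>k v - k v0\<bar> < sqrt \<bar>K\<bar>"
      using d(2)[of v] v by (simp add: W_def dist_commute dist_real_def)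
    moreover have "\<bar>k v\<bar> = sqrt \<bar>K\<bar>" "\<bar>k v0\<bar> = sqrt \<bar>K\<bar>"
      using sq[of v] sq[OF assms(2)] v by (metis IntD1 real_sqrt_abs)+
    ultimately show ?thesis using s by arith
  qed
  moreover have "open W" "v0 \<in> W" using U d d' by (auto simp: W_def)
  ultimately show ?thesis by blast
qed

lemma killing_field_tangent:
  assumes "Y \<in> bivectors"
  shows "killing_field p q Y v \<in> tangent p q v"
proof -
  have "linear (\<lambda>Y. \<langle>v, killing_field p q Y v\<rangle>)"
    by (rule linearI) (simp_all add: linear_add[OF linear_killing_field] linear_scale[OF linear_killing_field] pq_form_simps)
  from bivectors_linear_expand[OF this assms] show ?thesis
    by (simp add: tangent_def killing_field_wedge pq_form_simps pq_form_commute[of p q v])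
qed

text \<open>Projecting \<open>a\<close> and \<open>b\<close> to the tangent space makes the
  determinant vanish; the correction terms containing \<open>v\<close> are K times the determinant
  with the Killing field. On the right the base point is gone, so the 2-form has constant
  coefficients.\<close>

lemma det4_killing_field_wedge:
  assumes "v \<in> space_form p q K" "u \<in> tangent p q v" "w \<in> tangent p q v"
  shows "det4 v (killing_field p q (wedge a b) v) u w = - det4 a b u w / K"
proof -
  let ?P = "tangent_proj p q K v"
  have "det4 (?P a) (?P b) u w = 0"
    using assms tangent_proj_tangent by (intro det4_tangent_zero) auto
  then have "det4 a b u w = K * (\<langle>v, a\<rangle> * det4 v b u w) + K * (\<langle>v, b\<rangle> * det4 a v u w)"
    by (simp add: tangent_proj_def det4_simps det4_same algebra_simps)
  then show ?thesis
    using K by (simp add: killing_field_wedge det4_simps pq_form_commute[of p q v] det4_swap12[of a v] field_simps)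
qed

lemma det4_killing_field:
  assumes "Y \<in> bivectors" "v \<in> space_form p q K" "u \<in> tangent p q v" "w \<in> tangent p q v"
  shows "det4 v (killing_field p q Y v) u w = - bivector_det Y u w / K"
proof -
  have "linear (\<lambda>Y. det4 v (killing_field p q Y v) u w)"
    by (rule linearI) (simp_all add: linear_add[OF linear_killing_field] linear_scale[OF linear_killing_field] det4_simps)
  from bivectors_linear_expand[OF this assms(1)] show ?thesis
    by (simp add: bivector_det_def det4_killing_field_wedge[OF assms(2-4)] sum_divide_distrib sum_negf mult.commute)
qed

text \<open>A form of Hodge duality: with \<open>x\<close> and \<open>a\<close> in two slots, the
  determinant sees only the components of the bivector along \<open>n\<close> and \<open>b\<close>.
  The premise on \<open>k\<close> normalises the frame and fixes the sign.\<close>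

lemma bivector_det_orthogonal_frame:
  assumes "Y \<in> bivectors"
    and on: "\<langle>x, n\<rangle> = 0" "\<langle>x, a\<rangle> = 0" "\<langle>x, b\<rangle> = 0" "\<langle>n, a\<rangle> = 0" "\<langle>n, b\<rangle> = 0" "\<langle>a, b\<rangle> = 0"
    and norms: "\<langle>x, x\<rangle> \<noteq> 0" "\<langle>n, n\<rangle> = 1" "\<langle>a, a\<rangle> = r" "\<langle>b, b\<rangle> = r" "r \<noteq> 0"
    and k: "k * det4 x n a b = r"
  shows "k * bivector_det Y x a = - bivector_inner p q (wedge n b) Y"
proof -
  have "k * det4 s t x a = - (\<langle>n, s\<rangle> * \<langle>b, t\<rangle> - \<langle>n, t\<rangle> * \<langle>b, s\<rangle>)" for s t
  proof -
    have ex: "y = (\<langle>x, y\<rangle> / \<langle>x, x\<rangle>) *\<^sub>R x + \<langle>n, y\<rangle> *\<^sub>R n + (\<langle>a, y\<rangle> / r) *\<^sub>R a + (\<langle>b, y\<rangle> / r) *\<^sub>R b" for y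
      using orthogonal_frame_expand[OF on, of y] norms by simp
    have perm: "det4 n b x a = - det4 x n a b"
      using det4_swap23[of n b x a] det4_swap12[of n x b a] det4_swap34[of x n b a] by simp
    have perm': "det4 b n x a = det4 x n a b"
      using det4_swap12[of b n x a] perm by simp
    have "det4 s t x a = (\<langle>n, s\<rangle> * (\<langle>b, t\<rangle> / r) - \<langle>n, t\<rangle> * (\<langle>b, s\<rangle> / r)) * det4 n b x a"
      apply (subst ex[of s], subst ex[of t])
      unfolding det4_simps
      by (simp only: det4_same det4_same' perm perm') (simp add: algebra_simps)
    then have "k * det4 s t x a = - (\<langle>n, s\<rangle> * (\<langle>b, t\<rangle> / r) - \<langle>n, t\<rangle> * (\<langle>b, s\<rangle> / r)) * (k * det4 x n a b)"
      by (simp only: perm mult_minus_right mult_minus_left ac_simps)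
    then have "k * det4 s t x a = - (\<langle>n, s\<rangle> * (\<langle>b, t\<rangle> / r) - \<langle>n, t\<rangle> * (\<langle>b, s\<rangle> / r)) * r"
      by (simp only: k)
    then show ?thesis using norms(5) by (simp add: left_diff_distrib)
  qed
  then have "k * det4 s t x a = - bivector_inner p q (wedge n b) (wedge s t)" for s t
    by (simp add: bivector_inner_wedge)
  then show ?thesis
    using bivectors_linear_expand[OF linear_bivector_inner assms(1), of p q "wedge n b"]
    by (simp add: bivector_det_def sum_distrib_left sum_negf sum_divide_distrib mult.left_commute[of k])
qed

text \<open>A 1-form whose coefficients are linear in the position and antisymmetric has as exterior
  derivative twice the corresponding constant 2-form; this is the 2 in \<open>2 * K\<close>.\<close>

lemma primitive_on_killing_field:
  assumes "volume_form p q K vol" "Y \<in> bivectors"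
    and sq: "\<And>v. v \<in> space_form p q K \<Longrightarrow> (k v)\<^sup>2 = \<bar>K\<bar>"
    and k: "\<And>v u w z. v \<in> space_form p q K \<Longrightarrow> u \<in> tangent p q v \<Longrightarrow> w \<in> tangent p q v \<Longrightarrow>
      z \<in> tangent p q v \<Longrightarrow> vol v u w z = k v * det4 v u w z"
  shows "primitive_on p q K (\<lambda>v w. - (k v / (2 * K)) * bivector_det Y v w)
    (\<lambda>v. vol v (killing_field p q Y v))"
  unfolding primitive_on_def
proof
  fix v0 assume v0: "v0 \<in> space_form p q K"
  have "\<exists>U. open U \<and> v0 \<in> U \<and> (\<forall>v \<in> space_form p q K \<inter> U. k v = k v0)"
    by (rule volume_form_factor_locally_constant[OF assms(1) v0]) (rule sq k; assumption)+
  then obtain U where U: "open U" "v0 \<in> U" and kU: "\<And>v. v \<in> space_form p q K \<inter> U \<Longrightarrow> k v = k v0"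
    by blast
  \<comment> \<open>The factor is frozen at \<open>v0\<close>, which leaves the 1-form unchanged on
    M near \<open>v0\<close> and makes its extension linear.\<close>
  define A :: "real^4 \<Rightarrow> real^4" where "A y = (\<chi> i. - (k v0 / (2 * K)) * bivector_det Y y (axis i 1))" for y
  have linA: "linear A"
    unfolding A_def by (rule linearI) (simp_all add: vec_eq_iff linear_add[OF linear_bivector_det(1)]
        linear_scale[OF linear_bivector_det(1)] algebra_simps)
  have dA: "frechet_derivative A (at y) = A" for y
    using frechet_derivative_at[OF linear_imp_has_derivative[OF linA]] by simp
  have A_inner: "A y \<bullet> w = - (k v0 / (2 * K)) * bivector_det Y y w" for y w
  proof -
    have "bivector_det Y y w = (\<Sum>i\<in>UNIV. w $ i * bivector_det Y y (axis i 1))"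
      by (subst vec_expand[of w])
        (simp add: linear_sum[OF linear_bivector_det(2)] linear_scale[OF linear_bivector_det(2)])
    then show ?thesis by (simp add: A_def inner_vec_def sum_distrib_left ac_simps)
  qed
  show "\<exists>U A. open U \<and> v0 \<in> U \<and> smooth_on U A \<and> (\<forall>y\<in>space_form p q K \<inter> U.
      (\<forall>w\<in>tangent p q y. - (k y / (2 * K)) * bivector_det Y y w = A y \<bullet> w) \<and>
      (\<forall>u\<in>tangent p q y. \<forall>w\<in>tangent p q y. vol y (killing_field p q Y y) u w =
        frechet_derivative A (at y) u \<bullet> w - frechet_derivative A (at y) w \<bullet> u))"
  proof (intro exI[of _ U] exI[of _ A] conjI ballI)
    fix y u w assume y: "y \<in> space_form p q K \<inter> U" and uw: "u \<in> tangent p q y" "w \<in> tangent p q y"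
    have "vol y (killing_field p q Y y) u w = k v0 * det4 y (killing_field p q Y y) u w"
      using k[of y] kU[OF y] y uw killing_field_tangent[OF assms(2)] by simp
    also have "\<dots> = A u \<bullet> w - A w \<bullet> u"
    proof -
      have "det4 y (killing_field p q Y y) u w = - bivector_det Y u w / K"
        using det4_killing_field[OF assms(2)] y uw by simp
      then show ?thesis
        using bivector_det_commute[of Y w u] K by (simp only: A_inner) (simp add: field_simps)
    qed
    finally show "vol y (killing_field p q Y y) u w =
        frechet_derivative A (at y) u \<bullet> w - frechet_derivative A (at y) w \<bullet> u"
      by (simp add: dA)
  qed (use U kU smooth_on_linear[OF linA] A_inner in auto)
qed

end

section \<open>Closed 1-forms on the space form\<close>

lemma Ck_on_local:
  assumes "\<And>x. x \<in> S \<Longrightarrow> \<exists>U. open U \<and> x \<in> U \<and> Ck_on k U f"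
  shows "Ck_on k S f"
  using assms
proof (induction k arbitrary: f)
  case 0
  have "isCont f x" if "x \<in> S" for x
  proof -
    obtain U where "open U" "x \<in> U" "continuous_on U f" using 0[OF \<open>x \<in> S\<close>] by auto
    then show ?thesis using continuous_on_eq_continuous_at by blast
  qed
  then show ?case by (simp add: continuous_at_imp_continuous_on)
next
  case (Suc k)
  have "f differentiable at x" if "x \<in> S" for x
    using Suc.prems[OF that] by auto
  moreover have "Ck_on k S (\<lambda>x. frechet_derivative f (at x) v)" for v
    by (rule Suc.IH) (use Suc.prems in \<open>fastforce\<close>)
  ultimately show ?case by simp
qed

lemma smooth_on_local:
  assumes "\<And>x. x \<in> S \<Longrightarrow> \<exists>U. open U \<and> x \<in> U \<and> smooth_on U f"
  shows "smooth_on S f"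
  using assms Ck_on_local[of S _ f] unfolding smooth_on_def by meson

lemma primitive_on_diff:
  assumes "primitive_on p q K \<alpha> \<beta>" "primitive_on p q K \<alpha>' \<beta>"
  shows "primitive_on p q K (\<lambda>v w. \<alpha> v w - \<alpha>' v w) (\<lambda>v u w. 0)"
  unfolding primitive_on_def
proof
  fix v assume v: "v \<in> space_form p q K"
  obtain U A where U: "open U" "v \<in> U" "smooth_on U A"
    and A: "\<And>y w. y \<in> space_form p q K \<inter> U \<Longrightarrow> w \<in> tangent p q y \<Longrightarrow> \<alpha> y w = A y \<bullet> w"
      "\<And>y u w. y \<in> space_form p q K \<inter> U \<Longrightarrow> u \<in> tangent p q y \<Longrightarrow> w \<in> tangent p q y \<Longrightarrow>
        \<beta> y u w = frechet_derivative A (at y) u \<bullet> w - frechet_derivative A (at y) w \<bullet> u"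
    using bspec[OF assms(1)[unfolded primitive_on_def] v] by blast
  obtain U' A' where U': "open U'" "v \<in> U'" "smooth_on U' A'"
    and A': "\<And>y w. y \<in> space_form p q K \<inter> U' \<Longrightarrow> w \<in> tangent p q y \<Longrightarrow> \<alpha>' y w = A' y \<bullet> w"
      "\<And>y u w. y \<in> space_form p q K \<inter> U' \<Longrightarrow> u \<in> tangent p q y \<Longrightarrow> w \<in> tangent p q y \<Longrightarrow>
        \<beta> y u w = frechet_derivative A' (at y) u \<bullet> w - frechet_derivative A' (at y) w \<bullet> u"
    using bspec[OF assms(2)[unfolded primitive_on_def] v] by blast
  have d: "frechet_derivative (\<lambda>y. A y - A' y) (at y) =
      (\<lambda>u. frechet_derivative A (at y) u - frechet_derivative A' (at y) u)" if "y \<in> U \<inter> U'" for y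
    by (rule frechet_derivative_at[symmetric], rule has_derivative_diff;
        rule smooth_on_has_derivative) (use that U U' in auto)
  have "smooth_on (U \<inter> U') (\<lambda>y. A y - A' y)"
    using U U' by (intro smooth_on_minus) (auto intro: smooth_on_subset)
  then show "\<exists>U A. open U \<and> v \<in> U \<and> smooth_on U A \<and> (\<forall>y\<in>space_form p q K \<inter> U.
      (\<forall>w\<in>tangent p q y. \<alpha> y w - \<alpha>' y w = A y \<bullet> w) \<and>
      (\<forall>u\<in>tangent p q y. \<forall>w\<in>tangent p q y. 0 =
        frechet_derivative A (at y) u \<bullet> w - frechet_derivative A (at y) w \<bullet> u))"
  proof (intro exI[of _ "U \<inter> U'"] exI[of _ "\<lambda>y. A y - A' y"] conjI ballI)
    fix y u w assume "y \<in> space_form p q K \<inter> (U \<inter> U')" "u \<in> tangent p q y" "w \<in> tangent p q y"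
    then show "0 = frechet_derivative (\<lambda>y. A y - A' y) (at y) u \<bullet> w -
        frechet_derivative (\<lambda>y. A y - A' y) (at y) w \<bullet> u"
      using A(2)[of y u w] A'(2)[of y u w] by (simp add: d inner_diff_left)
  qed (use U U' A(1) A'(1) in \<open>auto simp: inner_diff_left\<close>)
qed

text \<open>Six convex half-spaces cover the complement of the line. Half-spaces for different
  coordinates always meet, so in the listed order each one meets an earlier one.\<close>

lemma connected_complement_axis: "connected {v::real^4. v $ 0 \<noteq> 0 \<or> v $ 1 \<noteq> 0 \<or> v $ 2 \<noteq> 0}"
proof -
  define P where "P i s = {v::real^4. s * v $ i > 0}" for i and s :: real
  have conn: "connected (P i s)" for i s
  proof -
    have P: "P i s = {v. (s *\<^sub>R axis i 1) \<bullet> v > 0}" by (auto simp: P_def inner_axis')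
    show ?thesis
      unfolding P by (rule convex_connected[OF convex_halfspace_gt])
  qed
  have meet: "P i s \<inter> P j t \<noteq> {}" if "i \<noteq> j" "s \<noteq> 0" "t \<noteq> 0" for i j s t
  proof -
    have "s *\<^sub>R axis i 1 + t *\<^sub>R axis j 1 \<in> P i s \<inter> P j t"
      using that by (auto simp: P_def axis_def zero_less_mult_iff linorder_neq_iff)
    then show ?thesis by blast
  qed
  have "connected (P 0 1 \<union> P 1 1 \<union> P 1 (-1) \<union> P 2 1 \<union> P 2 (-1) \<union> P 0 (-1))"
    using meet[of 0 1 1 1] meet[of 0 1 1 "-1"] meet[of 0 2 1 1] meet[of 0 2 1 "-1"] meet[of 1 0 1 "-1"]
    by (intro connected_Un conn) auto
  moreover have "P 0 1 \<union> P 1 1 \<union> P 1 (-1) \<union> P 2 1 \<union> P 2 (-1) \<union> P 0 (-1) =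
      {v. v $ 0 \<noteq> 0 \<or> v $ 1 \<noteq> 0 \<or> v $ 2 \<noteq> 0}"
    by (auto simp: P_def)
  ultimately show ?thesis by simp
qed

section \<open>The cone over the space form and its radial retraction\<close>

context space_form_signature
begin

text \<open>The open union of the rays through M: the punctured space for K > 0, the timelike
  vectors for K < 0.\<close>

definition pos_cone :: "(real^4) set" where "pos_cone = {v. K * \<langle>v, v\<rangle> > 0}"

lemma smooth_on_form:
  "open S \<Longrightarrow> smooth_on S f \<Longrightarrow> smooth_on S g \<Longrightarrow> smooth_on S (\<lambda>x. \<langle>f x, g x\<rangle>)"
  by (rule smooth_on_bilinear[OF bounded_bilinear_pq_form])

lemma open_cone: "open pos_cone"
proof -
  have "continuous_on UNIV (\<lambda>v. K * \<langle>v, v\<rangle>)"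
    by (intro continuous_intros bounded_bilinear.continuous_on[OF bounded_bilinear_pq_form])
  then show ?thesis unfolding pos_cone_def by (intro open_Collect_less) (auto intro: continuous_on_const)
qed

text \<open>Used for s = 1 and s = -1. For K > 0 it is R^4 without the closed ray opposite to
  \<open>s\<close> times the axis of index 3; for K < 0 it is one sheet of the cone.\<close>

definition half_cone :: "real \<Rightarrow> (real^4) set" where
  "half_cone s = (if K > 0 then - {v. v $ 0 = 0 \<and> v $ 1 = 0 \<and> v $ 2 = 0 \<and> s * v $ 3 \<le> 0}
    else {v \<in> pos_cone. s * v $ 3 > 0})"

lemma form_decompose:
  "K > 0 \<Longrightarrow> \<langle>v, v\<rangle> = (v $ 0)\<^sup>2 + (v $ 1)\<^sup>2 + (v $ 2)\<^sup>2 + (v $ 3)\<^sup>2"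
  "K < 0 \<Longrightarrow> \<langle>v, v\<rangle> = (v $ 0)\<^sup>2 + (v $ 1)\<^sup>2 + (v $ 2)\<^sup>2 - (v $ 3)\<^sup>2"
proof -
  have "(4::4) = 0" by simp
  then have "v $ 4 = v $ 0" by (simp only:)
  then show "K > 0 \<Longrightarrow> \<langle>v, v\<rangle> = (v $ 0)\<^sup>2 + (v $ 1)\<^sup>2 + (v $ 2)\<^sup>2 + (v $ 3)\<^sup>2"
    by (simp add: form_pos inner_vec_def sum_4 power2_eq_square)
qed (simp add: form_neg power2_eq_square)

lemma cone_eq: "pos_cone = half_cone 1 \<union> half_cone (- 1)"
proof (cases "K > 0")
  case True
  have "v \<in> pos_cone \<longleftrightarrow> \<not> (v $ 0 = 0 \<and> v $ 1 = 0 \<and> v $ 2 = 0 \<and> v $ 3 = 0)" for v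
  proof -
    have "v \<in> pos_cone \<longleftrightarrow> v \<noteq> 0" using True by (simp add: pos_cone_def form_pos zero_less_mult_iff)
    moreover have "(4::4) = 0" by simp
    then have "v $ 4 = v $ 0" by (simp only:)
    then have "v = 0 \<longleftrightarrow> v $ 0 = 0 \<and> v $ 1 = 0 \<and> v $ 2 = 0 \<and> v $ 3 = 0"
      unfolding vec_eq_iff forall_4 zero_index by argo
    ultimately show ?thesis by simp
  qed
  moreover have "v \<in> half_cone 1 \<union> half_cone (- 1) \<longleftrightarrow>
      \<not> (v $ 0 = 0 \<and> v $ 1 = 0 \<and> v $ 2 = 0 \<and> v $ 3 = 0)" for v
    using True unfolding half_cone_def by (simp only: if_True Un_iff Compl_iff mem_Collect_eq) argo
  ultimately show ?thesis by blast
next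
  case False
  then have "K < 0" using K by simp
  then have "v $ 3 \<noteq> 0" if "v \<in> pos_cone" for v
    using that by (auto simp: pos_cone_def form_decompose zero_less_mult_iff not_less dest: leD)
      (smt (verit, best) zero_le_power2)
  with False show ?thesis by (fastforce simp: half_cone_def)
qed

lemma open_half_cone: "open (half_cone s)"
proof (cases "K > 0")
  case True
  have "closed {v::real^4. v $ 0 = 0 \<and> v $ 1 = 0 \<and> v $ 2 = 0 \<and> s * v $ 3 \<le> 0}"
    by (intro closed_Collect_conj closed_Collect_eq closed_Collect_le continuous_intros)
  with True show ?thesis by (simp add: half_cone_def open_Compl)
next
  case False
  have "open {v::real^4. s * v $ 3 > 0}"
    by (intro open_Collect_less continuous_intros)
  with open_cone have "open (pos_cone \<inter> {v::real^4. s * v $ 3 > 0})" by blast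
  with False show ?thesis by (simp add: half_cone_def Collect_conj_eq)
qed

text \<open>The centre is \<open>s\<close> times the axis of index 3. Along a segment from it the
  first three coordinates are scaled by \<open>t\<close>, while the last one, taken with sign
  \<open>s\<close>, is at least \<open>t\<close> times its value at the end; this keeps the point
  off the removed ray, respectively inside the sheet.\<close>

lemma starlike_half_cone:
  assumes "s\<^sup>2 = 1"
  shows "starlike (half_cone s)"
proof -
  have s: "s * s = 1" using assms by (simp add: power2_eq_square)
  let ?a = "s *\<^sub>R axis 3 1 :: real^4"
  \<comment> \<open>Admitting \<open>v = ?a\<close> makes the same computation show that the centre
    itself belongs to the set.\<close>
  have "(1 - t) *\<^sub>R ?a + t *\<^sub>R v \<in> half_cone s" if v: "v = ?a \<or> v \<in> half_cone s" and t: "0 \<le> t" "t \<le> 1" for v t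
  proof -
    let ?w = "(1 - t) *\<^sub>R ?a + t *\<^sub>R v"
    have w: "?w $ 0 = t * v $ 0" "?w $ 1 = t * v $ 1" "?w $ 2 = t * v $ 2" "s * ?w $ 3 = (1 - t) + t * (s * v $ 3)"
      using s by (simp_all add: axis_nth_if algebra_simps)
    show ?thesis
    proof (cases "K > 0")
      case True
      have "t = 0 \<or> v $ 0 \<noteq> 0 \<or> v $ 1 \<noteq> 0 \<or> v $ 2 \<noteq> 0 \<or> s * v $ 3 > 0"
        using v s True by (auto simp: half_cone_def axis_nth_if)
      moreover have "s * ?w $ 3 > 0" if "s * v $ 3 > 0"
        unfolding w using that t by (cases "t = 0") (auto intro: add_nonneg_pos)
      moreover have "s * ?w $ 3 > 0" if "t = 0" unfolding w using that by simp
      ultimately have "?w $ 0 \<noteq> 0 \<or> ?w $ 1 \<noteq> 0 \<or> ?w $ 2 \<noteq> 0 \<or> s * ?w $ 3 > 0"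
        unfolding w by (metis mult_eq_0_iff)
      then show ?thesis using True by (auto simp only: half_cone_def if_True Compl_iff mem_Collect_eq not_le)
    next
      case False
      then have "K < 0" using K by simp
      have pos_cone: "u \<in> half_cone s \<longleftrightarrow> (u $ 0)\<^sup>2 + (u $ 1)\<^sup>2 + (u $ 2)\<^sup>2 < (s * u $ 3)\<^sup>2 \<and> s * u $ 3 > 0" for u
        using False \<open>K < 0\<close> assms
        by (simp add: half_cone_def pos_cone_def form_decompose zero_less_mult_iff power_mult_distrib)
      have v': "(v $ 0)\<^sup>2 + (v $ 1)\<^sup>2 + (v $ 2)\<^sup>2 < (s * v $ 3)\<^sup>2" "s * v $ 3 > 0"
        using v s unfolding pos_cone by (auto simp: axis_nth_if)
      have pos: "s * ?w $ 3 > 0" unfolding w using v' t by (cases "t = 0") (auto intro: add_nonneg_pos)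
      have "t\<^sup>2 * ((v $ 0)\<^sup>2 + (v $ 1)\<^sup>2 + (v $ 2)\<^sup>2) < (s * ?w $ 3)\<^sup>2"
      proof (cases "t = 0")
        case False
        then have "t\<^sup>2 * ((v $ 0)\<^sup>2 + (v $ 1)\<^sup>2 + (v $ 2)\<^sup>2) < (t * (s * v $ 3))\<^sup>2"
          using v' by (simp add: power_mult_distrib[of t "s * v $ 3"])
        also have "\<dots> \<le> (s * ?w $ 3)\<^sup>2"
          unfolding w using v' t by (intro power_mono) auto
        finally show ?thesis .
      next
        case True
        have "0 < (s * ?w $ 3)\<^sup>2" using pos by (rule zero_less_power)
        then show ?thesis unfolding True by (simp only: zero_power2 mult_zero_left)
      qed
      then show ?thesis
        unfolding pos_cone using pos unfolding w by (simp add: power_mult_distrib distrib_left)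
    qed
  qed
  note * = this
  have "?a \<in> half_cone s" using *[of ?a 1] by simp
  moreover have "closed_segment ?a v \<subseteq> half_cone s" if "v \<in> half_cone s" for v
  proof
    fix y assume "y \<in> closed_segment ?a v"
    then obtain t where "0 \<le> t" "t \<le> 1" "y = (1 - t) *\<^sub>R ?a + t *\<^sub>R v" unfolding in_segment by blast
    then show "y \<in> half_cone s" using * that by blast
  qed
  ultimately show ?thesis unfolding starlike_def by blast
qed

lemma connected_half_cones: "connected (half_cone 1 \<inter> half_cone (- 1))"
proof (cases "K > 0")
  case True
  then have "half_cone 1 \<inter> half_cone (- 1) = {v. v $ 0 \<noteq> 0 \<or> v $ 1 \<noteq> 0 \<or> v $ 2 \<noteq> 0}"
    by (auto simp: half_cone_def)
  then show ?thesis using connected_complement_axis by simp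
next
  case False
  then have "half_cone 1 \<inter> half_cone (- 1) = {}" by (auto simp: half_cone_def)
  then show ?thesis by simp
qed

text \<open>Radial projection onto M, where \<open>K\<close> times the square of \<open>v\<close> is
  1; the power keeps smoothness within reach of \<open>smooth_on_powr\<close>.\<close>

definition retract :: "real^4 \<Rightarrow> real^4" where "retract v = (K * \<langle>v, v\<rangle>) powr (- 1 / 2) *\<^sub>R v"

lemma space_form_subset_cone: "space_form p q K \<subseteq> pos_cone"
  using K by (auto simp: space_form_def pos_cone_def)

lemma retract_in: "v \<in> pos_cone \<Longrightarrow> retract v \<in> space_form p q K"
proof -
  assume "v \<in> pos_cone"
  then have pos: "K * \<langle>v, v\<rangle> > 0" by (simp add: pos_cone_def)
  have "(K * \<langle>v, v\<rangle>) powr (- 1 / 2) * (K * \<langle>v, v\<rangle>) powr (- 1 / 2) = 1 / (K * \<langle>v, v\<rangle>)"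
    using pos by (simp add: powr_add[symmetric] powr_minus_divide)
  moreover have "\<langle>v, v\<rangle> \<noteq> 0" using pos by auto
  ultimately show ?thesis
    using K by (simp add: space_form_def retract_def pq_form_simps mult.assoc[symmetric])
qed

lemma smooth_on_retract: "smooth_on pos_cone retract"
  unfolding retract_def
proof (rule smooth_on_scaleR[OF open_cone _ smooth_on_linear[OF _ open_cone]])
  show "smooth_on pos_cone (\<lambda>v. (K * \<langle>v, v\<rangle>) powr (- 1 / 2))"
  proof (rule smooth_on_compose[of "{0<..}" "\<lambda>x. x powr (- 1 / 2)"])
    show "smooth_on {0<..} (\<lambda>x::real. x powr (- 1 / 2))"
      using smooth_on_powr[of 1 "- 1 / 2"] by simp
    show "smooth_on pos_cone (\<lambda>v. K * \<langle>v, v\<rangle>)"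
      by (intro smooth_on_mult smooth_on_form smooth_on_const open_cone smooth_on_linear)
        (auto intro: linearI)
  qed (use open_cone in \<open>auto simp: pos_cone_def\<close>)
qed (auto intro: linearI)

text \<open>Differentiation of the constant square 1/K of \<open>retract v\<close>.\<close>

lemma retract_derivative_tangent:
  assumes "v \<in> pos_cone"
  shows "frechet_derivative retract (at v) w \<in> tangent p q (retract v)"
proof -
  let ?r' = "frechet_derivative retract (at v)"
  have r: "(retract has_derivative ?r') (at v)"
    using smooth_on_has_derivative[OF smooth_on_retract assms] .
  have "((\<lambda>v. \<langle>retract v, retract v\<rangle>) has_derivative (\<lambda>w. \<langle>retract v, ?r' w\<rangle> + \<langle>?r' w, retract v\<rangle>)) (at v)"
    by (rule bounded_bilinear.FDERIV[OF bounded_bilinear_pq_form r r])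
  moreover have "((\<lambda>v. \<langle>retract v, retract v\<rangle>) has_derivative (\<lambda>w. 0)) (at v)"
    by (rule has_derivative_transform_within_open[OF has_derivative_const open_cone assms, of "1 / K"])
      (use retract_in in \<open>auto simp: space_form_def\<close>)
  ultimately have "(\<lambda>w. \<langle>retract v, ?r' w\<rangle> + \<langle>?r' w, retract v\<rangle>) = (\<lambda>w. 0)"
    by (rule has_derivative_unique)
  then have "\<langle>retract v, ?r' w\<rangle> + \<langle>?r' w, retract v\<rangle> = 0" by metis
  then show ?thesis by (simp add: tangent_def pq_form_commute[of p q "?r' w"])
qed

lemma retract_id: "v \<in> space_form p q K \<Longrightarrow> retract v = v"
  using K by (simp add: retract_def space_form_def)

text \<open>On M the scaling factor is 1, and its derivative is proportional to the form of
  \<open>v\<close> and \<open>w\<close>, which vanishes on tangent vectors.\<close>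

lemma retract_derivative_id:
  assumes "v \<in> space_form p q K" "w \<in> tangent p q v"
  shows "frechet_derivative retract (at v) w = w"
proof -
  have Kv: "K * \<langle>v, v\<rangle> = 1" using assms K by (simp add: space_form_def)
  have "((\<lambda>v. K * \<langle>v, v\<rangle>) has_derivative (\<lambda>w. K * (\<langle>v, w\<rangle> + \<langle>w, v\<rangle>))) (at v)"
    by (intro has_derivative_mult_right bounded_bilinear.FDERIV[OF bounded_bilinear_pq_form] has_derivative_ident)
  moreover have "((\<lambda>x. x powr (- 1 / 2)) has_derivative (\<lambda>h. (- 1 / 2) * h)) (at (K * \<langle>v, v\<rangle>))"
    unfolding Kv by (auto intro!: derivative_eq_intros)
  ultimately have "((\<lambda>v. (K * \<langle>v, v\<rangle>) powr (- 1 / 2)) has_derivative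
      (\<lambda>w. (- 1 / 2) * (K * (\<langle>v, w\<rangle> + \<langle>w, v\<rangle>)))) (at v)"
    by (rule has_derivative_compose)
  from has_derivative_scaleR[OF this has_derivative_ident]
  have "(retract has_derivative (\<lambda>w. (K * \<langle>v, v\<rangle>) powr (- 1 / 2) *\<^sub>R w +
      ((- 1 / 2) * (K * (\<langle>v, w\<rangle> + \<langle>w, v\<rangle>))) *\<^sub>R v)) (at v)"
    by (simp add: retract_def[abs_def])
  from frechet_derivative_at[OF this, symmetric] show ?thesis
    using assms(2) by (simp add: Kv tangent_def pq_form_commute[of p q w])
qed

text \<open>A closed 1-form on the space form is pulled back to the cone by the radial retraction; the
  pos_cone is a union of two starlike sets with connected intersection.\<close>

lemma closed_form_on_space_form_exact:
  assumes "primitive_on p q K \<gamma> (\<lambda>v u w. 0)"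
  shows "\<exists>F. smooth_on pos_cone F \<and> (\<forall>y\<in>space_form p q K. \<forall>w\<in>tangent p q y.
    frechet_derivative F (at y) w = \<gamma> y w)"
proof -
  define r' where "r' v = frechet_derivative retract (at v)" for v
  \<comment> \<open>The coefficient vector of the pullback of \<open>\<gamma>\<close> under the
    retraction.\<close>
  define G :: "real^4 \<Rightarrow> real^4" where "G v = (\<Sum>b\<in>Basis. \<gamma> (retract v) (r' v b) *\<^sub>R b)" for v
  have r: "(retract has_derivative r' v) (at v)" if "v \<in> pos_cone" for v
    using smooth_on_has_derivative[OF smooth_on_retract that] by (simp add: r'_def)
  have r'_smooth: "smooth_on pos_cone (\<lambda>v. r' v w)" for w
    unfolding r'_def by (rule smooth_on_frechet_derivative[OF smooth_on_retract])
  have tan: "r' v w \<in> tangent p q (retract v)" if "v \<in> pos_cone" for v w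
    using retract_derivative_tangent[OF that] by (simp add: r'_def)
  \<comment> \<open>Differentiability is available only for the local extensions \<open>A\<close> of
    \<open>\<gamma>\<close>, so everything about \<open>G\<close> is transferred from
    \<open>A\<close> composed with the retraction.\<close>
  have local: "\<exists>W A. open W \<and> v \<in> W \<and> W \<subseteq> pos_cone \<and> smooth_on W (\<lambda>v. A (retract v)) \<and>
      (\<forall>y\<in>W. \<forall>w. G y \<bullet> w = A (retract y) \<bullet> r' y w) \<and>
      (\<forall>u w. frechet_derivative A (at (retract v)) (r' v u) \<bullet> r' v w =
         frechet_derivative A (at (retract v)) (r' v w) \<bullet> r' v u) \<and>
      A differentiable at (retract v)" if v: "v \<in> pos_cone" for v
  proof -
    obtain U A where U: "open U" "retract v \<in> U" "smooth_on U (A :: real^4 \<Rightarrow> real^4)"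
      and A: "\<And>y w. y \<in> space_form p q K \<inter> U \<Longrightarrow> w \<in> tangent p q y \<Longrightarrow> \<gamma> y w = A y \<bullet> w"
        "\<And>y u w. y \<in> space_form p q K \<inter> U \<Longrightarrow> u \<in> tangent p q y \<Longrightarrow> w \<in> tangent p q y \<Longrightarrow>
          0 = frechet_derivative A (at y) u \<bullet> w - frechet_derivative A (at y) w \<bullet> u"
      using bspec[OF assms(1)[unfolded primitive_on_def] retract_in[OF v]] by blast
    define W where "W = pos_cone \<inter> retract -` U"
    have "open W" unfolding W_def
      by (rule continuous_open_preimage[OF smooth_on_continuous_on[OF smooth_on_retract] open_cone U(1)])
    moreover have "smooth_on W (\<lambda>v. A (retract v))"
      by (rule smooth_on_compose[OF U(3) \<open>open W\<close> U(1)])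
        (auto simp: W_def intro: smooth_on_subset[OF smooth_on_retract])
    moreover have "G y \<bullet> w = A (retract y) \<bullet> r' y w" if "y \<in> W" for y w
    proof -
      have y: "y \<in> pos_cone" "retract y \<in> space_form p q K \<inter> U" using that retract_in by (auto simp: W_def)
      have "G y = (\<Sum>b\<in>Basis. (A (retract y) \<bullet> r' y b) *\<^sub>R b)"
        unfolding G_def using A(1)[OF y(2) tan[OF y(1)]] by simp
      moreover have "r' y w = (\<Sum>b\<in>Basis. (w \<bullet> b) *\<^sub>R r' y b)"
        by (rule linear_expand_basis[OF has_derivative_linear[OF r[OF y(1)]]])
      ultimately show ?thesis
        by (simp add: inner_sum_left inner_sum_right inner_commute[of w] mult.commute)
    qed
    moreover have "A differentiable at (retract v)"
      using smooth_on_has_derivative[OF U(3,2)] differentiable_def by blast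
    moreover have "frechet_derivative A (at (retract v)) (r' v u) \<bullet> r' v w =
         frechet_derivative A (at (retract v)) (r' v w) \<bullet> r' v u" for u w
      using A(2)[OF _ tan[OF v] tan[OF v], of u w] retract_in[OF v] U(2) by simp
    moreover have "v \<in> W" "W \<subseteq> pos_cone" using v U by (auto simp: W_def)
    ultimately show ?thesis by blast
  qed
  have G_smooth: "smooth_on pos_cone G"
  proof (rule smooth_on_local)
    fix v assume "v \<in> pos_cone"
    then obtain W A where W: "open W" "v \<in> W" "W \<subseteq> pos_cone" "smooth_on W (\<lambda>v. A (retract v))"
        "\<And>y w. y \<in> W \<Longrightarrow> G y \<bullet> w = A (retract y) \<bullet> r' y w"
      using local by metis
    have "smooth_on W (\<lambda>y. \<Sum>b\<in>Basis. (A (retract y) \<bullet> r' y b) *\<^sub>R b)"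
      by (intro smooth_on_sum smooth_on_scaleR smooth_on_inner smooth_on_const W
          smooth_on_subset[OF r'_smooth W(3)] finite_Basis)
    moreover have "(\<Sum>b\<in>Basis. (A (retract y) \<bullet> r' y b) *\<^sub>R b) = G y" if "y \<in> W" for y
      using W(5)[OF that] euclidean_representation[of "G y"] by simp
    ultimately have "smooth_on W G"
      using smooth_on_cong[OF W(1), of "\<lambda>y. \<Sum>b\<in>Basis. (A (retract y) \<bullet> r' y b) *\<^sub>R b" G] by blast
    then show "\<exists>U. open U \<and> v \<in> U \<and> smooth_on U G" using W by blast
  qed
  have sym: "frechet_derivative G (at v) u \<bullet> w = frechet_derivative G (at v) w \<bullet> u" if v: "v \<in> pos_cone" for v u w
  proof -
    obtain W A where W: "open W" "v \<in> W" "W \<subseteq> pos_cone"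
        "\<And>y w. y \<in> W \<Longrightarrow> G y \<bullet> w = A (retract y) \<bullet> r' y w"
      and A: "\<And>u w. frechet_derivative A (at (retract v)) (r' v u) \<bullet> r' v w =
         frechet_derivative A (at (retract v)) (r' v w) \<bullet> r' v u" "A differentiable at (retract v)"
      using local[OF v] by metis
    \<comment> \<open>The pullback of a closed form is closed: of the two terms, the first is
      symmetric in \<open>u\<close> and \<open>w\<close> as a second derivative of the retraction,
      the second because \<open>A\<close> is closed on tangent vectors.\<close>
    have "frechet_derivative G (at v) u \<bullet> w = A (retract v) \<bullet> frechet_derivative (\<lambda>y. r' y w) (at v) u +
        frechet_derivative A (at (retract v)) (r' v u) \<bullet> r' v w" for u w
    proof -
      have "((\<lambda>y. A (retract y)) has_derivative (\<lambda>u. frechet_derivative A (at (retract v)) (r' v u))) (at v)"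
        using has_derivative_compose[OF r[OF v]] A(2) frechet_derivative_works by blast
      from has_derivative_inner[OF this smooth_on_has_derivative[OF r'_smooth v, of w]]
      have "((\<lambda>y. G y \<bullet> w) has_derivative (\<lambda>u. A (retract v) \<bullet> frechet_derivative (\<lambda>y. r' y w) (at v) u +
        frechet_derivative A (at (retract v)) (r' v u) \<bullet> r' v w)) (at v)"
        by (rule has_derivative_transform_within_open[OF _ W(1,2)]) (simp add: W(4))
      from has_derivative_unique[OF has_derivative_inner_left[OF smooth_on_has_derivative[OF G_smooth v]] this]
      show ?thesis by metis
    qed
    moreover have "frechet_derivative (\<lambda>y. r' y w) (at v) u = frechet_derivative (\<lambda>y. r' y u) (at v) w"
      unfolding r'_def by (rule symmetric_second_derivative[OF open_cone v smooth_on_retract])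
    ultimately show ?thesis using A(1) by simp
  qed
  have "\<exists>f. \<forall>x\<in>half_cone 1 \<union> half_cone (- 1). (f has_derivative (\<lambda>h. G x \<bullet> h)) (at x)"
  proof (rule poincare_lemma_union)
    show "Ck_on 1 (half_cone 1 \<union> half_cone (- 1)) G"
      using G_smooth unfolding cone_eq smooth_on_def by blast
  qed (use open_half_cone starlike_half_cone connected_half_cones sym in \<open>auto simp: cone_eq\<close>)
  then obtain F where F: "\<And>x. x \<in> pos_cone \<Longrightarrow> (F has_derivative (\<lambda>h. G x \<bullet> h)) (at x)"
    unfolding cone_eq by blast
  have "smooth_on pos_cone F"
    by (rule smooth_onI[OF open_cone F])
      (auto intro: smooth_on_inner[OF open_cone G_smooth smooth_on_const[OF open_cone]])
  \<comment> \<open>At a point of M the retraction and its derivative on tangent vectors are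
    identities, so the pullback restricts to \<open>\<gamma>\<close> itself.\<close>
  moreover have "frechet_derivative F (at y) w = \<gamma> y w"
    if y: "y \<in> space_form p q K" and w: "w \<in> tangent p q y" for y w
  proof -
    have c: "y \<in> pos_cone" using y space_form_subset_cone by blast
    obtain U A where U: "y \<in> U"
      and A: "\<And>v w. v \<in> space_form p q K \<inter> U \<Longrightarrow> w \<in> tangent p q v \<Longrightarrow> \<gamma> v w = A v \<bullet> w"
      using bspec[OF assms(1)[unfolded primitive_on_def] y] by blast
    have "frechet_derivative F (at y) w = G y \<bullet> w"
      using frechet_derivative_at[OF F[OF c]] by metis
    also have "\<dots> = (\<Sum>b\<in>Basis. (A y \<bullet> r' y b) * (w \<bullet> b))"
      using tan[OF c] retract_id[OF y] A[of y] y U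
      by (simp add: G_def inner_sum_left inner_commute[of w])
    also have "\<dots> = A y \<bullet> r' y w"
      by (subst (2) linear_expand_basis[OF has_derivative_linear[OF r[OF c]]])
        (simp add: inner_sum_right mult.commute)
    also have "\<dots> = \<gamma> y w"
      using retract_derivative_id[OF y w] A[of y w] y U w by (simp add: r'_def)
    finally show ?thesis .
  qed
  ultimately show ?thesis by blast
qed

end

section \<open>Plane metrics\<close>

lemma area2_simps: "area2 \<xi> \<eta> = - area2 \<eta> \<xi>" "area2 \<xi> \<xi> = 0"
  by (simp_all add: area2_def)

lemma vec2_expand: "\<xi> = \<xi> $ 1 *\<^sub>R axis 1 1 + \<xi> $ 2 *\<^sub>R axis 2 1" for \<xi> :: "real^2"
  by (simp add: vec_eq_iff forall_2 axis_nth_if)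

lemma linear_expand2:
  fixes \<xi> :: "real^2"
  assumes "linear L"
  shows "L \<xi> = \<xi> $ 1 *\<^sub>R L (axis 1 1) + \<xi> $ 2 *\<^sub>R L (axis 2 1)"
  by (subst vec2_expand[of \<xi>]) (simp only: linear_add[OF assms] linear_scale[OF assms])

lemma det_bilin_matrix:
  "det (bilin_matrix g) = g (axis 1 1) (axis 1 1) * g (axis 2 1) (axis 2 1) -
    g (axis 1 1) (axis 2 1) * g (axis 2 1) (axis 1 1)"
  by (simp add: det_2 bilin_matrix_def)

text \<open>Rotation by a right angle in coordinates; it is the map that turns the metric into the
  area form, as \<open>g_rot2\<close> states. The power -1/2 makes its smooth dependence on the
  metric apparent.\<close>

definition rot2 :: "(real^2 \<Rightarrow> real^2 \<Rightarrow> real) \<Rightarrow> real^2 \<Rightarrow> real^2" where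
  "rot2 g \<xi> = (det (bilin_matrix g)) powr (- 1 / 2) *\<^sub>R
    (g (axis 1 1) \<xi> *\<^sub>R axis 2 1 - g (axis 2 1) \<xi> *\<^sub>R axis 1 1)"

locale metric2 =
  fixes g :: "real^2 \<Rightarrow> real^2 \<Rightarrow> real"
  assumes bilin: "bilinear g" and sym: "g \<xi> \<eta> = g \<eta> \<xi>" and pos: "\<xi> \<noteq> 0 \<Longrightarrow> g \<xi> \<xi> > 0"
begin

abbreviation "E \<equiv> g (axis 1 1) (axis 1 1)"
abbreviation "F \<equiv> g (axis 1 1) (axis 2 1)"
abbreviation "G \<equiv> g (axis 2 1) (axis 2 1)"
definition "W = sqrt (det (bilin_matrix g))"

lemma g_simps: "g (a + b) c = g a c + g b c" "g a (b + c) = g a b + g a c"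
  "g (a - b) c = g a c - g b c" "g a (b - c) = g a b - g a c"
  "g (r *\<^sub>R a) c = r * g a c" "g a (r *\<^sub>R c) = r * g a c" "g 0 c = 0" "g a 0 = 0"
  using bilin by (simp_all add: bilinear_ladd bilinear_radd bilinear_lsub bilinear_rsub bilinear_lmul
      bilinear_rmul bilinear_lzero bilinear_rzero)

lemma sym21: "g (axis 2 1) (axis 1 1) = F"
  by (rule sym)

lemma g_expand: "g \<xi> \<eta> = E * \<xi> $ 1 * \<eta> $ 1 + F * (\<xi> $ 1 * \<eta> $ 2 + \<xi> $ 2 * \<eta> $ 1) + G * \<xi> $ 2 * \<eta> $ 2"
  by (subst vec2_expand[of \<xi>], subst vec2_expand[of \<eta>])
    (simp only: g_simps sym21, simp add: algebra_simps)

lemma gram: "g \<xi> \<xi> * g \<eta> \<eta> - (g \<xi> \<eta>)\<^sup>2 = det (bilin_matrix g) * (area2 \<xi> \<eta>)\<^sup>2"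
  unfolding det_bilin_matrix sym21 g_expand[of \<xi>] g_expand[of \<eta>] area2_def
  by (simp add: power2_eq_square algebra_simps)

lemma E_pos: "E > 0"
  by (rule pos) (simp add: axis_eq_0_iff)

lemma det_eq: "det (bilin_matrix g) = E * G - F * F"
  by (simp add: det_bilin_matrix sym21)

lemma det_pos: "det (bilin_matrix g) > 0"
proof -
  \<comment> \<open>Orthogonal to the first basis vector, so that its square is a positive multiple
    of the determinant.\<close>
  define v :: "real^2" where "v = F *\<^sub>R axis 1 1 - E *\<^sub>R axis 2 1"
  have "v $ 2 \<noteq> 0" using E_pos by (simp add: v_def axis_nth_if)
  then have "g v v > 0" by (intro pos) auto
  moreover have "g v v = E * det (bilin_matrix g)"
    unfolding v_def det_eq by (simp add: g_simps sym21 algebra_simps)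
  ultimately show ?thesis using E_pos by (simp add: zero_less_mult_iff)
qed

lemma W_pos: "W > 0" and W_sq: "W * W = det (bilin_matrix g)"
  using det_pos by (simp_all add: W_def)

lemma rot2_eq: "rot2 g \<xi> = (1 / W) *\<^sub>R (g (axis 1 1) \<xi> *\<^sub>R axis 2 1 - g (axis 2 1) \<xi> *\<^sub>R axis 1 1)"
  using det_pos by (simp add: rot2_def W_def powr_minus_divide powr_half_sqrt)

lemma linear_rot2: "linear (rot2 g)"
  by (rule linearI) (simp_all add: rot2_def g_simps algebra_simps)

lemma g_rot2: "g (rot2 g \<xi>) \<eta> = W * area2 \<xi> \<eta>"
proof -
  have "W * g (rot2 g \<xi>) \<eta> = g (axis 1 1) \<xi> * g (axis 2 1) \<eta> - g (axis 2 1) \<xi> * g (axis 1 1) \<eta>"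
    using W_pos by (simp add: rot2_eq g_simps)
  also have "\<dots> = det (bilin_matrix g) * area2 \<xi> \<eta>"
    unfolding g_expand[of "axis 1 1" \<xi>] g_expand[of "axis 2 1" \<xi>] g_expand[of "axis 1 1" \<eta>]
      g_expand[of "axis 2 1" \<eta>] det_eq area2_def
    by (simp add: axis_nth_if algebra_simps)
  finally have "W * g (rot2 g \<xi>) \<eta> = W * (W * area2 \<xi> \<eta>)"
    unfolding W_sq[symmetric] by (simp add: mult.assoc)
  then show ?thesis using W_pos by simp
qed

lemma g_rot2_self: "g \<xi> (rot2 g \<xi>) = 0"
  using g_rot2[of \<xi> \<xi>] by (simp add: sym area2_simps(2))

lemma area2_rot2: "W * area2 \<xi> (rot2 g \<xi>) = g \<xi> \<xi>"
proof -
  have "W * (W * area2 \<xi> (rot2 g \<xi>)) = W * g \<xi> \<xi>"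
    using W_pos unfolding rot2_eq g_expand[of \<xi>] g_expand[of _ \<xi>] area2_def
    by (simp add: axis_nth_if field_simps)
  then show ?thesis using W_pos by simp
qed

lemma g_rot2_rot2: "g (rot2 g \<xi>) (rot2 g \<xi>) = g \<xi> \<xi>"
  using g_rot2 area2_rot2 by simp

text \<open>Length and orthogonality fix the area spanned with \<open>\<xi>\<close> up to sign, and
  the orientation fixes the sign; then \<open>v - rot2 g \<xi>\<close> has length 0. Being about a
  single vector, this serves both the definite description of the rotation and changes of
  chart.\<close>

lemma rot2_unique:
  assumes "g v v = g \<xi> \<xi>" "g \<xi> v = 0" "\<xi> \<noteq> 0 \<Longrightarrow> area2 \<xi> v > 0"
  shows "v = rot2 g \<xi>"
proof -
  have "(W * area2 \<xi> v)\<^sup>2 = (g \<xi> \<xi>)\<^sup>2"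
    using gram[of \<xi> v] assms(1,2) by (simp add: power_mult_distrib W_sq[symmetric] power2_eq_square)
  moreover have "W * area2 \<xi> v \<ge> 0" "g \<xi> \<xi> \<ge> 0"
    using assms(3) W_pos pos[of \<xi>] by (cases "\<xi> = 0"; simp add: area2_def g_simps)+
  ultimately have "W * area2 \<xi> v = g \<xi> \<xi>" by (meson power2_eq_imp_eq)
  then have "g (v - rot2 g \<xi>) (v - rot2 g \<xi>) = 0"
    using g_rot2[of \<xi> v] g_rot2_rot2[of \<xi>] assms(1) by (simp add: g_simps sym[of v "rot2 g \<xi>"])
  then show ?thesis using pos[of "v - rot2 g \<xi>"] by auto
qed

lemma the_rot:
  "(THE J. linear J \<and> (\<forall>\<xi>. g (J \<xi>) (J \<xi>) = g \<xi> \<xi> \<and> g \<xi> (J \<xi>) = 0 \<and> (\<xi> \<noteq> 0 \<longrightarrow> area2 \<xi> (J \<xi>) > 0))) = rot2 g"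
proof (rule the_equality)
  have "area2 \<xi> (rot2 g \<xi>) > 0" if "\<xi> \<noteq> 0" for \<xi>
    using area2_rot2[of \<xi>] pos[OF that] W_pos by (metis zero_less_mult_pos)
  then show "linear (rot2 g) \<and> (\<forall>\<xi>. g (rot2 g \<xi>) (rot2 g \<xi>) = g \<xi> \<xi> \<and> g \<xi> (rot2 g \<xi>) = 0 \<and>
      (\<xi> \<noteq> 0 \<longrightarrow> area2 \<xi> (rot2 g \<xi>) > 0))"
    using linear_rot2 g_rot2_rot2 g_rot2_self by blast
qed (use rot2_unique in blast)

text \<open>Removes the inverse matrix from the mean curvature; only the polynomial expression on
  the right enters the later computation.\<close>

lemma mean_curvature_trace:
  "trace (matrix_inv (bilin_matrix g) ** bilin_matrix h) * (W * W) =
    G * h (axis 1 1) (axis 1 1) - F * h (axis 2 1) (axis 1 1) - F * h (axis 1 1) (axis 2 1) +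
    E * h (axis 2 1) (axis 2 1)"
proof -
  define D where "D = E * G - F * F"
  have D: "D > 0" "det (bilin_matrix g) = D" using det_pos by (simp_all add: D_def det_eq)
  have EG: "E * G = D + F * F" by (simp add: D_def)
  \<comment> \<open>Cramer's formula; \<open>matrix_inv\<close> is a choice, so it is identified
    through both products.\<close>
  define B :: "real^2^2" where
    "B = (\<chi> i j. if i = 1 then if j = 1 then G / D else - F / D else if j = 1 then - F / D else E / D)"
  have "B ** bilin_matrix g = mat 1" "bilin_matrix g ** B = mat 1"
    using D(1) EG
    by (simp_all add: vec_eq_iff forall_2 matrix_matrix_mult_def sum_2 B_def bilin_matrix_def mat_def
        sym21 field_simps)
  then have "matrix_inv (bilin_matrix g) = B"
    unfolding matrix_inv_def
    by (intro some_equality) (simp_all, metis matrix_mul_assoc matrix_mul_lid matrix_mul_rid)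
  then show ?thesis
    using D by (simp add: W_sq trace_def sum_2 matrix_matrix_mult_def B_def bilin_matrix_def field_simps)
qed

end

section \<open>Immersions of plane domains\<close>

lemma frechet_derivative_cong_open:
  assumes "open U" "u \<in> U" "\<And>x. x \<in> U \<Longrightarrow> a x = b x" "smooth_on U a"
  shows "frechet_derivative b (at u) = frechet_derivative a (at u)"
  by (rule frechet_derivative_at[symmetric],
      rule has_derivative_transform_within_open[OF smooth_on_has_derivative[OF assms(4,2)] assms(1,2,3)])

text \<open>One chart at a time: \<open>f\<close> and \<open>n\<close> stand for the immersion and
  its normal as functions of the coordinates.\<close>

locale local_immersion = space_form_signature +
  fixes U :: "(real^2) set" and f n :: "real^2 \<Rightarrow> real^4"
  assumes U: "open U" and f: "smooth_on U f" and n: "smooth_on U n"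
    and f_in: "u \<in> U \<Longrightarrow> f u \<in> space_form p q K"
    and inj: "u \<in> U \<Longrightarrow> inj (frechet_derivative f (at u))"
    and n_unit: "u \<in> U \<Longrightarrow> \<langle>n u, n u\<rangle> = 1"
    and n_tangent: "u \<in> U \<Longrightarrow> \<langle>f u, n u\<rangle> = 0"
    and n_normal: "u \<in> U \<Longrightarrow> \<langle>n u, frechet_derivative f (at u) \<xi>\<rangle> = 0"
begin

abbreviation D :: "(real^2 \<Rightarrow> 'b::real_normed_vector) \<Rightarrow> real^2 \<Rightarrow> real^2 \<Rightarrow> 'b"
  where "D a u \<equiv> frechet_derivative a (at u)"

abbreviation (input) "e\<^sub>1 \<equiv> axis 1 1 :: real^2"
abbreviation (input) "e\<^sub>2 \<equiv> axis 2 1 :: real^2"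

text \<open>In coordinates, \<open>g\<close> and \<open>h\<close> are the first and second
  fundamental forms, \<open>S\<close> is \<open>*dx0\<close> and \<open>w\<close> the area density.
  \<open>S\<close> uses the explicit \<open>rot2\<close>, so that its smoothness can be read
  off.\<close>

definition "g u \<xi> \<eta> = \<langle>D f u \<xi>, D f u \<eta>\<rangle>"
definition "S u \<xi> = D f u (rot2 (g u) \<xi>)"
definition "w u = sqrt (det (bilin_matrix (g u)))"
definition "h u \<xi> \<eta> = \<langle>D (\<lambda>u. D f u \<eta>) u \<xi>, n u\<rangle>"

lemma linear_D: "smooth_on U a \<Longrightarrow> u \<in> U \<Longrightarrow> linear (D a u)"
  using has_derivative_linear smooth_on_has_derivative by blast

lemma D_form:
  assumes "smooth_on U a" "smooth_on U b" "u \<in> U"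
  shows "D (\<lambda>u. \<langle>a u, b u\<rangle>) u \<xi> = \<langle>a u, D b u \<xi>\<rangle> + \<langle>D a u \<xi>, b u\<rangle>"
  using fun_cong[OF frechet_derivative_at[OF bounded_bilinear.FDERIV[OF bounded_bilinear_pq_form[of p q]
    smooth_on_has_derivative[OF assms(1,3)] smooth_on_has_derivative[OF assms(2,3)]]], where x=\<xi>] by simp

text \<open>The source of all structure equations: a known inner product is differentiated, the
  relation holding on the open set \<open>U\<close> only.\<close>

lemma D_form_eq:
  assumes "smooth_on U a" "smooth_on U b" "u \<in> U" "\<And>u. u \<in> U \<Longrightarrow> \<langle>a u, b u\<rangle> = c u"
  shows "\<langle>a u, D b u \<xi>\<rangle> + \<langle>D a u \<xi>, b u\<rangle> = D c u \<xi>"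
  using D_form[OF assms(1-3), of \<xi>]
    frechet_derivative_cong_open[OF U assms(3,4) smooth_on_form[OF U assms(1,2)]] by simp

lemma D_form_const:
  assumes "smooth_on U a" "smooth_on U b" "u \<in> U" "\<And>u. u \<in> U \<Longrightarrow> \<langle>a u, b u\<rangle> = c"
  shows "\<langle>a u, D b u \<xi>\<rangle> + \<langle>D a u \<xi>, b u\<rangle> = 0"
  using D_form_eq[OF assms(1-3), of "\<lambda>_. c" \<xi>] assms(4) by simp

section \<open>Structure equations of an immersion\<close>

lemma Df_smooth: "smooth_on U (\<lambda>u. D f u \<xi>)"
  by (rule smooth_on_frechet_derivative[OF f])

lemma g_smooth: "smooth_on U (\<lambda>u. g u \<xi> \<eta>)"
  unfolding g_def by (rule smooth_on_form[OF U Df_smooth Df_smooth])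

lemma f_Df: "u \<in> U \<Longrightarrow> \<langle>f u, D f u \<xi>\<rangle> = 0"
  using D_form_const[OF f f, of u "1 / K" \<xi>] f_in pq_form_commute[of p q "f u"]
  by (simp add: space_form_def)

lemma metric2_g:
  assumes u: "u \<in> U"
  shows "metric2 (g u)"
proof
  note lin = linear_D[OF f u]
  show "bilinear (g u)"
    unfolding bilinear_def g_def
    by (auto intro!: linearI simp: linear_add[OF lin] linear_scale[OF lin] pq_form_simps)
  show "g u \<xi> \<eta> = g u \<eta> \<xi>" for \<xi> \<eta> by (simp add: g_def pq_form_commute)
  show "g u \<xi> \<xi> > 0" if "\<xi> \<noteq> 0" for \<xi>
  proof -
    have "D f u \<xi> \<noteq> 0" using inj[OF u] that linear_injective_0[OF lin] by blast
    then show ?thesis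
      unfolding g_def using form_tangent_pos[OF f_in[OF u]] f_Df[OF u] by (simp add: tangent_def)
  qed
qed

lemma w_eq: "u \<in> U \<Longrightarrow> w u = metric2.W (g u)"
  by (simp add: w_def metric2.W_def[OF metric2_g])

lemma det_smooth: "smooth_on U (\<lambda>u. det (bilin_matrix (g u)))"
  unfolding det_bilin_matrix by (intro smooth_on_minus smooth_on_mult U g_smooth)

lemma det_powr_smooth: "smooth_on U (\<lambda>u. det (bilin_matrix (g u)) powr s)"
  using smooth_on_compose[OF smooth_on_powr[of 1 s] U _ _ det_smooth] metric2.det_pos[OF metric2_g]
  by (simp add: image_subset_iff)

lemma w_smooth: "smooth_on U w"
  by (rule smooth_on_cong[OF U _ det_powr_smooth[of "1 / 2"]])
    (use metric2.det_pos[OF metric2_g] in \<open>simp add: w_def powr_half_sqrt less_imp_le\<close>)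

lemma S_eq:
  "u \<in> U \<Longrightarrow> S u \<xi> = (1 / w u) *\<^sub>R (g u e\<^sub>1 \<xi> *\<^sub>R D f u e\<^sub>2 - g u e\<^sub>2 \<xi> *\<^sub>R D f u e\<^sub>1)"
  by (simp add: S_def metric2.rot2_eq[OF metric2_g] w_eq linear_scale[OF linear_D[OF f]]
      linear_diff[OF linear_D[OF f]])

lemma S_smooth: "smooth_on U (\<lambda>u. S u \<xi>)"
proof -
  have "smooth_on U (\<lambda>u. det (bilin_matrix (g u)) powr (- 1 / 2) *\<^sub>R
      (g u e\<^sub>1 \<xi> *\<^sub>R D f u e\<^sub>2 - g u e\<^sub>2 \<xi> *\<^sub>R D f u e\<^sub>1))"
    by (intro smooth_on_scaleR smooth_on_minus U g_smooth Df_smooth det_powr_smooth)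
  then show ?thesis
    by (rule smooth_on_cong[OF U, rotated])
      (simp add: S_def rot2_def linear_scale[OF linear_D[OF f]] linear_diff[OF linear_D[OF f]])
qed

lemma linear_S: "u \<in> U \<Longrightarrow> linear (S u)"
  unfolding S_def
  using linear_compose[OF metric2.linear_rot2[OF metric2_g] linear_D[OF f]] by (simp add: o_def)

lemma Df_S: "u \<in> U \<Longrightarrow> \<langle>D f u \<eta>, S u \<xi>\<rangle> = w u * area2 \<xi> \<eta>"
  using metric2.g_rot2[OF metric2_g, of u \<xi> \<eta>]
  by (simp add: S_def w_eq g_def pq_form_commute)

lemma f_S: "u \<in> U \<Longrightarrow> \<langle>f u, S u \<xi>\<rangle> = 0"
  by (simp add: S_def f_Df)

lemma n_S: "u \<in> U \<Longrightarrow> \<langle>n u, S u \<xi>\<rangle> = 0"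
  by (simp add: S_def n_normal)

lemma S_S: "u \<in> U \<Longrightarrow> \<langle>S u \<xi>, S u \<xi>\<rangle> = g u \<xi> \<xi>"
  using metric2.g_rot2_rot2[OF metric2_g, of u \<xi>] by (simp add: S_def g_def)

lemma frame_expand:
  assumes u: "u \<in> U" and "\<xi> \<noteq> 0"
  shows "y = (K * \<langle>f u, y\<rangle>) *\<^sub>R f u + \<langle>n u, y\<rangle> *\<^sub>R n u + (\<langle>D f u \<xi>, y\<rangle> / g u \<xi> \<xi>) *\<^sub>R D f u \<xi> +
    (\<langle>S u \<xi>, y\<rangle> / g u \<xi> \<xi>) *\<^sub>R S u \<xi>"
proof -
  have "\<langle>f u, f u\<rangle> = 1 / K" using f_in[OF u] by (simp add: space_form_def)
  moreover have "\<langle>D f u \<xi>, S u \<xi>\<rangle> = 0" using Df_S[OF u] by (simp add: area2_simps(2))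
  moreover have "g u \<xi> \<xi> > 0" using metric2.pos[OF metric2_g[OF u] assms(2)] .
  ultimately show ?thesis
    using orthogonal_frame_expand[of "f u" "n u" "D f u \<xi>" "S u \<xi>" y] K u
      n_tangent n_unit n_normal f_Df f_S n_S S_S g_def[symmetric]
    by (simp add: mult.commute[of K])
qed

lemma symmetric_D2: "u \<in> U \<Longrightarrow> D (\<lambda>u. D f u \<eta>) u \<xi> = D (\<lambda>u. D f u \<xi>) u \<eta>"
  by (rule symmetric_second_derivative[OF U _ f])

lemma h_sym: "u \<in> U \<Longrightarrow> h u \<xi> \<eta> = h u \<eta> \<xi>"
  unfolding h_def by (simp add: symmetric_D2)

lemma Dn_Df: "u \<in> U \<Longrightarrow> \<langle>D n u \<xi>, D f u \<eta>\<rangle> = - h u \<xi> \<eta>"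
  using D_form_const[OF n Df_smooth, of u \<eta> 0 \<xi>] n_normal
  by (simp add: h_def pq_form_commute[of p q "n u"])

lemma Dn_f: "u \<in> U \<Longrightarrow> \<langle>D n u \<xi>, f u\<rangle> = 0"
  using D_form_const[OF f n, of u 0 \<xi>] n_tangent n_normal
  by (simp add: pq_form_commute)

lemma Dn_n: "u \<in> U \<Longrightarrow> \<langle>D n u \<xi>, n u\<rangle> = 0"
  using D_form_const[OF n n, of u 1 \<xi>] n_unit by (simp add: pq_form_commute)

text \<open>The Laplacian of the immersion, \<open>d * dx\<^sub>0 = 2 (K x\<^sub>0 - H N) vol\<close>, is obtained by pairing
  \<open>d * dx\<^sub>0\<close> with \<open>x\<^sub>0\<close>, \<open>N\<close> and the coordinate vector fields.\<close>

lemma ext_deriv_S: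
  assumes u: "u \<in> U"
    and H: "g u e\<^sub>2 e\<^sub>2 * h u e\<^sub>1 e\<^sub>1 - g u e\<^sub>1 e\<^sub>2 * h u e\<^sub>2 e\<^sub>1 - g u e\<^sub>1 e\<^sub>2 * h u e\<^sub>1 e\<^sub>2 + g u e\<^sub>1 e\<^sub>1 * h u e\<^sub>2 e\<^sub>2 =
      2 * H * (w u * w u)"
  shows "D (\<lambda>u. S u e\<^sub>2) u e\<^sub>1 - D (\<lambda>u. S u e\<^sub>1) u e\<^sub>2 = (2 * w u) *\<^sub>R (K *\<^sub>R f u - H *\<^sub>R n u)"
proof -
  interpret metric2 "g u" by (rule metric2_g[OF u])
  define Z where "Z = D (\<lambda>u. S u e\<^sub>2) u e\<^sub>1 - D (\<lambda>u. S u e\<^sub>1) u e\<^sub>2"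
  define X\<^sub>1 X\<^sub>2 where X: "X\<^sub>1 = D f u e\<^sub>1" "X\<^sub>2 = D f u e\<^sub>2"
  define X\<^sub>1\<^sub>1 X\<^sub>1\<^sub>2 X\<^sub>2\<^sub>2 where XX: "X\<^sub>1\<^sub>1 = D (\<lambda>u. D f u e\<^sub>1) u e\<^sub>1" "X\<^sub>1\<^sub>2 = D (\<lambda>u. D f u e\<^sub>2) u e\<^sub>1"
    "X\<^sub>2\<^sub>2 = D (\<lambda>u. D f u e\<^sub>2) u e\<^sub>2"
  have X\<^sub>2\<^sub>1: "D (\<lambda>u. D f u e\<^sub>1) u e\<^sub>2 = X\<^sub>1\<^sub>2" unfolding XX by (rule symmetric_D2[OF u])
  have w: "w u > 0" using W_pos w_eq[OF u] by simp
  have WS: "w u *\<^sub>R S u e\<^sub>1 = E *\<^sub>R X\<^sub>2 - F *\<^sub>R X\<^sub>1" "w u *\<^sub>R S u e\<^sub>2 = F *\<^sub>R X\<^sub>2 - G *\<^sub>R X\<^sub>1"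
    using w by (simp_all add: S_eq[OF u] X sym21)
  \<comment> \<open>Differentiating the orthogonality of \<open>f\<close> and \<open>S\<close> moves
    the derivative to \<open>f\<close>, where \<open>Df_S\<close> gives the area density
    twice.\<close>
  have fZ: "\<langle>f u, Z\<rangle> = 2 * w u"
    using D_form_const[OF f S_smooth u f_S, of e\<^sub>2 e\<^sub>1] D_form_const[OF f S_smooth u f_S, of e\<^sub>1 e\<^sub>2]
    by (simp add: Z_def pq_form_simps Df_S[OF u] area2_def axis_nth_if)
  \<comment> \<open>The same with \<open>n\<close> brings in the second fundamental form; multiplied
    by \<open>w u\<close> it becomes the left side of the premise \<open>H\<close>.\<close>
  have nZ: "\<langle>n u, Z\<rangle> = - 2 * H * w u"
  proof -
    have "w u * \<langle>n u, Z\<rangle> = \<langle>D n u e\<^sub>2, w u *\<^sub>R S u e\<^sub>1\<rangle> - \<langle>D n u e\<^sub>1, w u *\<^sub>R S u e\<^sub>2\<rangle>"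
      using D_form_const[OF n S_smooth u n_S, of e\<^sub>2 e\<^sub>1] D_form_const[OF n S_smooth u n_S, of e\<^sub>1 e\<^sub>2]
      by (simp add: Z_def pq_form_simps eq_neg_iff_add_eq_0 flip: right_diff_distrib)
    also have "\<dots> = - 2 * H * (w u * w u)"
      using H unfolding WS by (simp add: pq_form_simps X Dn_Df[OF u])
    finally have "w u * (\<langle>n u, Z\<rangle>) = w u * (- 2 * H * w u)" by simp
    then show ?thesis by (rule mult_left_cancel[THEN iffD1, rotated]) (use w in simp)
  qed
  have W2: "w v * w v = g v e\<^sub>1 e\<^sub>1 * g v e\<^sub>2 e\<^sub>2 - g v e\<^sub>1 e\<^sub>2 * g v e\<^sub>1 e\<^sub>2" if "v \<in> U" for v
    using metric2.W_sq[OF metric2_g[OF that]] metric2.det_eq[OF metric2_g[OF that]] w_eq[OF that] by simp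
  \<comment> \<open>The square of the area density is differentiated, so that no square root is
    involved.\<close>
  have dW: "w u * D w u \<xi> =
      \<langle>D (\<lambda>u. D f u e\<^sub>1) u \<xi>, X\<^sub>1\<rangle> * G + E * \<langle>D (\<lambda>u. D f u e\<^sub>2) u \<xi>, X\<^sub>2\<rangle> -
      F * (\<langle>X\<^sub>1, D (\<lambda>u. D f u e\<^sub>2) u \<xi>\<rangle> + \<langle>D (\<lambda>u. D f u e\<^sub>1) u \<xi>, X\<^sub>2\<rangle>)" for \<xi>
  proof -
    note d = smooth_on_has_derivative[OF g_smooth u]
    have "((\<lambda>v. w v * w v) has_derivative
        (\<lambda>\<xi>. w u * D w u \<xi> + D w u \<xi> * w u)) (at u)"
      by (intro has_derivative_mult smooth_on_has_derivative[OF w_smooth u])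
    moreover have "((\<lambda>v. w v * w v) has_derivative (\<lambda>\<xi>.
        (E * D (\<lambda>v. g v e\<^sub>2 e\<^sub>2) u \<xi> + D (\<lambda>v. g v e\<^sub>1 e\<^sub>1) u \<xi> * G) -
        (F * D (\<lambda>v. g v e\<^sub>1 e\<^sub>2) u \<xi> + D (\<lambda>v. g v e\<^sub>1 e\<^sub>2) u \<xi> * F))) (at u)"
      by (rule has_derivative_transform_within_open[OF _ U u W2[symmetric]])
        (intro has_derivative_diff has_derivative_mult d)
    ultimately have "w u * D w u \<xi> + D w u \<xi> * w u =
        (E * D (\<lambda>v. g v e\<^sub>2 e\<^sub>2) u \<xi> + D (\<lambda>v. g v e\<^sub>1 e\<^sub>1) u \<xi> * G) -
        (F * D (\<lambda>v. g v e\<^sub>1 e\<^sub>2) u \<xi> + D (\<lambda>v. g v e\<^sub>1 e\<^sub>2) u \<xi> * F)"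
      by (rule fun_cong[OF has_derivative_unique])
    moreover have "D (\<lambda>v. g v \<alpha> \<beta>) u \<xi> =
        \<langle>D f u \<alpha>, D (\<lambda>u. D f u \<beta>) u \<xi>\<rangle> + \<langle>D (\<lambda>u. D f u \<alpha>) u \<xi>, D f u \<beta>\<rangle>" for \<alpha> \<beta>
      using D_form[OF Df_smooth Df_smooth u] by (simp add: g_def[abs_def])
    ultimately show ?thesis
      by (simp add: X pq_form_commute[of p q "D f u _"] algebra_simps)
  qed
  have DS: "\<langle>D f u \<eta>, D (\<lambda>u. S u \<xi>) u \<zeta>\<rangle> = D w u \<zeta> * area2 \<xi> \<eta> - \<langle>D (\<lambda>u. D f u \<eta>) u \<zeta>, S u \<xi>\<rangle>" for \<xi> \<eta> \<zeta>
  proof -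
    have "((\<lambda>u. w u * area2 \<xi> \<eta>) has_derivative (\<lambda>\<zeta>. D w u \<zeta> * area2 \<xi> \<eta>)) (at u)"
      by (rule has_derivative_mult_left[OF smooth_on_has_derivative[OF w_smooth u]])
    from fun_cong[OF frechet_derivative_at[OF this], where x=\<zeta>]
    have "D (\<lambda>u. w u * area2 \<xi> \<eta>) u \<zeta> = D w u \<zeta> * area2 \<xi> \<eta>" by simp
    then show ?thesis
      using D_form_eq[OF Df_smooth S_smooth u Df_S]
      by (simp add: eq_diff_eq)
  qed
  \<comment> \<open>The derivative of the area density cancels against the second derivatives of
    \<open>f\<close>; this needs the symmetry of the latter.\<close>
  have XZ: "\<langle>X\<^sub>1, Z\<rangle> = 0" "\<langle>X\<^sub>2, Z\<rangle> = 0"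
  proof -
    have "w u * \<langle>X\<^sub>1, Z\<rangle> = - (w u * D w u e\<^sub>1) - \<langle>X\<^sub>1\<^sub>1, w u *\<^sub>R S u e\<^sub>2\<rangle> + \<langle>X\<^sub>1\<^sub>2, w u *\<^sub>R S u e\<^sub>1\<rangle>"
      unfolding Z_def X pq_form_simps DS X\<^sub>2\<^sub>1 XX(1)[symmetric] area2_def
      by (simp add: axis_nth_if algebra_simps)
    also have "\<dots> = 0"
      unfolding dW WS XX(1,2)[symmetric] pq_form_simps by (simp add: pq_form_commute algebra_simps)
    finally show "\<langle>X\<^sub>1, Z\<rangle> = 0" using w by simp
    have "w u * \<langle>X\<^sub>2, Z\<rangle> = - (w u * D w u e\<^sub>2) - \<langle>X\<^sub>1\<^sub>2, w u *\<^sub>R S u e\<^sub>2\<rangle> + \<langle>X\<^sub>2\<^sub>2, w u *\<^sub>R S u e\<^sub>1\<rangle>"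
      unfolding Z_def X pq_form_simps DS XX(2,3)[symmetric] area2_def
      by (simp add: axis_nth_if algebra_simps)
    also have "\<dots> = 0"
      unfolding dW WS X\<^sub>2\<^sub>1 XX(3)[symmetric] pq_form_simps by (simp add: pq_form_commute algebra_simps)
    finally show "\<langle>X\<^sub>2, Z\<rangle> = 0" using w by simp
  qed
  \<comment> \<open>The difference of the two sides is orthogonal to a full frame.\<close>
  define Z' where "Z' = Z - (2 * w u) *\<^sub>R (K *\<^sub>R f u - H *\<^sub>R n u)"
  have sym': "\<langle>n u, f u\<rangle> = 0" "\<langle>X\<^sub>1, f u\<rangle> = 0" "\<langle>X\<^sub>1, n u\<rangle> = 0" "\<langle>X\<^sub>2, f u\<rangle> = 0" "\<langle>X\<^sub>2, n u\<rangle> = 0"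
    using n_tangent[OF u] n_normal[OF u] f_Df[OF u] by (simp_all add: pq_form_commute X)
  have "\<langle>f u, Z'\<rangle> = 0" "\<langle>n u, Z'\<rangle> = 0" "\<langle>X\<^sub>1, Z'\<rangle> = 0" "\<langle>X\<^sub>2, Z'\<rangle> = 0"
    using fZ nZ XZ sym' n_tangent[OF u] n_unit[OF u] f_in[OF u] K
    by (simp_all add: Z'_def pq_form_simps space_form_def)
  moreover have "\<langle>S u e\<^sub>1, Z'\<rangle> = 0"
    using calculation(3,4) by (simp add: S_eq[OF u] X[symmetric] pq_form_simps)
  ultimately have "Z' = 0"
    using frame_expand[OF u, of e\<^sub>1 Z'] by (simp add: X[symmetric] axis_eq_0_iff)
  then show ?thesis by (simp add: Z'_def Z_def)
qed

text \<open>These are the terms of the exterior derivative of the moment form in which the first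
  factor is differentiated. In the orthogonal basis \<open>X\<^sub>1\<close>,
  \<open>S\<^sub>1\<close> of the tangent plane both sides of each equation become multiples of one
  bivector; for \<open>n\<close> the multiples agree because the shape operator is
  symmetric.\<close>

lemma wedge_S:
  assumes u: "u \<in> U"
  shows "wedge (D f u e\<^sub>1) (S u e\<^sub>2) = wedge (D f u e\<^sub>2) (S u e\<^sub>1)"
    and "wedge (D n u e\<^sub>1) (S u e\<^sub>2) = wedge (D n u e\<^sub>2) (S u e\<^sub>1)"
proof -
  interpret metric2 "g u" by (rule metric2_g[OF u])
  interpret wedge: bounded_bilinear wedge by (rule bounded_bilinear_wedge)
  note wedge_simps = wedge.add_left wedge.add_right wedge.diff_left wedge.diff_right
    wedge.scaleR_left wedge.scaleR_right wedge_self
  define X\<^sub>1 X\<^sub>2 S\<^sub>1 where X: "X\<^sub>1 = D f u e\<^sub>1" "X\<^sub>2 = D f u e\<^sub>2" "S\<^sub>1 = S u e\<^sub>1"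
  have w: "w u > 0" "w u * w u = E * G - F * F"
    using W_pos W_sq det_eq w_eq[OF u] by simp_all
  have WS: "w u *\<^sub>R S\<^sub>1 = E *\<^sub>R X\<^sub>2 - F *\<^sub>R X\<^sub>1" "w u *\<^sub>R S u e\<^sub>2 = F *\<^sub>R X\<^sub>2 - G *\<^sub>R X\<^sub>1"
    using w(1) by (simp_all add: S_eq[OF u] X sym21)
  have EX: "E *\<^sub>R X\<^sub>2 = F *\<^sub>R X\<^sub>1 + w u *\<^sub>R S\<^sub>1" using WS(1) by simp
  \<comment> \<open>This is \<open>EX\<close> rotated by a right angle: the rotation sends
    \<open>X\<^sub>1\<close> to \<open>S\<^sub>1\<close> and \<open>S\<^sub>1\<close> to
    \<open>- X\<^sub>1\<close>.\<close>
  have "w u *\<^sub>R (E *\<^sub>R S u e\<^sub>2) = w u *\<^sub>R (F *\<^sub>R S\<^sub>1 - w u *\<^sub>R X\<^sub>1)"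
  proof -
    have "w u *\<^sub>R (E *\<^sub>R S u e\<^sub>2) = E *\<^sub>R (w u *\<^sub>R S u e\<^sub>2)" by (simp add: mult.commute)
    also have "\<dots> = F *\<^sub>R (E *\<^sub>R X\<^sub>2) - (E * G) *\<^sub>R X\<^sub>1" unfolding WS by (simp add: algebra_simps)
    also have "\<dots> = F *\<^sub>R (w u *\<^sub>R S\<^sub>1) - (w u * w u) *\<^sub>R X\<^sub>1"
      unfolding EX w(2) by (simp add: algebra_simps)
    finally show ?thesis by (simp add: algebra_simps)
  qed
  then have ES: "E *\<^sub>R S u e\<^sub>2 = F *\<^sub>R S\<^sub>1 - w u *\<^sub>R X\<^sub>1"
    by (rule scaleR_left_imp_eq[rotated]) (use w(1) in simp)
  have "E *\<^sub>R wedge X\<^sub>1 (S u e\<^sub>2) = wedge X\<^sub>1 (E *\<^sub>R S u e\<^sub>2)" by (simp add: wedge_simps)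
  also have "\<dots> = wedge (E *\<^sub>R X\<^sub>2) S\<^sub>1" unfolding ES EX by (simp add: wedge_simps)
  finally have "E *\<^sub>R wedge X\<^sub>1 (S u e\<^sub>2) = E *\<^sub>R wedge X\<^sub>2 S\<^sub>1" by (simp add: wedge_simps)
  then show "wedge (D f u e\<^sub>1) (S u e\<^sub>2) = wedge (D f u e\<^sub>2) (S u e\<^sub>1)"
    using E_pos by (simp add: X)
  have ex: "E *\<^sub>R D n u \<xi> = \<langle>X\<^sub>1, D n u \<xi>\<rangle> *\<^sub>R X\<^sub>1 + \<langle>S\<^sub>1, D n u \<xi>\<rangle> *\<^sub>R S\<^sub>1" for \<xi>
  proof -
    have "D n u \<xi> = (\<langle>X\<^sub>1, D n u \<xi>\<rangle> / E) *\<^sub>R X\<^sub>1 + (\<langle>S\<^sub>1, D n u \<xi>\<rangle> / E) *\<^sub>R S\<^sub>1"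
      using frame_expand[OF u, of e\<^sub>1 "D n u \<xi>"] Dn_f[OF u, of \<xi>] Dn_n[OF u, of \<xi>]
      by (simp add: X axis_eq_0_iff pq_form_commute[of p q "f u"] pq_form_commute[of p q "n u"])
    from arg_cong[OF this, of "\<lambda>y. E *\<^sub>R y"]
    have "E *\<^sub>R D n u \<xi> = E *\<^sub>R ((\<langle>X\<^sub>1, D n u \<xi>\<rangle> / E) *\<^sub>R X\<^sub>1 + (\<langle>S\<^sub>1, D n u \<xi>\<rangle> / E) *\<^sub>R S\<^sub>1)" .
    also have "\<dots> = \<langle>X\<^sub>1, D n u \<xi>\<rangle> *\<^sub>R X\<^sub>1 + \<langle>S\<^sub>1, D n u \<xi>\<rangle> *\<^sub>R S\<^sub>1"
      using E_pos by (simp add: scaleR_add_right)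
    finally show ?thesis .
  qed
  \<comment> \<open>Symmetry of the second fundamental form, with
    \<open>E *\<^sub>R X\<^sub>2\<close> replaced by its expansion \<open>EX\<close>.\<close>
  have c: "F * \<langle>X\<^sub>1, D n u e\<^sub>1\<rangle> + w u * \<langle>S\<^sub>1, D n u e\<^sub>1\<rangle> = E * \<langle>X\<^sub>1, D n u e\<^sub>2\<rangle>"
  proof -
    have "F * \<langle>X\<^sub>1, D n u e\<^sub>1\<rangle> + w u * \<langle>S\<^sub>1, D n u e\<^sub>1\<rangle> = \<langle>E *\<^sub>R X\<^sub>2, D n u e\<^sub>1\<rangle>"
      unfolding EX by (simp add: pq_form_simps)
    also have "\<dots> = E * \<langle>X\<^sub>1, D n u e\<^sub>2\<rangle>"
      using Dn_Df[OF u] h_sym[OF u, of e\<^sub>1 e\<^sub>2] by (simp add: pq_form_simps X pq_form_commute[of p q "D f u _"])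
    finally show ?thesis .
  qed
  have "(E * E) *\<^sub>R wedge (D n u e\<^sub>1) (S u e\<^sub>2) = wedge (E *\<^sub>R D n u e\<^sub>1) (E *\<^sub>R S u e\<^sub>2)"
    by (simp add: wedge_simps)
  also have "\<dots> = (F * \<langle>X\<^sub>1, D n u e\<^sub>1\<rangle> + w u * \<langle>S\<^sub>1, D n u e\<^sub>1\<rangle>) *\<^sub>R wedge X\<^sub>1 S\<^sub>1"
    unfolding ex ES by (simp add: wedge_simps wedge_commute[of S\<^sub>1 X\<^sub>1] algebra_simps)
  also have "\<dots> = E *\<^sub>R wedge (E *\<^sub>R D n u e\<^sub>2) S\<^sub>1"
    unfolding ex c by (simp add: wedge_simps)
  also have "\<dots> = (E * E) *\<^sub>R wedge (D n u e\<^sub>2) S\<^sub>1" by (simp add: wedge_simps)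
  finally show "wedge (D n u e\<^sub>1) (S u e\<^sub>2) = wedge (D n u e\<^sub>2) (S u e\<^sub>1)"
    using E_pos by (simp add: X)
qed

text \<open>By the product rule the derivative has two parts: one vanishes by
  \<open>wedge_S\<close>, and in the other \<open>*dx0\<close> contributes a multiple of the first
  factor, which wedges with itself to 0. Since \<open>H\<close> is constant, no derivative of it
  appears.\<close>

lemma moment_form_closed_local:
  assumes u: "u \<in> U"
    and H: "g u e\<^sub>2 e\<^sub>2 * h u e\<^sub>1 e\<^sub>1 - g u e\<^sub>1 e\<^sub>2 * h u e\<^sub>2 e\<^sub>1 - g u e\<^sub>1 e\<^sub>2 * h u e\<^sub>1 e\<^sub>2 + g u e\<^sub>1 e\<^sub>1 * h u e\<^sub>2 e\<^sub>2 =
      2 * H * (w u * w u)"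
  defines "\<omega> \<equiv> \<lambda>\<xi> u. wedge (K *\<^sub>R f u - H *\<^sub>R n u) (S u \<xi>)"
  shows "D (\<omega> \<eta>) u \<xi> - D (\<omega> \<xi>) u \<eta> = 0"
proof -
  interpret wedge: bounded_bilinear wedge by (rule bounded_bilinear_wedge)
  let ?P = "K *\<^sub>R f u - H *\<^sub>R n u"
  have d: "(\<omega> \<eta> has_derivative (\<lambda>\<xi>. wedge ?P (D (\<lambda>u. S u \<eta>) u \<xi>) +
      wedge (K *\<^sub>R D f u \<xi> - H *\<^sub>R D n u \<xi>) (S u \<eta>))) (at u)" for \<eta>
    unfolding \<omega>_def
    by (intro wedge.FDERIV has_derivative_diff has_derivative_scaleR_right smooth_on_has_derivative[OF _ u] f n S_smooth)
  have D\<omega>: "D (\<omega> \<eta>) u \<xi> = wedge ?P (D (\<lambda>u. S u \<eta>) u \<xi>) +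
      wedge (K *\<^sub>R D f u \<xi> - H *\<^sub>R D n u \<xi>) (S u \<eta>)" for \<eta> \<xi>
    using fun_cong[OF frechet_derivative_at[OF d], where x=\<xi>] by simp
  have d': "(\<omega> \<eta> has_derivative D (\<omega> \<eta>) u) (at u)" for \<eta>
    using d[of \<eta>] frechet_derivative_at[OF d[of \<eta>]] by simp
  have lin: "linear (D (\<omega> \<eta>) u)" for \<eta>
    using has_derivative_linear[OF d'] .
  \<comment> \<open>Linearity in the form argument, carried through the derivative; with it the
    2-form is determined by its value on the two coordinate directions.\<close>
  have \<omega>_expand: "D (\<omega> \<eta>) u \<xi> = \<eta> $ 1 *\<^sub>R D (\<omega> e\<^sub>1) u \<xi> + \<eta> $ 2 *\<^sub>R D (\<omega> e\<^sub>2) u \<xi>" for \<xi> \<eta>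
  proof -
    have "((\<lambda>u. \<eta> $ 1 *\<^sub>R \<omega> e\<^sub>1 u + \<eta> $ 2 *\<^sub>R \<omega> e\<^sub>2 u) has_derivative
        (\<lambda>\<xi>. \<eta> $ 1 *\<^sub>R D (\<omega> e\<^sub>1) u \<xi> + \<eta> $ 2 *\<^sub>R D (\<omega> e\<^sub>2) u \<xi>)) (at u)"
      by (intro has_derivative_add has_derivative_scaleR_right d')
    then have "(\<omega> \<eta> has_derivative (\<lambda>\<xi>. \<eta> $ 1 *\<^sub>R D (\<omega> e\<^sub>1) u \<xi> + \<eta> $ 2 *\<^sub>R D (\<omega> e\<^sub>2) u \<xi>)) (at u)"
    proof (rule has_derivative_transform_within_open[OF _ U u])
      fix v assume "v \<in> U"
      then show "\<eta> $ 1 *\<^sub>R \<omega> e\<^sub>1 v + \<eta> $ 2 *\<^sub>R \<omega> e\<^sub>2 v = \<omega> \<eta> v"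
        unfolding \<omega>_def by (subst (3) linear_expand2[OF linear_S]) (simp_all add: wedge.add_right wedge.scaleR_right)
    qed
    from fun_cong[OF frechet_derivative_at[OF this], where x=\<xi>] show ?thesis by simp
  qed
  have "D (\<omega> \<eta>) u \<xi> - D (\<omega> \<xi>) u \<eta> =
      (\<xi> $ 1 * \<eta> $ 2 - \<xi> $ 2 * \<eta> $ 1) *\<^sub>R (D (\<omega> e\<^sub>2) u e\<^sub>1 - D (\<omega> e\<^sub>1) u e\<^sub>2)"
    unfolding \<omega>_expand[of \<eta> \<xi>] \<omega>_expand[of \<xi> \<eta>]
    unfolding linear_expand2[OF lin, of _ \<xi>] linear_expand2[OF lin, of _ \<eta>]
    by (simp add: algebra_simps)
  moreover have "D (\<omega> e\<^sub>2) u e\<^sub>1 - D (\<omega> e\<^sub>1) u e\<^sub>2 = wedge ?P (D (\<lambda>u. S u e\<^sub>2) u e\<^sub>1 - D (\<lambda>u. S u e\<^sub>1) u e\<^sub>2)"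
    unfolding D\<omega> using wedge_S[OF u]
    by (simp add: wedge.diff_right wedge.diff_left wedge.scaleR_left)
  moreover have "\<dots> = 0"
    unfolding ext_deriv_S[OF u H] by (simp add: wedge.scaleR_right wedge_self)
  ultimately show ?thesis by simp
qed

end

section \<open>Immersed surfaces\<close>

lemma chart_inv_in: "u \<in> snd c ` fst c \<Longrightarrow> chart_inv c u \<in> fst c"
  and chart_chart_inv: "u \<in> snd c ` fst c \<Longrightarrow> snd c (chart_inv c u) = u"
  unfolding chart_inv_def by (auto intro: inv_into_into f_inv_into_f)

context
  fixes X :: "'a topology" and \<A> :: "'a chart set"
  assumes surface: "oriented_surface X \<A>"
begin

lemma fst_chart_topspace: "c \<in> \<A> \<Longrightarrow> fst c \<subseteq> topspace X"
  using surface unfolding oriented_surface_def by blast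

lemma open_chart: "c \<in> \<A> \<Longrightarrow> open (snd c ` fst c)"
  using surface unfolding oriented_surface_def by blast

lemma homeomorphic_chart:
  "c \<in> \<A> \<Longrightarrow> homeomorphic_map (subtopology X (fst c)) (top_of_set (snd c ` fst c)) (snd c)"
  using surface unfolding oriented_surface_def by blast

lemma topspace_chart: "c \<in> \<A> \<Longrightarrow> topspace (subtopology X (fst c)) = fst c"
  using fst_chart_topspace[of c] by auto

lemma chart_inv_chart: "c \<in> \<A> \<Longrightarrow> x \<in> fst c \<Longrightarrow> chart_inv c (snd c x) = x"
  unfolding chart_inv_def
  using homeomorphic_imp_injective_map[OF homeomorphic_chart] topspace_chart by (metis inv_into_f_f)

lemma open_chart_overlap:
  assumes "c \<in> \<A>" "c' \<in> \<A>"
  shows "open (snd c ` (fst c \<inter> fst c'))"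
proof -
  have "openin X (fst c')" using surface assms(2) unfolding oriented_surface_def by blast
  then have "openin (subtopology X (fst c)) (fst c \<inter> fst c')"
    by (auto simp: openin_subtopology)
  then have "openin (top_of_set (snd c ` fst c)) (snd c ` (fst c \<inter> fst c'))"
    using homeomorphic_map_openness[OF homeomorphic_chart[OF assms(1)], of "fst c \<inter> fst c'"]
      topspace_chart[OF assms(1)] by auto
  then show ?thesis using openin_open_trans open_chart[OF assms(1)] by blast
qed

lemma chart_diff_has_derivative:
  assumes "smooth_fun \<A> f" "c \<in> \<A>" "x \<in> fst c"
  shows "((f \<circ> chart_inv c) has_derivative chart_diff f c x) (at (snd c x))"
  unfolding chart_diff_def
  by (rule smooth_on_has_derivative[of "snd c ` fst c"]) (use assms in \<open>auto simp: smooth_fun_def\<close>)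

lemma transition_has_derivative:
  assumes "c \<in> \<A>" "c' \<in> \<A>" "x \<in> fst c \<inter> fst c'"
  shows "((snd c' \<circ> chart_inv c) has_derivative chart_diff (snd c') c x) (at (snd c x))"
  unfolding chart_diff_def
  by (rule smooth_on_has_derivative[of "snd c ` (fst c \<inter> fst c')"])
    (use surface assms in \<open>auto simp: oriented_surface_def\<close>)

lemma chart_diff_transition:
  assumes "smooth_fun \<A> f" "c \<in> \<A>" "c' \<in> \<A>" "x \<in> fst c \<inter> fst c'"
  shows "chart_diff f c x \<xi> = chart_diff f c' x (chart_diff (snd c') c x \<xi>)"
proof -
  have x: "(snd c' \<circ> chart_inv c) (snd c x) = snd c' x"
    using chart_inv_chart assms by simp
  have "((\<lambda>u. (f \<circ> chart_inv c') ((snd c' \<circ> chart_inv c) u)) has_derivative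
      (\<lambda>\<xi>. chart_diff f c' x (chart_diff (snd c') c x \<xi>))) (at (snd c x))"
  proof (rule has_derivative_compose[OF transition_has_derivative[OF assms(2-4)]])
    show "((f \<circ> chart_inv c') has_derivative chart_diff f c' x) (at ((snd c' \<circ> chart_inv c) (snd c x)))"
      unfolding x by (rule chart_diff_has_derivative[OF assms(1,3)]) (use assms(4) in simp)
  qed
  then have "((f \<circ> chart_inv c) has_derivative
      (\<lambda>\<xi>. chart_diff f c' x (chart_diff (snd c') c x \<xi>))) (at (snd c x))"
    by (rule has_derivative_transform_within_open[OF _ open_chart_overlap[OF assms(2,3)]])
      (use assms(4) chart_inv_chart[OF assms(2)] chart_inv_chart[OF assms(3)] in auto)
  from fun_cong[OF frechet_derivative_at[OF this], where x=\<xi>] show ?thesis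
    by (simp add: chart_diff_def)
qed

lemma area2_linear:
  assumes "linear L"
  shows "area2 (L \<xi>) (L \<eta>) = area2 (L (axis 1 1)) (L (axis 2 1)) * area2 \<xi> \<eta>"
  by (subst linear_expand2[OF assms, of \<xi>], subst linear_expand2[OF assms, of \<eta>])
    (simp add: area2_def algebra_simps)

lemma area2_transition:
  assumes "c \<in> \<A>" "c' \<in> \<A>" "x \<in> fst c \<inter> fst c'" "area2 \<xi> \<eta> > 0"
  shows "area2 (chart_diff (snd c') c x \<xi>) (chart_diff (snd c') c x \<eta>) > 0"
proof -
  have "area2 (chart_diff (snd c') c x (axis 1 1)) (chart_diff (snd c') c x (axis 2 1)) > 0"
    using surface assms unfolding oriented_surface_def by blast
  then show ?thesis
    using area2_linear[OF has_derivative_linear[OF transition_has_derivative[OF assms(1-3)]], of \<xi> \<eta>] assms(4)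
    by simp
qed

section \<open>Exact forms and de Rham classes\<close>

lemma smooth_fun_add:
  assumes "smooth_fun \<A> f" "smooth_fun \<A> g"
  shows "smooth_fun \<A> (\<lambda>x. f x + g x)"
  using assms open_chart smooth_on_add unfolding smooth_fun_def o_def by blast

lemma chart_diff_add:
  assumes "smooth_fun \<A> f" "smooth_fun \<A> g" "c \<in> \<A>" "x \<in> fst c"
  shows "chart_diff (\<lambda>x. f x + g x) c x \<xi> = chart_diff f c x \<xi> + chart_diff g c x \<xi>"
  using fun_cong[OF frechet_derivative_at[OF has_derivative_add[OF
    chart_diff_has_derivative[OF assms(1,3,4)] chart_diff_has_derivative[OF assms(2-4)]]], where x=\<xi>]
  by (simp add: chart_diff_def[of "\<lambda>x. f x + g x"] o_def)

lemma exact_form_add: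
  assumes "exact_form \<A> \<omega>" "exact_form \<A> \<omega>'"
  shows "exact_form \<A> (\<lambda>c x \<xi>. \<omega> c x \<xi> + \<omega>' c x \<xi>)"
proof -
  obtain f f' where f: "smooth_fun \<A> f" "\<And>c x \<xi>. c \<in> \<A> \<Longrightarrow> x \<in> fst c \<Longrightarrow> \<omega> c x \<xi> = chart_diff f c x \<xi>"
    and f': "smooth_fun \<A> f'" "\<And>c x \<xi>. c \<in> \<A> \<Longrightarrow> x \<in> fst c \<Longrightarrow> \<omega>' c x \<xi> = chart_diff f' c x \<xi>"
    using assms unfolding exact_form_def by metis
  show ?thesis
    unfolding exact_form_def
    by (intro exI[of _ "\<lambda>x. f x + f' x"] conjI smooth_fun_add f(1) f'(1) ballI allI)
      (simp add: chart_diff_add[OF f(1) f'(1)] f(2) f'(2))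
qed

lemma exact_form_bounded_linear:
  assumes "bounded_linear L" "exact_form \<A> \<omega>"
  shows "exact_form \<A> (\<lambda>c x \<xi>. L (\<omega> c x \<xi>))"
proof -
  obtain f where f: "smooth_fun \<A> f" "\<And>c x \<xi>. c \<in> \<A> \<Longrightarrow> x \<in> fst c \<Longrightarrow> \<omega> c x \<xi> = chart_diff f c x \<xi>"
    using assms unfolding exact_form_def by metis
  have "smooth_fun \<A> (\<lambda>x. L (f x))"
    using f(1) open_chart smooth_on_bounded_linear[OF assms(1)] unfolding smooth_fun_def o_def by blast
  moreover have "chart_diff (\<lambda>x. L (f x)) c x \<xi> = L (chart_diff f c x \<xi>)" if "c \<in> \<A>" "x \<in> fst c" for c x \<xi>
    using fun_cong[OF frechet_derivative_at[OF bounded_linear.has_derivative[OF assms(1)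
      chart_diff_has_derivative[OF f(1) that]]], where x=\<xi>]
    by (simp add: chart_diff_def[of "\<lambda>x. L (f x)"] o_def)
  ultimately show ?thesis unfolding exact_form_def using f(2) by (intro exI[of _ "\<lambda>x. L (f x)"]) simp
qed

text \<open>A class consists of the closed forms that differ from its representative by an exact
  one, so both inclusions come from adding exact forms.\<close>

lemma H1_class_eqI:
  fixes \<omega> \<omega>' :: "('a, real) form1"
  assumes "exact_form \<A> (\<lambda>c x \<xi>. \<omega> c x \<xi> - \<omega>' c x \<xi>)"
  shows "H1_class \<A> \<omega> = H1_class \<A> \<omega>'"
proof -
  have "exact_form \<A> (\<lambda>c x \<xi>. - (\<omega> c x \<xi> - \<omega>' c x \<xi>))"
    by (rule exact_form_bounded_linear[OF bounded_linear_minus[OF bounded_linear_ident] assms])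
  from exact_form_add[OF _ this] exact_form_add[OF _ assms] show ?thesis
    unfolding H1_class_def by fastforce
qed

end

section \<open>Surfaces of constant mean curvature in the space form\<close>

locale cmc_immersion = space_form_signature K p q for K p q +
  fixes vol :: "real^4 \<Rightarrow> real^4 \<Rightarrow> real^4 \<Rightarrow> real^4 \<Rightarrow> real"
    and X :: "'a topology" and \<A> :: "'a chart set" and x0 N :: "'a \<Rightarrow> real^4" and H :: real
  assumes vol: "volume_form p q K vol" and surface: "oriented_surface X \<A>"
    and immersion: "immersion_into p q K X \<A> x0" and normal: "unit_normal p q \<A> vol x0 N"
    and mean_curvature: "\<And>c x. c \<in> \<A> \<Longrightarrow> x \<in> fst c \<Longrightarrow> mean_curvature p q x0 N c x = H"
begin

lemma smooth_x0: "smooth_fun \<A> x0" and smooth_N: "smooth_fun \<A> N"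
  using immersion normal unfolding immersion_into_def unit_normal_def by blast+

lemma x0_in: "c \<in> \<A> \<Longrightarrow> x \<in> fst c \<Longrightarrow> x0 x \<in> space_form p q K"
  using immersion fst_chart_topspace[OF surface] unfolding immersion_into_def by blast

lemma normal_at:
  assumes "c \<in> \<A>" "x \<in> fst c"
  shows "\<langle>x0 x, N x\<rangle> = 0" "\<langle>N x, N x\<rangle> = 1" "\<langle>N x, chart_diff x0 c x \<xi>\<rangle> = 0"
    "vol (x0 x) (N x) (chart_diff x0 c x \<xi>) (chart_diff x0 c x \<eta>) = area_form p q x0 c x \<xi> \<eta>"
  using normal assms unfolding unit_normal_def tangent_def by auto

lemma local_immersion_chart:
  assumes c: "c \<in> \<A>"
  shows "local_immersion K p q (snd c ` fst c) (x0 \<circ> chart_inv c) (N \<circ> chart_inv c)"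
proof unfold_locales
  show "open (snd c ` fst c)" by (rule open_chart[OF surface c])
  show "smooth_on (snd c ` fst c) (x0 \<circ> chart_inv c)" "smooth_on (snd c ` fst c) (N \<circ> chart_inv c)"
    using smooth_x0 smooth_N c unfolding smooth_fun_def by blast+
  fix u \<xi> assume u: "u \<in> snd c ` fst c"
  note x = c chart_inv_in[OF u]
  have d: "frechet_derivative (x0 \<circ> chart_inv c) (at u) = chart_diff x0 c (chart_inv c u)"
    by (simp add: chart_diff_def chart_chart_inv[OF u])
  show "(x0 \<circ> chart_inv c) u \<in> space_form p q K" using x0_in[OF x] by simp
  show "inj (frechet_derivative (x0 \<circ> chart_inv c) (at u))"
    using immersion x unfolding d immersion_into_def by blast
  show "\<langle>(N \<circ> chart_inv c) u, (N \<circ> chart_inv c) u\<rangle> = 1"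
    "\<langle>(x0 \<circ> chart_inv c) u, (N \<circ> chart_inv c) u\<rangle> = 0"
    "\<langle>(N \<circ> chart_inv c) u, frechet_derivative (x0 \<circ> chart_inv c) (at u) \<xi>\<rangle> = 0"
    using normal_at[OF x] by (simp_all add: d)
qed

lemma induced_metric_local:
  assumes "c \<in> \<A>"
  shows "induced_metric p q x0 c x = local_immersion.g p q (x0 \<circ> chart_inv c) (snd c x)"
  by (intro ext) (simp add: induced_metric_def chart_diff_def
      local_immersion.g_def[OF local_immersion_chart[OF assms]])

lemma metric2_induced: "c \<in> \<A> \<Longrightarrow> x \<in> fst c \<Longrightarrow> metric2 (induced_metric p q x0 c x)"
  using local_immersion.metric2_g[OF local_immersion_chart, of c "snd c x"]
  by (simp add: induced_metric_local)

lemma rot_eq: "c \<in> \<A> \<Longrightarrow> x \<in> fst c \<Longrightarrow> rot p q x0 c x = rot2 (induced_metric p q x0 c x)"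
  unfolding rot_def by (rule metric2.the_rot[OF metric2_induced])

text \<open>Changes of chart are orientation-preserving isometries, and such maps commute with the
  rotation because it is unique. Hence the moment form is independent of the chart.\<close>

lemma rot_transition:
  assumes c: "c \<in> \<A>" "c' \<in> \<A>" "x \<in> fst c \<inter> fst c'"
  shows "rot p q x0 c' x (chart_diff (snd c') c x \<xi>) = chart_diff (snd c') c x (rot p q x0 c x \<xi>)"
proof -
  let ?\<phi> = "chart_diff (snd c') c x" and ?g = "induced_metric p q x0 c x"
  interpret metric2 ?g using metric2_induced c by blast
  interpret c': metric2 "induced_metric p q x0 c' x" using metric2_induced c by blast
  have g: "induced_metric p q x0 c' x (?\<phi> \<alpha>) (?\<phi> \<beta>) = ?g \<alpha> \<beta>" for \<alpha> \<beta>
    unfolding induced_metric_def using chart_diff_transition[OF surface smooth_x0 c] by metis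
  have "?\<phi> (rot2 ?g \<xi>) = rot2 (induced_metric p q x0 c' x) (?\<phi> \<xi>)"
  proof (rule c'.rot2_unique)
    assume "?\<phi> \<xi> \<noteq> 0"
    then have "\<xi> \<noteq> 0"
      using linear_0[OF has_derivative_linear[OF transition_has_derivative[OF surface c]]] by metis
    then have "area2 \<xi> (rot2 ?g \<xi>) > 0"
      using area2_rot2[of \<xi>] pos W_pos by (metis zero_less_mult_pos)
    then show "area2 (?\<phi> \<xi>) (?\<phi> (rot2 ?g \<xi>)) > 0" by (rule area2_transition[OF surface c])
  qed (simp_all add: g g_rot2_rot2 g_rot2_self)
  then show ?thesis using rot_eq c by simp
qed

lemma moment_form_local:
  assumes c: "c \<in> \<A>" and u: "u \<in> snd c ` fst c"
  shows "moment_form p q K x0 H N c (chart_inv c u) \<xi> =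
    wedge (K *\<^sub>R (x0 \<circ> chart_inv c) u - H *\<^sub>R (N \<circ> chart_inv c) u)
      (local_immersion.S p q (x0 \<circ> chart_inv c) u \<xi>)"
proof -
  interpret local_immersion K p q "snd c ` fst c" "x0 \<circ> chart_inv c" "N \<circ> chart_inv c"
    by (rule local_immersion_chart[OF c])
  have "induced_metric p q x0 c (chart_inv c u) = g u"
    by (simp add: induced_metric_local[OF c] chart_chart_inv[OF u])
  then show ?thesis
    by (simp add: moment_form_def hodge_star_def rot_eq[OF c chart_inv_in[OF u]] S_def chart_diff_def
        chart_chart_inv[OF u])
qed

text \<open>The curvature hypothesis freed of the inverse matrix, in the shape of the premise
  \<open>H\<close> of \<open>ext_deriv_S\<close>.\<close>

lemma mean_curvature_local:
  assumes c: "c \<in> \<A>" and x: "x \<in> fst c"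
  defines "f \<equiv> x0 \<circ> chart_inv c" and "n \<equiv> N \<circ> chart_inv c" and "u \<equiv> snd c x"
  defines "m \<equiv> local_immersion.g p q f u" and "II \<equiv> local_immersion.h p q f n u"
  shows "m (axis 2 1) (axis 2 1) * II (axis 1 1) (axis 1 1) -
    m (axis 1 1) (axis 2 1) * II (axis 2 1) (axis 1 1) -
    m (axis 1 1) (axis 2 1) * II (axis 1 1) (axis 2 1) +
    m (axis 1 1) (axis 1 1) * II (axis 2 1) (axis 2 1) =
    2 * H * (local_immersion.w p q f u * local_immersion.w p q f u)"
proof -
  interpret local_immersion K p q "snd c ` fst c" f n
    unfolding f_def n_def by (rule local_immersion_chart[OF c])
  have u: "u \<in> snd c ` fst c" using x by (simp add: u_def)
  have xu: "chart_inv c u = x" using chart_inv_chart[OF surface c x] by (simp add: u_def)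
  interpret metric2 m unfolding m_def by (rule metric2_g[OF u])
  have g: "induced_metric p q x0 c x = m"
    using induced_metric_local[OF c, of x] by (simp add: m_def f_def u_def)
  have "chart_diff (\<lambda>y. chart_diff x0 c y \<eta>) c x = D (\<lambda>u. D f u \<eta>) u" for \<eta>
    unfolding chart_diff_def[of "\<lambda>y. chart_diff x0 c y \<eta>"] u_def[symmetric]
    by (rule frechet_derivative_cong_open[OF U u _ Df_smooth])
      (simp add: chart_diff_def f_def chart_chart_inv)
  then have "second_fund_form p q x0 N c x = II"
    unfolding II_def second_fund_form_def local_immersion.h_def[OF local_immersion_axioms, abs_def]
    by (simp add: n_def xu)
  then have "trace (matrix_inv (bilin_matrix m) ** bilin_matrix II) = 2 * H"
    using mean_curvature[OF c x] by (simp add: mean_curvature_def g)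
  moreover have "local_immersion.w p q f u = W" using w_eq[OF u] by (simp only: m_def)
  ultimately show ?thesis using mean_curvature_trace[of II] by simp
qed

lemma closed_moment_form: "closed_form \<A> (moment_form p q K x0 H N)"
  unfolding closed_form_def one_form_def
proof (intro conjI ballI allI)
  interpret wedge: bounded_bilinear wedge by (rule bounded_bilinear_wedge)
  fix c assume c: "c \<in> \<A>"
  let ?f = "x0 \<circ> chart_inv c" and ?n = "N \<circ> chart_inv c"
  interpret local_immersion K p q "snd c ` fst c" ?f ?n
    by (rule local_immersion_chart[OF c])
  let ?\<omega> = "\<lambda>\<xi> u. wedge (K *\<^sub>R ?f u - H *\<^sub>R ?n u) (S u \<xi>)"
  have smooth: "smooth_on (snd c ` fst c) (?\<omega> \<xi>)" for \<xi>
    by (intro smooth_on_bilinear[OF bounded_bilinear_wedge] smooth_on_minus smooth_on_scaleR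
        smooth_on_const U f n S_smooth)
  show "smooth_on (snd c ` fst c) (\<lambda>u. moment_form p q K x0 H N c (chart_inv c u) \<xi>)" for \<xi>
    by (rule smooth_on_cong[OF U _ smooth]) (simp add: moment_form_local[OF c])
  show "ext_deriv (moment_form p q K x0 H N) c x \<xi> \<eta> = 0" if x: "x \<in> fst c" for x \<xi> \<eta>
  proof -
    have u: "snd c x \<in> snd c ` fst c" using x by blast
    have "chart_diff (\<lambda>y. moment_form p q K x0 H N c y \<eta>) c x = D (?\<omega> \<eta>) (snd c x)" for \<eta>
      unfolding chart_diff_def
      by (rule frechet_derivative_cong_open[OF U u _ smooth]) (simp add: moment_form_local[OF c])
    then show ?thesis
      using moment_form_closed_local[OF u mean_curvature_local[OF c x]] by (simp add: ext_deriv_def)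
  qed
  show "linear (moment_form p q K x0 H N c x)" if x: "x \<in> fst c" for x
  proof -
    have u: "snd c x \<in> snd c ` fst c" using x by blast
    have "moment_form p q K x0 H N c x = (\<lambda>\<xi>. ?\<omega> \<xi> (snd c x))"
      using moment_form_local[OF c u] chart_inv_chart[OF surface c x] by auto
    then show ?thesis
      by (auto intro!: linearI simp: linear_add[OF linear_S[OF u]] linear_scale[OF linear_S[OF u]]
          wedge.add_right wedge.scaleR_right)
  qed
  show "moment_form p q K x0 H N c x \<xi> = moment_form p q K x0 H N c' x (chart_diff (snd c') c x \<xi>)"
    if "c' \<in> \<A>" "x \<in> fst c \<inter> fst c'" for c' x \<xi>
    using rot_transition[OF c that] chart_diff_transition[OF surface smooth_x0 c that]
    by (simp add: moment_form_def hodge_star_def)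
qed

text \<open>Contracting the area form with a vector amounts to minus its inner product with the
  rotated argument, and there the tangential part of the Killing field may be replaced by the field
  itself.\<close>

lemma area_form_tangent_part:
  assumes c: "c \<in> \<A>" and x: "x \<in> fst c"
  shows "area_form p q x0 c x (tangent_part p q x0 Y c x) \<xi> =
    - \<langle>killing_field p q Y (x0 x), chart_diff x0 c x (rot p q x0 c x \<xi>)\<rangle>"
proof -
  let ?f = "x0 \<circ> chart_inv c" and ?n = "N \<circ> chart_inv c" and ?u = "snd c x"
    and ?X = "chart_diff x0 c x" and ?V = "killing_field p q Y (x0 x)"
  interpret local_immersion K p q "snd c ` fst c" ?f ?n
    by (rule local_immersion_chart[OF c])
  have u: "?u \<in> snd c ` fst c" using x by blast
  interpret m: metric2 "induced_metric p q x0 c x" by (rule metric2_induced[OF c x])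
  have Xg: "\<langle>?X \<alpha>, ?X \<beta>\<rangle> = induced_metric p q x0 c x \<alpha> \<beta>" for \<alpha> \<beta> by (simp add: induced_metric_def)
  have lin: "linear ?X" using linear_D[OF f u] by (simp add: chart_diff_def)
  have xu: "chart_inv c ?u = x" by (rule chart_inv_chart[OF surface c x])
  have g: "g ?u = induced_metric p q x0 c x" by (rule induced_metric_local[OF c, symmetric])
  have SX: "S ?u \<xi> = ?X (rot2 (induced_metric p q x0 c x) \<xi>)" for \<xi>
    by (simp add: S_def g chart_diff_def)
  have Df: "D ?f ?u = ?X" by (simp add: chart_diff_def)
  \<comment> \<open>Components of the Killing field along the tangent vectors of the frame; they
    give the witness \<open>\<tau>\<close> for the definite description
    \<open>tangent_part\<close>.\<close>
  define a where "a = \<langle>?X (axis 1 1), ?V\<rangle> / g ?u (axis 1 1) (axis 1 1)"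
  define b where "b = \<langle>S ?u (axis 1 1), ?V\<rangle> / g ?u (axis 1 1) (axis 1 1)"
  define \<tau> where "\<tau> = a *\<^sub>R axis 1 1 + b *\<^sub>R rot2 (induced_metric p q x0 c x) (axis 1 1)"
  have "?V = (K * \<langle>x0 x, ?V\<rangle>) *\<^sub>R x0 x + \<langle>N x, ?V\<rangle> *\<^sub>R N x + ?X \<tau>"
    using frame_expand[OF u, of "axis 1 1" ?V]
    by (simp add: \<tau>_def linear_add[OF lin] linear_scale[OF lin] a_def b_def xu SX[symmetric]
        axis_eq_0_iff Df add.assoc)
  then have V: "?V - ?X \<tau> = (K * \<langle>x0 x, ?V\<rangle>) *\<^sub>R x0 x + \<langle>N x, ?V\<rangle> *\<^sub>R N x"
    by (metis add_diff_cancel_right')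
  have xX: "\<langle>x0 x, ?X \<xi>\<rangle> = 0" for \<xi> using f_Df[OF u, of \<xi>] by (simp add: chart_diff_def xu)
  have \<tau>: "\<langle>?V - ?X \<tau>, ?X \<xi>\<rangle> = 0" for \<xi>
    unfolding V using xX normal_at(3)[OF c x] by (simp add: pq_form_simps)
  have "tangent_part p q x0 Y c x = \<tau>"
    unfolding tangent_part_def
  proof (rule the_equality)
    show "\<forall>\<xi>. \<langle>?V - ?X \<tau>, ?X \<xi>\<rangle> = 0" using \<tau> by blast
    fix \<sigma> assume \<sigma>: "\<forall>\<xi>. \<langle>?V - ?X \<sigma>, ?X \<xi>\<rangle> = 0"
    have "induced_metric p q x0 c x (\<sigma> - \<tau>) (\<sigma> - \<tau>) = \<langle>?V - ?X \<tau>, ?X (\<sigma> - \<tau>)\<rangle> - \<langle>?V - ?X \<sigma>, ?X (\<sigma> - \<tau>)\<rangle>"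
      unfolding Xg[symmetric] by (simp add: linear_diff[OF lin] pq_form_simps)
    then show "\<sigma> = \<tau>" using \<sigma> \<tau> m.pos[of "\<sigma> - \<tau>"] by auto
  qed
  moreover have "area_form p q x0 c x \<tau> \<xi> = - induced_metric p q x0 c x \<tau> (rot p q x0 c x \<xi>)"
    using m.g_rot2[of \<xi> \<tau>] m.sym[of \<tau>] area2_simps(1)[of \<xi> \<tau>]
    by (simp add: area_form_def m.W_def rot_eq[OF c x])
  moreover have "\<langle>?V, ?X (rot p q x0 c x \<xi>)\<rangle> = induced_metric p q x0 c x \<tau> (rot p q x0 c x \<xi>)"
    using \<tau>[of "rot p q x0 c x \<xi>"] by (simp add: Xg[symmetric] pq_form_simps)
  ultimately show ?thesis by simp
qed

text \<open>Translates the pairing into Killing fields. On decomposable bivectors the two formulas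
  differ exactly by the sign.\<close>

lemma bivector_inner_wedge_killing:
  assumes "Y \<in> bivectors"
  shows "bivector_inner p q (wedge a b) Y = - \<langle>killing_field p q Y a, b\<rangle>"
proof -
  have "linear (\<lambda>Y. - \<langle>killing_field p q Y a, b\<rangle>)"
    by (rule linearI) (simp_all add: linear_add[OF linear_killing_field] linear_scale[OF linear_killing_field] pq_form_simps)
  from bivectors_linear_expand[OF this assms] bivectors_linear_expand[OF linear_bivector_inner assms, of p q "wedge a b"]
  show ?thesis
    by (simp add: bivector_inner_wedge killing_field_wedge pq_form_simps pq_form_commute[of p q a]
        pq_form_commute[of p q b] mult.commute)
qed

text \<open>For the primitive of \<open>primitive_on_killing_field\<close> the form defining the moment class is equal
  to the moment form, not just cohomologous to it.\<close>

lemma moment_form_eq: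
  assumes Y: "Y \<in> bivectors" and c: "c \<in> \<A>" and x: "x \<in> fst c"
    and k: "\<And>v u w z. v \<in> space_form p q K \<Longrightarrow> u \<in> tangent p q v \<Longrightarrow> w \<in> tangent p q v \<Longrightarrow>
      z \<in> tangent p q v \<Longrightarrow> vol v u w z = k v * det4 v u w z"
  shows "area_form p q x0 c x (tangent_part p q x0 Y c x) \<xi> -
      2 * H * (- (k (x0 x) / (2 * K)) * bivector_det Y (x0 x) (chart_diff x0 c x \<xi>)) =
    bivector_inner p q (moment_form p q K x0 H N c x \<xi>) Y / K"
proof -
  let ?X = "chart_diff x0 c x" and ?V = "killing_field p q Y (x0 x)" and ?J = "rot p q x0 c x"
  interpret m: metric2 "induced_metric p q x0 c x" by (rule metric2_induced[OF c x])
  have xX: "\<langle>x0 x, ?X \<eta>\<rangle> = 0" for \<eta>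
    using local_immersion.f_Df[OF local_immersion_chart[OF c], of "snd c x" \<eta>] x
    by (simp add: chart_diff_def chart_inv_chart[OF surface c x])
  have lin: "linear ?X"
    using has_derivative_linear[OF chart_diff_has_derivative[OF surface smooth_x0 c x]] .
  have "k (x0 x) * bivector_det Y (x0 x) (?X \<xi>) = - bivector_inner p q (wedge (N x) (?X (?J \<xi>))) Y"
  proof (cases "\<xi> = 0")
    \<comment> \<open>The frame degenerates here, but both sides vanish.\<close>
    case True
    then have "?X \<xi> = 0" "?X (?J \<xi>) = 0"
      using linear_0[OF lin] linear_0[OF m.linear_rot2] by (simp_all add: rot_eq[OF c x])
    moreover have "bivector_inner p q (wedge (N x) 0) Y = 0"
      using bivector_inner_wedge_killing[OF Y] by (simp add: pq_form_simps)
    ultimately show ?thesis using linear_0[OF linear_bivector_det(2)] by simp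
  next
    case False
    let ?r = "induced_metric p q x0 c x \<xi> \<xi>"
    have r: "?r > 0" by (rule m.pos[OF False])
    \<comment> \<open>The orientation of the normal enters: the volume form on \<open>N\<close>, a
      tangent vector and its rotation is the area of a square, the squared length of that
      vector.\<close>
    have "k (x0 x) * det4 (x0 x) (N x) (?X \<xi>) (?X (?J \<xi>)) = area_form p q x0 c x \<xi> (?J \<xi>)"
      using k[OF x0_in[OF c x], of "N x" "?X \<xi>" "?X (?J \<xi>)"] normal_at[OF c x] xX by (simp add: tangent_def)
    also have "\<dots> = ?r"
      using m.area2_rot2[of \<xi>] by (simp add: area_form_def m.W_def rot_eq[OF c x])
    finally have "k (x0 x) * det4 (x0 x) (N x) (?X \<xi>) (?X (?J \<xi>)) = ?r" .
    then show ?thesis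
      using x0_in[OF c x] K r normal_at[OF c x] xX m.g_rot2_self[of \<xi>] m.g_rot2_rot2[of \<xi>]
      by (intro bivector_det_orthogonal_frame[OF Y, where r="?r"])
        (simp_all add: space_form_def rot_eq[OF c x] flip: induced_metric_def)
  qed
  \<comment> \<open>The 2 of \<open>2 * H\<close> cancels that of the primitive, leaving the factor
    1/K.\<close>
  then have "- 2 * H * (- (k (x0 x) / (2 * K)) * bivector_det Y (x0 x) (?X \<xi>)) =
      - H * bivector_inner p q (wedge (N x) (?X (?J \<xi>))) Y / K"
    using K by (simp add: field_simps)
  moreover have "bivector_inner p q (moment_form p q K x0 H N c x \<xi>) Y =
      - K * \<langle>?V, ?X (?J \<xi>)\<rangle> - H * bivector_inner p q (wedge (N x) (?X (?J \<xi>))) Y"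
  proof -
    have "linear (killing_field p q Y)"
      by (rule linearI) (simp_all add: killing_field_def pq_form_simps sum.distrib scaleR_sum_right algebra_simps)
    then show ?thesis
      by (simp add: moment_form_def hodge_star_def bivector_inner_wedge_killing[OF Y] linear_diff
          linear_scale pq_form_simps)
  qed
  ultimately show ?thesis
    using K by (simp add: area_form_tangent_part[OF c x] diff_divide_distrib)
qed

text \<open>For the explicit primitive both sides have the same representative; replacing it by the
  chosen one changes the form by the pullback of a closed, hence exact, form on M.\<close>

lemma moment_class_eq:
  assumes Y: "Y \<in> bivectors"
  shows "moment_class p q K vol \<A> x0 H Y =
    H1_class \<A> (\<lambda>c x \<xi>. bivector_inner p q (moment_form p q K x0 H N c x \<xi>) Y / K)"
proof -
  have "\<exists>k. \<forall>v\<in>space_form p q K. (k v)\<^sup>2 = \<bar>K\<bar> \<and>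
      (\<forall>u\<in>tangent p q v. \<forall>w\<in>tangent p q v. \<forall>z\<in>tangent p q v. vol v u w z = k v * det4 v u w z)"
    by (rule bchoice) (use volume_form_eq_det4[OF vol] in blast)
  then obtain k where sq: "\<And>v. v \<in> space_form p q K \<Longrightarrow> (k v)\<^sup>2 = \<bar>K\<bar>"
    and k: "\<And>v u w z. v \<in> space_form p q K \<Longrightarrow> u \<in> tangent p q v \<Longrightarrow> w \<in> tangent p q v \<Longrightarrow>
      z \<in> tangent p q v \<Longrightarrow> vol v u w z = k v * det4 v u w z"
    by blast
  define \<alpha>0 where "\<alpha>0 = (\<lambda>v w. - (k v / (2 * K)) * bivector_det Y v w)"
  \<comment> \<open>The primitive selected by the definition; nothing is known of it but that it is
    one.\<close>
  define \<alpha> where "\<alpha> = (SOME \<alpha>. primitive_on p q K \<alpha> (\<lambda>v. vol v (killing_field p q Y v)))"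
  have \<alpha>0: "primitive_on p q K \<alpha>0 (\<lambda>v. vol v (killing_field p q Y v))"
    unfolding \<alpha>0_def by (rule primitive_on_killing_field[OF vol Y]) (rule sq k; assumption)+
  then have "primitive_on p q K \<alpha> (\<lambda>v. vol v (killing_field p q Y v))"
    unfolding \<alpha>_def by (rule someI[of "\<lambda>\<alpha>. primitive_on p q K \<alpha> (\<lambda>v. vol v (killing_field p q Y v))"])
  from closed_form_on_space_form_exact[OF primitive_on_diff[OF this \<alpha>0]]
  obtain F where F: "smooth_on pos_cone F"
      "\<And>y w. y \<in> space_form p q K \<Longrightarrow> w \<in> tangent p q y \<Longrightarrow> frechet_derivative F (at y) w = \<alpha> y w - \<alpha>0 y w"
    by blast
  have x0_cone: "(x0 \<circ> chart_inv c) ` (snd c ` fst c) \<subseteq> pos_cone" if "c \<in> \<A>" for c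
    using x0_in[OF that chart_inv_in] space_form_subset_cone by fastforce
  have "exact_form \<A> (\<lambda>c x \<xi>. \<alpha> (x0 x) (chart_diff x0 c x \<xi>) - \<alpha>0 (x0 x) (chart_diff x0 c x \<xi>))"
    unfolding exact_form_def
  \<comment> \<open>The potential on the cone, pulled back by the immersion, whose differential
    takes values in tangent vectors of M.\<close>
  proof (intro exI[of _ "F \<circ> x0"] conjI ballI allI)
    show "smooth_fun \<A> (F \<circ> x0)"
      unfolding smooth_fun_def
    proof
      fix c assume c: "c \<in> \<A>"
      then show "smooth_on (snd c ` fst c) (F \<circ> x0 \<circ> chart_inv c)"
        using smooth_on_compose[OF F(1) open_chart[OF surface c] open_cone x0_cone[OF c]] smooth_x0
        by (simp add: smooth_fun_def o_def)
    qed
    fix c x \<xi> assume c: "c \<in> \<A>" and x: "x \<in> fst c"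
    let ?X = "chart_diff x0 c x"
    have M: "x0 x \<in> space_form p q K" by (rule x0_in[OF c x])
    have "\<langle>x0 x, ?X \<xi>\<rangle> = 0"
      using local_immersion.f_Df[OF local_immersion_chart[OF c], of "snd c x" \<xi>] x
      by (simp add: chart_diff_def chart_inv_chart[OF surface c x])
    then have "\<alpha> (x0 x) (?X \<xi>) - \<alpha>0 (x0 x) (?X \<xi>) = frechet_derivative F (at (x0 x)) (?X \<xi>)"
      using F(2)[OF M] by (simp add: tangent_def)
    also have "\<dots> = chart_diff (F \<circ> x0) c x \<xi>"
    proof -
      have "(F has_derivative frechet_derivative F (at (x0 x))) (at ((x0 \<circ> chart_inv c) (snd c x)))"
        using smooth_on_has_derivative[OF F(1)] M space_form_subset_cone chart_inv_chart[OF surface c x] by auto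
      from fun_cong[OF frechet_derivative_at[OF has_derivative_compose[OF
          chart_diff_has_derivative[OF surface smooth_x0 c x] this]], where x=\<xi>]
      show ?thesis by (simp add: chart_diff_def o_def)
    qed
    finally show "\<alpha> (x0 x) (?X \<xi>) - \<alpha>0 (x0 x) (?X \<xi>) = chart_diff (F \<circ> x0) c x \<xi>" .
  qed
  from exact_form_bounded_linear[OF surface bounded_linear_mult_right this, of "- 2 * H"]
  have ex: "exact_form \<A> (\<lambda>c x \<xi>. - 2 * H * (\<alpha> (x0 x) (chart_diff x0 c x \<xi>) - \<alpha>0 (x0 x) (chart_diff x0 c x \<xi>)))" .
  have "exact_form \<A> (\<lambda>c x \<xi>. (area_form p q x0 c x (tangent_part p q x0 Y c x) \<xi> -
      2 * H * \<alpha> (x0 x) (chart_diff x0 c x \<xi>)) - bivector_inner p q (moment_form p q K x0 H N c x \<xi>) Y / K)"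
  proof -
    have "area_form p q x0 c x (tangent_part p q x0 Y c x) \<xi> - 2 * H * \<alpha> (x0 x) (chart_diff x0 c x \<xi>) -
        bivector_inner p q (moment_form p q K x0 H N c x \<xi>) Y / K =
        - 2 * H * (\<alpha> (x0 x) (chart_diff x0 c x \<xi>) - \<alpha>0 (x0 x) (chart_diff x0 c x \<xi>))"
      if "c \<in> \<A>" "x \<in> fst c" for c x \<xi>
    proof -
      have "area_form p q x0 c x (tangent_part p q x0 Y c x) \<xi> - 2 * H * \<alpha>0 (x0 x) (chart_diff x0 c x \<xi>) =
          bivector_inner p q (moment_form p q K x0 H N c x \<xi>) Y / K"
        unfolding \<alpha>0_def by (rule moment_form_eq[OF Y that]) (rule k; assumption)
      then show ?thesis by (simp add: algebra_simps)
    qed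
    with ex show ?thesis unfolding exact_form_def by simp
  qed
  then show ?thesis
    unfolding moment_class_def Let_def \<alpha>_def[symmetric] by (rule H1_class_eqI[OF surface])
qed

end

theorem proposition4p9:
  fixes K H :: real and p q :: nat
    and vol\<^sub>M :: "real^4 \<Rightarrow> real^4 \<Rightarrow> real^4 \<Rightarrow> real^4 \<Rightarrow> real"
    and X :: "'a topology" and \<A> :: "'a chart set"
    and x0 N :: "'a \<Rightarrow> real^4"
  assumes "K \<noteq> 0"
    and "(p, q) = (if K > 0 then (4, 0) else (3, 1))"
    and "volume_form p q K vol\<^sub>M"
    and "oriented_surface X \<A>"
    and "immersion_into p q K X \<A> x0"
    and "unit_normal p q \<A> vol\<^sub>M x0 N"
    and "\<forall>c\<in>\<A>. \<forall>x\<in>fst c. mean_curvature p q x0 N c x = H"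
  shows "closed_form \<A> (moment_form p q K x0 H N) \<and>
    (\<forall>Y\<in>bivectors. moment_class p q K vol\<^sub>M \<A> x0 H Y =
       H1_class \<A> (\<lambda>c x \<xi>. bivector_inner p q (moment_form p q K x0 H N c x \<xi>) Y / K))"
proof -
  interpret cmc_immersion K p q vol\<^sub>M X \<A> x0 N H
    by unfold_locales (use assms in auto)
  show ?thesis using closed_moment_form moment_class_eq by blast
qed

end
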